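(* Let $T$ be a 3-sufficiently subdivided finite tree with at least one essential vertex. Then $\mathcal D^3T$ is $\mathcal S_3$-equivariantly homotopy equivalent to the following directed multigraph $G(3,T)$. Its vertices are the six permutations $ijk$ of $012$ (with $ijk$ standing for the configuration $(i,j,k)$, and $\mathcal S_3$ acting by permuting coordinates). Its edges are: $m_2+m_3$ edges along each of the directed pairs $012\to201$, $201\to120$, $120\to012$, $102\to021$, $021\to210$, $210\to102$, and $m_2+m_3$ edges in each direction between each of the pairs $\{012,102\}$, $\{201,210\}$, $\{120,021\}$; plus $m_2$ edges in each direction between each of the pairs $\{201,102\}$, $\{012,021\}$, $\{120,210\}$. The action of $\mu\in\mathcal S_3$ sends each edge from $x$ to $y$ homeomorphically, preserving orientation, onto an edge from $x\cdot\mu$ to $y\cdot\mu$ of the same family (multiplicity class).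
   Context: A tree $T$ is $n$-sufficiently subdivided if every path between distinct vertices of degree $\neq2$ passes through at least $n-1$ edges. An essential vertex is a vertex of degree at least $3$. The discretized configuration space $\mathcal D^nT$ is the subcomplex of the product cell complex $T^n$ consisting of cells $(a_1,\dots,a_n)$ with pairwise disjoint closures; $\mathcal S_n$ acts by $(a_1,\dots,a_n)\cdot\sigma=(a_{\sigma(1)},\dots,a_{\sigma(n)})$. For $r\ge1$, $m_r=\sum_v\binom{d(v)-1}{r}$ over vertices $v$ with degree $d(v)>r$. Vertices of $T$ are numbered $0,1,2,\dots$ in the order of a depth-first (leftmost-branch-first) walk from a root $0$ of degree one in a planar embedding. *)

theory Defs
  imports "HOL-Analysis.Analysis"
begin

definition deg :: "nat set set \<Rightarrow> nat \<Rightarrow> nat" where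
  "deg E v = card {e \<in> E. v \<in> e}"

definition is_path :: "nat set set \<Rightarrow> nat list \<Rightarrow> bool" where
  "is_path E p \<longleftrightarrow> p \<noteq> [] \<and> distinct p \<and>
     (\<forall>i. Suc i < length p \<longrightarrow> {p ! i, p ! Suc i} \<in> E)"

definition is_cycle :: "nat set set \<Rightarrow> nat list \<Rightarrow> bool" where
  "is_cycle E c \<longleftrightarrow> length c \<ge> 3 \<and> is_path E c \<and> {last c, hd c} \<in> E"

definition finite_tree :: "nat set \<Rightarrow> nat set set \<Rightarrow> bool" where
  "finite_tree V E \<longleftrightarrow> finite V \<and> V \<noteq> {} \<and>
     E \<subseteq> {{u, v} | u v. u \<in> V \<and> v \<in> V \<and> u \<noteq> v} \<and>
     (\<forall>u\<in>V. \<forall>v\<in>V. \<exists>p. is_path E p \<and> hd p = u \<and> last p = v) \<and>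
     \<not> (\<exists>c. is_cycle E c)"

definition suff_subdivided :: "nat \<Rightarrow> nat set set \<Rightarrow> bool" where
  "suff_subdivided n E \<longleftrightarrow>
     (\<forall>p. is_path E p \<and> hd p \<noteq> last p \<and> deg E (hd p) \<noteq> 2 \<and> deg E (last p) \<noteq> 2
          \<longrightarrow> length p - 1 \<ge> n - 1)"

definition essential :: "nat set set \<Rightarrow> nat \<Rightarrow> bool" where
  "essential E v \<longleftrightarrow> deg E v \<ge> 3"

definition m_num :: "nat set \<Rightarrow> nat set set \<Rightarrow> nat \<Rightarrow> nat" where
  "m_num V E r = (\<Sum>v\<in>{v \<in> V. deg E v > r}. (deg E v - 1) choose r)"

text \<open>Cells of T: the vertex cells {v} and the edge cells e (identified with their
  vertex sets). The closed cell is realized in barycentric coordinates in nat \<Rightarrow> real.\<close>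

definition cells :: "nat set \<Rightarrow> nat set set \<Rightarrow> nat set set" where
  "cells V E = {{v} | v. v \<in> V} \<union> E"

definition closed_cell :: "nat set \<Rightarrow> (nat \<Rightarrow> real) set" where
  "closed_cell c = {x. (\<forall>i. 0 \<le> x i) \<and> (\<forall>i. i \<notin> c \<longrightarrow> x i = 0) \<and> (\<Sum>i\<in>c. x i) = 1}"

definition conf_cells :: "nat \<Rightarrow> nat set \<Rightarrow> nat set set \<Rightarrow> (nat \<Rightarrow> nat set) set" where
  "conf_cells n V E = {a. (\<forall>i<n. a i \<in> cells V E) \<and> (\<forall>i\<ge>n. a i = {}) \<and>
      (\<forall>i<n. \<forall>j<n. i \<noteq> j \<longrightarrow> closed_cell (a i) \<inter> closed_cell (a j) = {})}"

text \<open>The space D^n T: union of the closed product cells, a subset of nat \<Rightarrow> (nat \<Rightarrow> real)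
  (position i \<mapsto> point of T), carrying the subspace of the product topology.\<close>
definition DConf :: "nat \<Rightarrow> nat set \<Rightarrow> nat set set \<Rightarrow> (nat \<Rightarrow> nat \<Rightarrow> real) set" where
  "DConf n V E = (\<Union>a\<in>conf_cells n V E.
      {x. (\<forall>i<n. x i \<in> closed_cell (a i)) \<and> (\<forall>i\<ge>n. x i = (\<lambda>_. 0))})"

definition conf_act :: "(nat \<Rightarrow> nat) \<Rightarrow> (nat \<Rightarrow> 'a) \<Rightarrow> (nat \<Rightarrow> 'a)" where
  "conf_act \<sigma> x = (\<lambda>i. x (\<sigma> i))"

definition Sym :: "nat \<Rightarrow> (nat \<Rightarrow> nat) set" where
  "Sym n = {\<sigma>. \<sigma> permutes {0..<n}}"

definition equivariant ::
  "'g set \<Rightarrow> 'a topology \<Rightarrow> ('g \<Rightarrow> 'a \<Rightarrow> 'a) \<Rightarrow> ('g \<Rightarrow> 'b \<Rightarrow> 'b) \<Rightarrow> ('a \<Rightarrow> 'b) \<Rightarrow> bool" where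
  "equivariant G X actX actY f \<longleftrightarrow>
     (\<forall>g\<in>G. \<forall>x\<in>topspace X. f (actX g x) = actY g (f x))"

definition equiv_homotopy_equivalent ::
  "'g set \<Rightarrow> 'a topology \<Rightarrow> ('g \<Rightarrow> 'a \<Rightarrow> 'a) \<Rightarrow> 'b topology \<Rightarrow> ('g \<Rightarrow> 'b \<Rightarrow> 'b) \<Rightarrow> bool" where
  "equiv_homotopy_equivalent G X actX Y actY \<longleftrightarrow>
     (\<exists>f g. continuous_map X Y f \<and> continuous_map Y X g \<and>
        equivariant G X actX actY f \<and> equivariant G Y actY actX g \<and>
        homotopic_with (equivariant G X actX actX) X X (g \<circ> f) id \<and>
        homotopic_with (equivariant G Y actY actY) Y Y (f \<circ> g) id)"

definition pv :: "nat \<Rightarrow> nat \<Rightarrow> nat \<Rightarrow> (nat \<Rightarrow> nat)" where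
  "pv i j k = (\<lambda>n. if n = 0 then i else if n = 1 then j else if n = 2 then k else n)"

definition G3_vertices :: "(nat \<Rightarrow> nat) set" where
  "G3_vertices = {pv 0 1 2, pv 0 2 1, pv 1 0 2, pv 1 2 0, pv 2 0 1, pv 2 1 0}"

definition both_ways :: "('a \<times> 'a) set \<Rightarrow> ('a \<times> 'a) set" where
  "both_ways P = P \<union> {(y, x) | x y. (x, y) \<in> P}"

definition fam_pairs :: "nat \<Rightarrow> ((nat \<Rightarrow> nat) \<times> (nat \<Rightarrow> nat)) set" where
  "fam_pairs f =
    (if f = 0 then
       {(pv 0 1 2, pv 2 0 1), (pv 2 0 1, pv 1 2 0), (pv 1 2 0, pv 0 1 2),
        (pv 1 0 2, pv 0 2 1), (pv 0 2 1, pv 2 1 0), (pv 2 1 0, pv 1 0 2)}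
     else if f = 1 then
       both_ways {(pv 0 1 2, pv 1 0 2), (pv 2 0 1, pv 2 1 0), (pv 1 2 0, pv 0 2 1)}
     else if f = 2 then
       both_ways {(pv 2 0 1, pv 1 0 2), (pv 0 1 2, pv 0 2 1), (pv 1 2 0, pv 2 1 0)}
     else {})"

definition fam_mult :: "nat set \<Rightarrow> nat set set \<Rightarrow> nat \<Rightarrow> nat" where
  "fam_mult V E f = (if f = 2 then m_num V E 2 else m_num V E 2 + m_num V E 3)"

type_synonym gedge = "nat \<times> (nat \<Rightarrow> nat) \<times> (nat \<Rightarrow> nat) \<times> nat"
type_synonym gidx = "(nat \<Rightarrow> nat) + gedge"

definition G3_edges :: "nat set \<Rightarrow> nat set set \<Rightarrow> gedge set" where
  "G3_edges V E = {(f, x, y, k) | f x y k. f < 3 \<and> (x, y) \<in> fam_pairs f \<and> k < fam_mult V E f}"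

text \<open>Geometric realization of the multigraph, embedded in gidx \<Rightarrow> real:
  vertex p is the indicator of Inl p; the point at parameter t of edge e from x to y is
  (1-t) Inl x + t Inl y + min t (1-t) Inr e.\<close>
definition gvert :: "(nat \<Rightarrow> nat) \<Rightarrow> gidx \<Rightarrow> real" where
  "gvert p = (\<lambda>j. if j = Inl p then 1 else 0)"

definition gpt :: "gedge \<Rightarrow> real \<Rightarrow> gidx \<Rightarrow> real" where
  "gpt e t = (case e of (f, x, y, k) \<Rightarrow>
      (\<lambda>j. (if j = Inl x then 1 - t else 0) + (if j = Inl y then t else 0) +
           (if j = Inr e then min t (1 - t) else 0)))"

definition G3_real :: "nat set \<Rightarrow> nat set set \<Rightarrow> (gidx \<Rightarrow> real) set" where
  "G3_real V E = gvert ` G3_vertices \<union> (\<Union>e\<in>G3_edges V E. gpt e ` {0..1})"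

definition G3_action :: "nat set \<Rightarrow> nat set set \<Rightarrow> ((nat \<Rightarrow> nat) \<Rightarrow> (gidx \<Rightarrow> real) \<Rightarrow> (gidx \<Rightarrow> real)) \<Rightarrow> bool" where
  "G3_action V E act \<longleftrightarrow>
     (\<forall>\<mu>\<in>Sym 3. act \<mu> ` G3_real V E \<subseteq> G3_real V E) \<and>
     (\<forall>z\<in>G3_real V E. act id z = z) \<and>
     (\<forall>\<mu>\<in>Sym 3. \<forall>\<nu>\<in>Sym 3. \<forall>z\<in>G3_real V E. act (\<mu> \<circ> \<nu>) z = act \<nu> (act \<mu> z)) \<and>
     (\<forall>\<mu>\<in>Sym 3. \<forall>p\<in>G3_vertices. act \<mu> (gvert p) = gvert (p \<circ> \<mu>)) \<and>
     (\<forall>\<mu>\<in>Sym 3. \<forall>f x y k. (f, x, y, k) \<in> G3_edges V E \<longrightarrow>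
        (\<exists>k'. (f, x \<circ> \<mu>, y \<circ> \<mu>, k') \<in> G3_edges V E \<and>
              (\<forall>t\<in>{0..1}. act \<mu> (gpt (f, x, y, k) t) = gpt (f, x \<circ> \<mu>, y \<circ> \<mu>, k') t)))"

end

theory Submission
  imports Defs
begin

text \<open>The complex is built up along a growing subtree, starting from a star with three edges. Each step adds
  either a cell together with a free face, which does not change the equivariant homotopy type, or a
  one-dimensional cell, whose orbit under the symmetric group attaches six arcs. In a path connected
  complex the ends of an arc can be slid anywhere, so that, up to equivariant homotopy equivalence, only
  the number of orbits of arcs matters. To reach connectedness, the first two orbits are placed by hand:
  at an essential vertex, lengthening one of the three branches makes the configurations on the other
  two exchange, and the two transpositions so obtained generate the symmetric group. The total number
  of orbits of arcs, summed over the branches, is \<open>3 m\<^sub>2 + 2 m\<^sub>3\<close>, the number of orbits of edges of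
  the graph.\<close>

section \<open>Equivariant homotopy equivalences and attached arcs\<close>

text \<open>Why no cell above dimension one has to be attached: when a leaf \<open>w\<close> is
  glued to \<open>u\<close>, the cells with the edge \<open>{u, w}\<close> form a cylinder over the
  configurations in \<open>W - {u}\<close>. It collapses to its end at \<open>u\<close>, and there
  remains \<open>{w}\<close> times the difference between \<open>D E n W\<close> and
  \<open>D E n (W - {u})\<close>. So the number of points drops by one. For one point the difference
  is \<open>u\<close> with its edges: one edge is an expansion, the others are arcs. The obstacle is
  two points near a vertex \<open>u\<close> that gets a new branch: there the difference is counted
  directly, and this needs neighbours of degree 2 in the current subtree. Hence such a branch grows
  by two vertices at a time. At a vertex of degree k these cost k (k - 1) and k - 1 arcs, together 3
  (k - 1) + 2 binom(k - 1, 2), which is the growth of 3 m_2 + 2 m_3. In the graph, each family of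
  directed pairs is one free orbit, which gives (m_2 + m_3) + (m_2 + m_3) + m_2 orbits of edges.
  Freeness of the action lets an equivariant map or homotopy be prescribed at will on one arc of
  each orbit, subject only to its ends.\<close>

lemma Sym_id: "id \<in> Sym n"
  by (simp add: Sym_def permutes_id)

lemma Sym_comp: "g \<in> Sym n \<Longrightarrow> h \<in> Sym n \<Longrightarrow> g \<circ> h \<in> Sym n"
  by (simp add: Sym_def permutes_compose)

lemma Sym_inv: "g \<in> Sym n \<Longrightarrow> inv g \<in> Sym n"
  by (simp add: Sym_def permutes_inv)

lemma Sym_inv_o: "g \<in> Sym n \<Longrightarrow> g \<circ> inv g = id" "g \<in> Sym n \<Longrightarrow> inv g \<circ> g = id"
  by (auto simp: Sym_def dest: permutes_inv_o)

lemma finite_Sym: "finite (Sym n)"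
  unfolding Sym_def by (rule finite_permutations) simp

text \<open>A right action, to match \<open>conf_act\<close>, which precomposes with the
  permutation. It is required on the whole ambient type; stability of a subspace is the separate
  condition \<open>ginv\<close>.\<close>

definition gact :: "((nat \<Rightarrow> nat) \<Rightarrow> 'a::topological_space \<Rightarrow> 'a) \<Rightarrow> bool" where
  "gact act \<longleftrightarrow> (\<forall>g\<in>Sym 3. continuous_on UNIV (act g)) \<and> (\<forall>x. act id x = x) \<and>
     (\<forall>g\<in>Sym 3. \<forall>h\<in>Sym 3. \<forall>x. act (g \<circ> h) x = act h (act g x))"

lemma gact_inv:
  assumes "gact act" "g \<in> Sym 3"
  shows "act (inv g) (act g x) = x" "act g (act (inv g) x) = x"
  using assms Sym_inv[of g 3] Sym_inv_o[of g 3] unfolding gact_def by metis+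

definition ginv :: "((nat \<Rightarrow> nat) \<Rightarrow> 'a \<Rightarrow> 'a) \<Rightarrow> 'a set \<Rightarrow> bool" where
  "ginv act X \<longleftrightarrow> (\<forall>g\<in>Sym 3. \<forall>x\<in>X. act g x \<in> X)"

lemma ginv_iff:
  assumes "gact act" "ginv act X" "g \<in> Sym 3"
  shows "act g x \<in> X \<longleftrightarrow> x \<in> X"
  using assms gact_inv[OF assms(1,3)] Sym_inv[OF assms(3)] unfolding ginv_def by metis

definition gmap where
  "gmap X actX Y actY f \<longleftrightarrow> continuous_on X f \<and> f ` X \<subseteq> Y \<and>
     (\<forall>g\<in>Sym 3. \<forall>x\<in>X. f (actX g x) = actY g (f x))"

definition ghom where
  "ghom X actX Y actY f f' \<longleftrightarrow>
     homotopic_with (equivariant (Sym 3) (top_of_set X) actX actY) (top_of_set X) (top_of_set Y) f f'"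

text \<open>Unfolding \<open>homotopic_with\<close> in this way requires a property that depends
  only on values on \<open>X\<close>. Equivariance also looks at the value at
  \<open>actX g x\<close>, hence the invariance of \<open>X\<close>.\<close>

lemma ghom_iff:
  assumes "ginv actX X"
  shows "ghom X actX Y actY f f' \<longleftrightarrow>
    (\<exists>h::real \<times> 'a::topological_space \<Rightarrow> 'b::topological_space.
       continuous_on ({0..1} \<times> X) h \<and> h ` ({0..1} \<times> X) \<subseteq> Y \<and>
       (\<forall>x\<in>X. h (0, x) = f x) \<and> (\<forall>x\<in>X. h (1, x) = f' x) \<and>
       (\<forall>t\<in>{0..1}. \<forall>g\<in>Sym 3. \<forall>x\<in>X. h (t, actX g x) = actY g (h (t, x))))"
proof -
  have *: "equivariant (Sym 3) (top_of_set X) actX actY h = equivariant (Sym 3) (top_of_set X) actX actY k"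
    if "\<And>x. x \<in> topspace (top_of_set X) \<Longrightarrow> h x = k x" for h k
    using that assms by (auto simp: equivariant_def ginv_def)
  show ?thesis
    unfolding ghom_def
    by (subst homotopic_with[OF *], assumption)
       (simp add: equivariant_def prod_topology_subtopology_eu image_subset_iff_funcset)
qed

lemma ghom_sym: "ghom X a Y b f f' \<Longrightarrow> ghom X a Y b f' f"
  unfolding ghom_def by (rule homotopic_with_symD)

lemma ghom_trans [trans]: "ghom X a Y b f f' \<Longrightarrow> ghom X a Y b f' f'' \<Longrightarrow> ghom X a Y b f f''"
  unfolding ghom_def by (rule homotopic_with_trans)

lemma gmap_ghom_refl: "gmap X a Y b f \<Longrightarrow> ghom X a Y b f f"
  unfolding ghom_def gmap_def by (auto simp: equivariant_def)

lemma gmap_comp: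
  assumes "gmap X a Y b f" "gmap Y b Z c h"
  shows "gmap X a Z c (h \<circ> f)"
  using assms unfolding gmap_def
  by (auto intro: continuous_on_compose2 simp: image_subset_iff)

lemma ghom_imp_gmap:
  assumes "ghom X a Y b f f'"
  shows "gmap X a Y b f" "gmap X a Y b f'"
  using homotopic_with_imp_continuous_maps[OF assms[unfolded ghom_def]]
    homotopic_with_imp_property[OF assms[unfolded ghom_def]]
  by (auto simp: gmap_def equivariant_def)

lemma ghom_cong:
  assumes "ginv a X" "ghom X a Y b f f'" "\<And>x. x \<in> X \<Longrightarrow> f x = k x" "\<And>x. x \<in> X \<Longrightarrow> f' x = k' x"
  shows "ghom X a Y b k k'"
  using assms(2-4) unfolding ghom_iff[OF assms(1)] by simp

lemma ghom_comp_left: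
  assumes "ginv a X" "ghom X a Y b f f'" "gmap Y b Z c h"
  shows "ghom X a Z c (h \<circ> f) (h \<circ> f')"
proof -
  obtain k where "continuous_on ({0..1} \<times> X) k" "k ` ({0..1::real} \<times> X) \<subseteq> Y"
       "\<forall>x\<in>X. k (0, x) = f x" "\<forall>x\<in>X. k (1, x) = f' x"
       "\<forall>t\<in>{0..1}. \<forall>g\<in>Sym 3. \<forall>x\<in>X. k (t, a g x) = b g (k (t, x))"
    using assms(2) unfolding ghom_iff[OF assms(1)] by blast
  then show ?thesis
    using assms(3) unfolding ghom_iff[OF assms(1)] gmap_def
    by (intro exI[of _ "h \<circ> k"])
       (auto intro!: continuous_on_compose2[of Y h] simp: image_subset_iff)
qed

lemma ghom_comp_right:
  assumes "ginv a X" "ginv b Y" "ghom Y b Z c f f'" "gmap X a Y b h"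
  shows "ghom X a Z c (f \<circ> h) (f' \<circ> h)"
proof -
  obtain k where k: "continuous_on ({0..1} \<times> Y) k" "k ` ({0..1::real} \<times> Y) \<subseteq> Z"
       "\<forall>x\<in>Y. k (0, x) = f x" "\<forall>x\<in>Y. k (1, x) = f' x"
       "\<forall>t\<in>{0..1}. \<forall>g\<in>Sym 3. \<forall>x\<in>Y. k (t, b g x) = c g (k (t, x))"
    using assms(3) unfolding ghom_iff[OF assms(2)] by blast
  have h: "continuous_on X h" "h ` X \<subseteq> Y" "\<forall>g\<in>Sym 3. \<forall>x\<in>X. h (a g x) = b g (h x)"
    using assms(4) by (auto simp: gmap_def)
  have "continuous_on ({0..1} \<times> X) (\<lambda>p. k (fst p, h (snd p)))"
    by (rule continuous_on_compose2[OF k(1)])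
       (use h in \<open>auto intro!: continuous_intros continuous_on_compose2[OF h(1)]\<close>)
  then show ?thesis
    using k h unfolding ghom_iff[OF assms(1)]
    by (intro exI[of _ "\<lambda>p. k (fst p, h (snd p))"]) (auto simp: image_subset_iff)
qed

text \<open>Both maps are arguments because they are needed later: \<open>arc_geqv\<close> extends
  \<open>f\<close> from a subspace, and \<open>models\<close> follows the value of \<open>f\<close>
  at a base point.\<close>

definition geqv where
  "geqv X a Y b f h \<longleftrightarrow> gmap X a Y b f \<and> gmap Y b X a h \<and>
     ghom X a X a (h \<circ> f) id \<and> ghom Y b Y b (f \<circ> h) id"

lemma geqv_trans:
  assumes "ginv a X" "ginv b Y" "ginv c Z" "geqv X a Y b f h" "geqv Y b Z c f' h'"
  shows "geqv X a Z c (f' \<circ> f) (h \<circ> h')"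
proof -
  note d = assms(4,5)[unfolded geqv_def]
  have "ghom X a X a (h \<circ> ((h' \<circ> f') \<circ> f)) (h \<circ> (id \<circ> f))"
    using d by (intro ghom_comp_left[OF assms(1)] ghom_comp_right[OF assms(1,2)]) auto
  moreover have "ghom Z c Z c (f' \<circ> ((f \<circ> h) \<circ> h')) (f' \<circ> (id \<circ> h'))"
    using d by (intro ghom_comp_left[OF assms(3)] ghom_comp_right[OF assms(3,2)]) auto
  ultimately show ?thesis
    using d unfolding geqv_def by (auto intro: gmap_comp ghom_trans simp: comp_assoc)
qed

lemma geqv_imp_equiv_homotopy_equivalent:
  assumes "geqv X a Y b f h"
  shows "equiv_homotopy_equivalent (Sym 3) (top_of_set X) a (top_of_set Y) b"
  using assms unfolding geqv_def equiv_homotopy_equivalent_def gmap_def ghom_def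
  by (intro exI[of _ f] exI[of _ h]) (auto simp: equivariant_def)

text \<open>Attaching a free orbit of arcs to \<open>A\<close>. By \<open>new\<close> and
  \<open>free\<close> the open arcs avoid \<open>A\<close> and one another, and
  \<open>\<tau>\<close> is a continuous inverse of the parametrization, so that a function on
  \<open>X\<close> can be glued from its values on \<open>A\<close> and on the single arc
  \<open>\<phi>\<close>.\<close>

locale arc =
  fixes act :: "(nat \<Rightarrow> nat) \<Rightarrow> 'a::topological_space \<Rightarrow> 'a" and X A :: "'a set" and \<phi> :: "real \<Rightarrow> 'a"
    and \<tau> :: "'a \<Rightarrow> real"
  assumes gact: "gact act" and ginvA: "ginv act A" and closedA: "closed A"
    and path: "continuous_on {0..1} \<phi>" and ends: "\<phi> 0 \<in> A" "\<phi> 1 \<in> A"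
    and X: "X = A \<union> (\<Union>g\<in>Sym 3. act g ` \<phi> ` {0..1})"
    and new: "\<And>t. 0 < t \<Longrightarrow> t < 1 \<Longrightarrow> \<phi> t \<notin> A"
    and free: "\<And>t t' g. 0 < t \<Longrightarrow> t < 1 \<Longrightarrow> 0 < t' \<Longrightarrow> t' < 1 \<Longrightarrow> g \<in> Sym 3 \<Longrightarrow>
       act g (\<phi> t) = \<phi> t' \<Longrightarrow> g = id"
    and closed_arc: "closed (\<phi> ` {0..1})"
    and \<tau>_cont: "continuous_on (\<phi> ` {0..1}) \<tau>"
    and \<tau>: "\<And>t. 0 \<le> t \<Longrightarrow> t \<le> 1 \<Longrightarrow> \<tau> (\<phi> t) = t"
begin

lemma act_comp: "g \<in> Sym 3 \<Longrightarrow> h \<in> Sym 3 \<Longrightarrow> act h (act g x) = act (g \<circ> h) x"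
  using gact by (auto simp: gact_def)

lemma act_inv: "g \<in> Sym 3 \<Longrightarrow> act (inv g) (act g x) = x" "g \<in> Sym 3 \<Longrightarrow> act g (act (inv g) x) = x"
  using gact gact_inv by auto

lemma act_cont: "g \<in> Sym 3 \<Longrightarrow> continuous_on S (act g)"
  using gact by (auto simp: gact_def intro: continuous_on_subset)

lemma ginvX: "ginv act X"
proof -
  have "act h (act g (\<phi> t)) \<in> X" if "g \<in> Sym 3" "h \<in> Sym 3" "t \<in> {0..1}" for g h t
    unfolding X using that act_comp[of g h] Sym_comp[of g 3 h] by blast
  then have "act g x \<in> X" if "g \<in> Sym 3" "x \<in> act h ` \<phi> ` {0..1}" "h \<in> Sym 3" for g h x
    using that by blast
  moreover have "act g x \<in> X" if "g \<in> Sym 3" "x \<in> A" for g x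
    using that ginvA unfolding X ginv_def by blast
  ultimately show ?thesis
    unfolding ginv_def by (subst X) blast
qed

lemma A_subset: "A \<subseteq> X" and arc_subset: "\<phi> ` {0..1} \<subseteq> X"
proof -
  have "act id x = x" for x using gact by (simp add: gact_def)
  then show "A \<subseteq> X" "\<phi> ` {0..1} \<subseteq> X"
    unfolding X using Sym_id[of 3] by (auto simp: image_iff) (metis atLeastAtMost_iff)
qed

lemma closed_arcs: "g \<in> Sym 3 \<Longrightarrow> closed (act g ` \<phi> ` {0..1})"
proof -
  assume g: "g \<in> Sym 3"
  then have "act g ` \<phi> ` {0..1} = act (inv g) -` \<phi> ` {0..1}"
    using act_inv[OF g] by (auto simp: image_iff) (metis atLeastAtMost_iff)
  then show ?thesis
    using closed_vimage[OF closed_arc] act_cont[OF Sym_inv[OF g], of UNIV] by simp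
qed

text \<open>Values on one arc force those on its translates, and freeness leaves no condition
  between different translates; only the ends, which lie in \<open>A\<close>, must agree with
  \<open>f\<close>. The time parameter is carried along so that one lemma serves for maps and for
  homotopies.\<close>

lemma extend:
  fixes Y :: "'b::topological_space set" and f :: "real \<times> 'a \<Rightarrow> 'b" and \<pi> :: "real \<times> real \<Rightarrow> 'b"
  assumes Y: "gact b" "ginv b Y"
    and f: "continuous_on ({0..1} \<times> A) f" "f ` ({0..1} \<times> A) \<subseteq> Y"
      "\<And>s g x. s \<in> {0..1} \<Longrightarrow> g \<in> Sym 3 \<Longrightarrow> x \<in> A \<Longrightarrow> f (s, act g x) = b g (f (s, x))"
    and \<pi>: "continuous_on ({0..1} \<times> {0..1}) \<pi>" "\<pi> ` ({0..1} \<times> {0..1}) \<subseteq> Y"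
      "\<And>s. s \<in> {0..1} \<Longrightarrow> \<pi> (s, 0) = f (s, \<phi> 0)" "\<And>s. s \<in> {0..1} \<Longrightarrow> \<pi> (s, 1) = f (s, \<phi> 1)"
  obtains F where "continuous_on ({0..1} \<times> X) F" "F ` ({0..1} \<times> X) \<subseteq> Y"
      "\<And>s g x. s \<in> {0..1} \<Longrightarrow> g \<in> Sym 3 \<Longrightarrow> x \<in> X \<Longrightarrow> F (s, act g x) = b g (F (s, x))"
      "\<And>s x. s \<in> {0..1} \<Longrightarrow> x \<in> A \<Longrightarrow> F (s, x) = f (s, x)"
      "\<And>s t. s \<in> {0..1} \<Longrightarrow> t \<in> {0..1} \<Longrightarrow> F (s, \<phi> t) = \<pi> (s, t)"
proof -
  \<comment> \<open>Off \<open>A\<close> the translate that contains \<open>x\<close> is unique by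
    \<open>free\<close>, so there the choice is forced.\<close>
  define c where "c x = (SOME g. g \<in> Sym 3 \<and> x \<in> act g ` \<phi> ` {0..1})" for x
  define F where "F p = (if snd p \<in> A then f p
      else b (c (snd p)) (\<pi> (fst p, \<tau> (act (inv (c (snd p))) (snd p)))))" for p
  have FA: "F (s, x) = f (s, x)" if "x \<in> A" for s x
    using that by (simp add: F_def)
  have Farc: "F (s, act g (\<phi> t)) = b g (\<pi> (s, t))" if "s \<in> {0..1}" "g \<in> Sym 3" "t \<in> {0..1}" for s g t
  proof (cases "t = 0 \<or> t = 1")
    case True
    then have "\<phi> t \<in> A" "\<pi> (s, t) = f (s, \<phi> t)" using ends \<pi>(3,4) that by auto
    then show ?thesis using FA f(3) that ginvA by (simp add: ginv_def)
  next
    case False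
    with that have t: "0 < t" "t < 1" by auto
    let ?x = "act g (\<phi> t)"
    have nA: "?x \<notin> A" using new[OF t] ginv_iff[OF gact ginvA that(2)] by simp
    have "c ?x \<in> Sym 3 \<and> ?x \<in> act (c ?x) ` \<phi> ` {0..1}"
      unfolding c_def by (rule someI[of _ g]) (use that in auto)
    then obtain t' where c: "c ?x \<in> Sym 3" and t': "t' \<in> {0..1}" "?x = act (c ?x) (\<phi> t')" by blast
    have "\<phi> t' \<notin> A" using nA t' ginv_iff[OF gact ginvA c] by metis
    then have "t' \<noteq> 0" "t' \<noteq> 1" using ends by auto
    then have t'2: "0 < t'" "t' < 1" using t' by auto
    have e: "act (inv (c ?x)) ?x = \<phi> t'" using t' act_inv[OF c] by metis
    then have "act (g \<circ> inv (c ?x)) (\<phi> t) = \<phi> t'" using act_comp[OF that(2) Sym_inv[OF c]] by simp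
    then have "g \<circ> inv (c ?x) = id" using free[OF t t'2 Sym_comp[OF that(2) Sym_inv[OF c]]] by simp
    then have gc: "g = c ?x" using Sym_inv_o[OF c] by (metis comp_assoc comp_id id_comp)
    have "\<phi> t' = \<phi> t" using e gc act_inv[OF that(2)] by metis
    then have "\<tau> (act (inv (c ?x)) ?x) = t" using e \<tau>[of t] t by simp
    then show ?thesis using nA gc by (simp add: F_def)
  qed
  have F\<phi>: "F (s, \<phi> t) = \<pi> (s, t)" if "s \<in> {0..1}" "t \<in> {0..1}" for s t
    using Farc[OF that(1) Sym_id that(2)] gact Y(1) by (simp add: gact_def)
  have X': "x \<in> A \<or> (\<exists>g\<in>Sym 3. \<exists>t\<in>{0..1}. x = act g (\<phi> t))" if "x \<in> X" for x
    using that X by auto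
  have Feq: "F (s, act g x) = b g (F (s, x))" if "s \<in> {0..1}" "g \<in> Sym 3" "x \<in> X" for s g x
    using X'[OF that(3)]
  proof (elim disjE bexE)
    assume "x \<in> A" then show ?thesis using FA f(3) that ginvA by (simp add: ginv_def)
  next
    fix h t assume ht: "h \<in> Sym 3" "t \<in> {0..1}" "x = act h (\<phi> t)"
    then show ?thesis
      using act_comp[OF ht(1) that(2)] Farc[OF that(1) Sym_comp[OF ht(1) that(2)] ht(2)]
        Farc[OF that(1) ht(1,2)] Y(1) that by (simp add: gact_def)
  qed
  have FY: "F (s, x) \<in> Y" if "s \<in> {0..1}" "x \<in> X" for s x
    using X'[OF that(2)]
  proof (elim disjE bexE)
    assume "x \<in> A" then show ?thesis using FA f(2) that by auto
  next
    fix g t assume gt: "g \<in> Sym 3" "t \<in> {0..1}" "x = act g (\<phi> t)"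
    have "\<pi> (s, t) \<in> Y" using \<pi>(2) that gt by auto
    then show ?thesis using Farc[OF that(1) gt(1,2)] gt Y(2) by (simp add: ginv_def)
  qed
  have contA: "continuous_on ({0..1} \<times> A) F"
    by (rule continuous_on_eq[OF f(1)]) (auto simp: FA)
  have cont_arc: "continuous_on ({0..1} \<times> act g ` \<phi> ` {0..1}) F" if g: "g \<in> Sym 3" for g
  proof (rule continuous_on_eq)
    show "b g (\<pi> (fst p, \<tau> (act (inv g) (snd p)))) = F p" if p: "p \<in> {0..1} \<times> act g ` \<phi> ` {0..1}" for p
    proof -
      from p obtain s t where st: "p = (s, act g (\<phi> t))" "s \<in> {0..1}" "t \<in> {0..1}" by auto
      then have "\<tau> (act (inv g) (snd p)) = t" using act_inv[OF g] \<tau> by simp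
      then show ?thesis using Farc[OF st(2) g st(3)] st by simp
    qed
    have 1: "continuous_on ({0..1} \<times> act g ` \<phi> ` {0..1}) (\<lambda>p. \<tau> (act (inv g) (snd p)))"
      by (rule continuous_on_compose2[OF \<tau>_cont])
         (auto simp: act_inv[OF g] intro!: continuous_on_compose2[OF act_cont[OF Sym_inv[OF g], of UNIV]]
           continuous_intros)
    have 2: "continuous_on ({0..1} \<times> act g ` \<phi> ` {0..1}) (\<lambda>p. \<pi> (fst p, \<tau> (act (inv g) (snd p))))"
      by (rule continuous_on_compose2[OF \<pi>(1)]) (auto simp: act_inv[OF g] \<tau> intro!: continuous_intros 1)
    have 3: "continuous_on UNIV (b g)" using Y(1) g by (auto simp: gact_def)
    show "continuous_on ({0..1} \<times> act g ` \<phi> ` {0..1}) (\<lambda>p. b g (\<pi> (fst p, \<tau> (act (inv g) (snd p)))))"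
      by (rule continuous_on_compose2[OF 3 2]) auto
  qed
  have "continuous_on ({0..1::real} \<times> A \<union> (\<Union>g\<in>Sym 3. {0..1} \<times> act g ` \<phi> ` {0..1})) F"
    using cont_arc closed_arcs finite_Sym closedA contA
    by (intro continuous_on_closed_Un continuous_on_closed_Union closed_UN closed_Times ballI) auto
  moreover have "{0..1::real} \<times> A \<union> (\<Union>g\<in>Sym 3. {0..1} \<times> act g ` \<phi> ` {0..1}) = {0..1} \<times> X"
    unfolding X by blast
  ultimately have "continuous_on ({0..1} \<times> X) F" by simp
  with FY Feq FA F\<phi> show ?thesis using that[of F] by (simp add: image_subset_iff)
qed

end

section \<open>Cancellation of paths in an arbitrary topological space\<close>

lemma homotopic_paths_const_right:
  assumes "path p" "path_image p \<subseteq> S" "x = pathfinish p"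
  shows "homotopic_paths S (p +++ (\<lambda>_. x)) p"
  by (rule homotopic_paths_sym, rule homotopic_paths_reparametrize[OF assms(1,2), where f = "\<lambda>t. min (2 * t) 1"])
     (auto intro!: continuous_intros simp: joinpaths_def assms(3) pathfinish_def)

lemma homotopic_paths_const_left:
  assumes "path p" "path_image p \<subseteq> S" "x = pathstart p"
  shows "homotopic_paths S ((\<lambda>_. x) +++ p) p"
  by (rule homotopic_paths_sym, rule homotopic_paths_reparametrize[OF assms(1,2), where f = "\<lambda>t. max 0 (2 * t - 1)"])
     (auto intro!: continuous_intros simp: joinpaths_def assms(3) pathstart_def)

lemma homotopic_paths_rinv_const:
  assumes "path p" "path_image p \<subseteq> S"
  shows "homotopic_paths S (p +++ reversepath p) (\<lambda>_. pathstart p)"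
proof -
  have r: "s * (1 - \<bar>2 * t - 1\<bar>) \<in> {0..1}" if "s \<in> {0..1}" "t \<in> {0..1}" for s t :: real
  proof -
    have "0 \<le> 1 - \<bar>2 * t - 1\<bar>" "1 - \<bar>2 * t - 1\<bar> \<le> 1" using that by auto
    then show ?thesis using that mult_le_one[of s] by auto
  qed
  have "homotopic_paths S (\<lambda>_. pathstart p) (p +++ reversepath p)"
    unfolding homotopic_paths
  proof (intro exI conjI)
    \<comment> \<open>At time \<open>s\<close> the path follows \<open>p\<close> out to
      \<open>p s\<close> and comes back; the tent function of the second coordinate is the position
      on this way.\<close>
    let ?h = "\<lambda>z. p (fst z * (1 - \<bar>2 * snd z - 1\<bar>))"
    show "continuous_on ({0..1} \<times> {0..1}) ?h"
      by (rule continuous_on_compose2[OF assms(1)[unfolded path_def]])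
         (use r in \<open>auto intro!: continuous_intros\<close>)
    show "?h \<in> {0..1} \<times> {0..1} \<rightarrow> S"
      using r assms(2) by (fastforce simp: path_image_def)
    show "\<forall>x\<in>{0..1}. ?h (0, x) = pathstart p" by (simp add: pathstart_def)
    show "\<forall>x\<in>{0..1}. ?h (1, x) = (p +++ reversepath p) x"
      by (auto simp: joinpaths_def reversepath_def algebra_simps)
    show "\<forall>t\<in>{0..1}. pathstart (?h \<circ> Pair t) = pathstart (\<lambda>_. pathstart p) \<and>
       pathfinish (?h \<circ> Pair t) = pathfinish (\<lambda>_. pathstart p)"
      by (simp add: pathstart_def pathfinish_def)
  qed
  then show ?thesis by (rule homotopic_paths_sym)
qed

lemma homotopic_paths_linv_const:
  assumes "path p" "path_image p \<subseteq> S"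
  shows "homotopic_paths S (reversepath p +++ p) (\<lambda>_. pathfinish p)"
  using homotopic_paths_rinv_const[of "reversepath p" S] assms by simp

lemma path_const [simp]: "path (\<lambda>_. x)" "path_image (\<lambda>_. x) = {x}" "pathstart (\<lambda>_. x) = x"
    "pathfinish (\<lambda>_. x) = x"
  by (auto simp: path_def path_image_def pathstart_def pathfinish_def)

text \<open>Free reduction of the one word that occurs in \<open>arc_left_inverse\<close>: there
  \<open>a\<close> and \<open>e\<close> are images of the connecting paths, \<open>b\<close> and
  \<open>d\<close> are tracks of the ends of an arc under a homotopy, and \<open>c\<close> is the
  arc.\<close>

lemma homotopic_paths_conjugate:
  assumes p: "path a" "path b" "path c" "path d" "path e"
    and S: "path_image a \<subseteq> S" "path_image b \<subseteq> S" "path_image c \<subseteq> S" "path_image d \<subseteq> S" "path_image e \<subseteq> S"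
    and pf: "pathstart b = pathstart a" "pathfinish b = pathstart c" "pathfinish c = pathstart d"
      "pathfinish d = pathfinish e"
  shows "homotopic_paths S
    (a +++ (((reversepath a +++ b) +++ (c +++ (d +++ reversepath e))) +++ e)) (b +++ (c +++ d))"
proof -
  note [simp] = p S pf path_join subset_path_image_join
  have "homotopic_paths S ((d +++ reversepath e) +++ e) (d +++ (reversepath e +++ e))"
    by (rule homotopic_paths_sym[OF homotopic_paths_assoc]) auto
  also have "homotopic_paths S (d +++ (reversepath e +++ e)) (d +++ (\<lambda>_. pathfinish e))"
    by (rule homotopic_paths_join[OF _ homotopic_paths_linv_const]) auto
  also have "homotopic_paths S (d +++ (\<lambda>_. pathfinish e)) d"
    by (rule homotopic_paths_const_right) auto
  finally have 1: "homotopic_paths S ((d +++ reversepath e) +++ e) d" .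
  have "homotopic_paths S ((c +++ (d +++ reversepath e)) +++ e) (c +++ ((d +++ reversepath e) +++ e))"
    by (rule homotopic_paths_sym[OF homotopic_paths_assoc]) auto
  also have "homotopic_paths S (c +++ ((d +++ reversepath e) +++ e)) (c +++ d)"
    by (rule homotopic_paths_join[OF _ 1]) auto
  finally have 2: "homotopic_paths S ((c +++ (d +++ reversepath e)) +++ e) (c +++ d)" .
  have "homotopic_paths S (((reversepath a +++ b) +++ (c +++ (d +++ reversepath e))) +++ e)
     ((reversepath a +++ b) +++ ((c +++ (d +++ reversepath e)) +++ e))"
    by (rule homotopic_paths_sym[OF homotopic_paths_assoc]) auto
  also have "homotopic_paths S ((reversepath a +++ b) +++ ((c +++ (d +++ reversepath e)) +++ e))
     ((reversepath a +++ b) +++ (c +++ d))"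
    by (rule homotopic_paths_join[OF _ 2]) auto
  finally have 3: "homotopic_paths S (((reversepath a +++ b) +++ (c +++ (d +++ reversepath e))) +++ e)
     ((reversepath a +++ b) +++ (c +++ d))" .
  have "homotopic_paths S (a +++ (reversepath a +++ b)) ((a +++ reversepath a) +++ b)"
    by (rule homotopic_paths_assoc) auto
  also have "homotopic_paths S ((a +++ reversepath a) +++ b) ((\<lambda>_. pathstart a) +++ b)"
    by (rule homotopic_paths_join[OF homotopic_paths_rinv_const]) auto
  also have "homotopic_paths S ((\<lambda>_. pathstart a) +++ b) b"
    by (rule homotopic_paths_const_left) auto
  finally have 4: "homotopic_paths S (a +++ (reversepath a +++ b)) b" .
  have "homotopic_paths S (a +++ (((reversepath a +++ b) +++ (c +++ (d +++ reversepath e))) +++ e))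
    (a +++ ((reversepath a +++ b) +++ (c +++ d)))"
    by (rule homotopic_paths_join[OF _ 3]) auto
  also have "homotopic_paths S (a +++ ((reversepath a +++ b) +++ (c +++ d)))
     ((a +++ (reversepath a +++ b)) +++ (c +++ d))"
    by (rule homotopic_paths_assoc) auto
  also have "homotopic_paths S ((a +++ (reversepath a +++ b)) +++ (c +++ d)) (b +++ (c +++ d))"
    by (rule homotopic_paths_join[OF 4]) auto
  finally show ?thesis .
qed

context arc
begin

text \<open>The homotopy of paths fixes the ends, so it fits together with the constant homotopy on
  \<open>A\<close>.\<close>

lemma ghom_rel_ends:
  assumes Y: "gact b" "ginv b Y" and F: "gmap X act Y b F0" "gmap X act Y b F1"
    and A: "\<And>x. x \<in> A \<Longrightarrow> F0 x = F1 x" and hp: "homotopic_paths Y (F0 \<circ> \<phi>) (F1 \<circ> \<phi>)"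
  shows "ghom X act Y b F0 F1"
proof -
  obtain k where k: "continuous_on ({0..1} \<times> {0..1}) k" "k \<in> ({0..1} \<times> {0..1}) \<rightarrow> Y"
       "\<forall>x\<in>{0..1}. k (0,x) = (F0 \<circ> \<phi>) x" "\<forall>x\<in>{0..1}. k (1,x) = (F1 \<circ> \<phi>) x"
       "\<forall>t\<in>{0..1::real}. pathstart (k \<circ> Pair t) = pathstart (F0 \<circ> \<phi>) \<and> pathfinish (k \<circ> Pair t) = pathfinish (F0 \<circ> \<phi>)"
    using hp unfolding homotopic_paths by blast
  note Fd = F[unfolded gmap_def]
  have "\<exists>H. continuous_on ({0..1::real} \<times> X) H \<and> H ` ({0..1} \<times> X) \<subseteq> Y \<and>
      (\<forall>s g x. s \<in> {0..1} \<longrightarrow> g \<in> Sym 3 \<longrightarrow> x \<in> X \<longrightarrow> H (s, act g x) = b g (H (s, x))) \<and>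
      (\<forall>s x. s \<in> {0..1} \<longrightarrow> x \<in> A \<longrightarrow> H (s, x) = F0 x) \<and>
      (\<forall>s t. s \<in> {0..1} \<longrightarrow> t \<in> {0..1} \<longrightarrow> H (s, \<phi> t) = k (s, t))"
  proof (rule extend[OF Y, where f = "F0 \<circ> snd" and \<pi> = k])
    show "continuous_on ({0..1} \<times> A) (F0 \<circ> snd)"
      using Fd A_subset by (auto intro!: continuous_intros elim!: continuous_on_compose2 simp: o_def)
    show "k ` ({0..1} \<times> {0..1}) \<subseteq> Y" using k(2) by auto
    show "(F0 \<circ> snd) ` ({0..1} \<times> A) \<subseteq> Y" using Fd A_subset by (auto simp: image_subset_iff)
    show "(F0 \<circ> snd) (s, act g x) = b g ((F0 \<circ> snd) (s, x))" if "g \<in> Sym 3" "x \<in> A" for s g x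
      using Fd that A_subset by auto
  qed (use k in \<open>auto simp: pathstart_def pathfinish_def\<close>)
  then obtain H where H: "continuous_on ({0..1::real} \<times> X) H" "H ` ({0..1} \<times> X) \<subseteq> Y"
      "\<And>s g x. s \<in> {0..1} \<Longrightarrow> g \<in> Sym 3 \<Longrightarrow> x \<in> X \<Longrightarrow> H (s, act g x) = b g (H (s, x))"
      "\<And>s x. s \<in> {0..1} \<Longrightarrow> x \<in> A \<Longrightarrow> H (s, x) = F0 x"
      "\<And>s t. s \<in> {0..1} \<Longrightarrow> t \<in> {0..1} \<Longrightarrow> H (s, \<phi> t) = k (s, t)"
    by blast
  have "H (0, x) = F0 x \<and> H (1, x) = F1 x" if "x \<in> X" for x
  proof -
    consider "x \<in> A" | g t where "g \<in> Sym 3" "t \<in> {0..1}" "x = act g (\<phi> t)" using \<open>x \<in> X\<close> X by auto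
    then show ?thesis
    proof cases
      case 2
      then have "\<phi> t \<in> X" using arc_subset by auto
      then show ?thesis using 2 H(3)[of _ g "\<phi> t"] H(5)[of _ t] k(3,4) Fd by auto
    qed (use H A in auto)
  qed
  then show ?thesis
    unfolding ghom_iff[OF ginvX] using H by (intro exI[of _ H]) auto
qed

text \<open>A homotopy \<open>k\<close> on \<open>A\<close> moves the ends of the arc; the only
  obstruction to extending it is whether the first image of the arc, compared with the second one
  transported back along the two tracks, is homotopic to it with fixed ends.\<close>

lemma ghom_if_square:
  assumes Y: "gact b" "ginv b Y" and F: "gmap X act Y b F0" "gmap X act Y b F1"
    and k: "continuous_on ({0..1} \<times> A) k" "k ` ({0..1::real} \<times> A) \<subseteq> Y"
       "\<forall>x\<in>A. k (0, x) = F0 x" "\<forall>x\<in>A. k (1, x) = F1 x"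
       "\<forall>t\<in>{0..1}. \<forall>g\<in>Sym 3. \<forall>x\<in>A. k (t, act g x) = b g (k (t, x))"
    and hp: "homotopic_paths Y (F0 \<circ> \<phi>)
       ((\<lambda>s. k (s, \<phi> 0)) +++ ((F1 \<circ> \<phi>) +++ reversepath (\<lambda>s. k (s, \<phi> 1))))"
  shows "ghom X act Y b F0 F1"
proof -
  define \<theta>0 \<theta>1 where \<theta>: "\<theta>0 = (\<lambda>s. k (s, \<phi> 0))" "\<theta>1 = (\<lambda>s. k (s, \<phi> 1))"
  \<comment> \<open>The path \<open>S s\<close> follows the rest of the track
    \<open>\<theta>0\<close> from time \<open>s\<close> to 1, then the image of the arc under
    \<open>F1\<close>, then \<open>\<theta>1\<close> backwards from 1 to \<open>s\<close>. Its ends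
    are the values of \<open>k\<close> at time \<open>s\<close>, as \<open>extend\<close>
    requires.\<close>
  define S where "S s = (\<lambda>t. \<theta>0 ((1 - s) * t + s)) +++ ((F1 \<circ> \<phi>) +++ (\<lambda>t. \<theta>1 ((s - 1) * t + 1)))" for s
  have cF1: "continuous_on {0..1} (F1 \<circ> \<phi>)"
    using path F(2) arc_subset unfolding gmap_def by (auto intro!: continuous_on_compose2[of X F1] simp: o_def)
  have c\<theta>: "continuous_on {0..1} \<theta>0" "continuous_on {0..1} \<theta>1"
    unfolding \<theta> using ends by (auto intro!: continuous_on_compose2[OF k(1)] continuous_intros)
  have \<theta>Y: "\<theta>0 s \<in> Y" "\<theta>1 s \<in> Y" if "s \<in> {0..1}" for s
    unfolding \<theta> using k(2) ends that by auto
  have F1Y: "F1 (\<phi> t) \<in> Y" if "t \<in> {0..1}" for t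
    using F(2) arc_subset that unfolding gmap_def by (auto simp: image_subset_iff)
  have e1: "\<theta>0 1 = F1 (\<phi> 0)" "\<theta>1 1 = F1 (\<phi> 1)" using k(4) ends by (auto simp: \<theta>)
  have seg: "(1 - t) * s + t \<in> {0..1}" if "s \<in> {0..1}" "t \<in> {0..1}" for s t :: real
  proof -
    have "(1 - t) * s \<le> (1 - t) * 1" using that by (intro mult_left_mono) auto
    then show ?thesis using that by auto
  qed
  have seg0: "(1 - s) * t + s \<in> {0..1}" and seg1: "(s - 1) * t + 1 \<in> {0..1}"
    if "s \<in> {0..1}" "t \<in> {0..1}" for s t :: real
    using seg[OF that] seg[of s "1 - t"] that by (auto simp: algebra_simps)
  have cS: "continuous_on ({0..1} \<times> {0..1}) (\<lambda>y. S (fst y) (snd y))"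
    unfolding S_def
  proof (intro continuous_on_homotopic_join_lemma[where p = "\<lambda>s t. \<theta>0 ((1 - s) * t + s)" and q = "\<lambda>s. (F1 \<circ> \<phi>) +++ (\<lambda>t. \<theta>1 ((s - 1) * t + 1))"]
      continuous_on_homotopic_join_lemma[where p = "\<lambda>s. F1 \<circ> \<phi>" and q = "\<lambda>s t. \<theta>1 ((s - 1) * t + 1)"])
    show "continuous_on ({0..1} \<times> {0..1}) (\<lambda>y. \<theta>0 ((1 - fst y) * snd y + fst y))"
      by (rule continuous_on_compose2[OF c\<theta>(1)]) (use seg0 in \<open>auto intro!: continuous_intros\<close>)
    show "continuous_on ({0..1} \<times> {0..1}) (\<lambda>y. \<theta>1 ((fst y - 1) * snd y + 1))"
      by (rule continuous_on_compose2[OF c\<theta>(2)]) (use seg1 in \<open>auto intro!: continuous_intros\<close>)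
    show "continuous_on ({0..1::real} \<times> {0..1}) (\<lambda>y. (F1 \<circ> \<phi>) (snd y))"
      by (rule continuous_on_compose2[OF cF1]) (auto intro!: continuous_intros)
  qed (use e1 in \<open>auto simp: pathstart_def pathfinish_def joinpaths_def\<close>)
  have SY: "S s t \<in> Y" if "s \<in> {0..1}" "t \<in> {0..1}" for s t
    unfolding S_def joinpaths_def
    using that \<theta>Y seg0[of s "2*t"] seg1[of s "2*(2*t-1)-1"] F1Y[of "2*(2*t-1)"] by auto
  have Send: "S s 0 = \<theta>0 s" "S s 1 = \<theta>1 s" for s
    by (auto simp: S_def joinpaths_def)
  have "\<exists>H. continuous_on ({0..1::real} \<times> X) H \<and> H ` ({0..1} \<times> X) \<subseteq> Y \<and>
      (\<forall>s g x. s \<in> {0..1} \<longrightarrow> g \<in> Sym 3 \<longrightarrow> x \<in> X \<longrightarrow> H (s, act g x) = b g (H (s, x))) \<and>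
      (\<forall>s x. s \<in> {0..1} \<longrightarrow> x \<in> A \<longrightarrow> H (s, x) = k (s, x)) \<and>
      (\<forall>s t. s \<in> {0..1} \<longrightarrow> t \<in> {0..1} \<longrightarrow> H (s, \<phi> t) = S s t)"
    by (rule extend[OF Y k(1), where \<pi> = "\<lambda>y. S (fst y) (snd y)"])
       (use k cS SY Send \<theta> in auto)
  then obtain H where H: "continuous_on ({0..1::real} \<times> X) H" "H ` ({0..1} \<times> X) \<subseteq> Y"
      "\<And>s g x. s \<in> {0..1} \<Longrightarrow> g \<in> Sym 3 \<Longrightarrow> x \<in> X \<Longrightarrow> H (s, act g x) = b g (H (s, x))"
      "\<And>s x. s \<in> {0..1} \<Longrightarrow> x \<in> A \<Longrightarrow> H (s, x) = k (s, x)"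
      "\<And>s t. s \<in> {0..1} \<Longrightarrow> t \<in> {0..1} \<Longrightarrow> H (s, \<phi> t) = S s t"
    by blast
  have H01: "ghom X act Y b (\<lambda>x. H (0, x)) (\<lambda>x. H (1, x))"
    unfolding ghom_iff[OF ginvX] using H by (intro exI[of _ H]) auto
  note Hg = ghom_imp_gmap[OF H01]
  have pF1: "path (F1 \<circ> \<phi>)" "path_image (F1 \<circ> \<phi>) \<subseteq> Y"
    using cF1 F1Y by (auto simp: path_def path_image_def)
  have p\<theta>: "path \<theta>0" "path_image \<theta>0 \<subseteq> Y" "path \<theta>1" "path_image \<theta>1 \<subseteq> Y"
    using c\<theta> \<theta>Y by (auto simp: path_def path_image_def)
  have pS: "path (S 0)" "path_image (S 0) \<subseteq> Y" "path (S 1)" "path_image (S 1) \<subseteq> Y"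
    using SY by (auto simp: path_def path_image_def intro!: continuous_on_compose2[OF cS, of _ "Pair _", simplified] continuous_intros)
  \<comment> \<open>The homotopy \<open>H\<close> begins and ends with maps that agree with
    \<open>F0\<close> and \<open>F1\<close> on \<open>A\<close>, but along the arc only up to
    homotopy; \<open>ghom_rel_ends\<close> closes both gaps.\<close>
  have "homotopic_paths Y (S 0) ((\<lambda>x. H (0, x)) \<circ> \<phi>)"
    by (rule homotopic_paths_eq) (use pS H(5) in auto)
  then have "homotopic_paths Y (F0 \<circ> \<phi>) ((\<lambda>x. H (0, x)) \<circ> \<phi>)"
    using hp by (auto simp: S_def \<theta>[symmetric] reversepath_def intro: homotopic_paths_trans)
  then have "ghom X act Y b F0 (\<lambda>x. H (0, x))"
    by (intro ghom_rel_ends[OF Y F(1) Hg(1)]) (use H(4) k in auto)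
  also note H01
  also have "ghom X act Y b (\<lambda>x. H (1, x)) F1"
  proof (intro ghom_rel_ends[OF Y Hg(2) F(2)])
    have "homotopic_paths Y ((\<lambda>x. H (1, x)) \<circ> \<phi>) (S 1)"
      by (rule homotopic_paths_sym, rule homotopic_paths_eq) (use pS H(5) in auto)
    also have "S 1 = (\<lambda>_. F1 (\<phi> 0)) +++ ((F1 \<circ> \<phi>) +++ (\<lambda>_. F1 (\<phi> 1)))"
      by (simp add: S_def e1)
    also have "homotopic_paths Y \<dots> ((\<lambda>_. F1 (\<phi> 0)) +++ (F1 \<circ> \<phi>))"
      by (intro homotopic_paths_join homotopic_paths_const_right)
         (use pF1 F1Y in \<open>auto simp: pathstart_def pathfinish_def joinpaths_def\<close>)
    also have "homotopic_paths Y \<dots> (F1 \<circ> \<phi>)"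
      by (rule homotopic_paths_const_left) (use pF1 in \<open>auto simp: pathstart_def\<close>)
    finally show "homotopic_paths Y ((\<lambda>x. H (1, x)) \<circ> \<phi>) (F1 \<circ> \<phi>)" .
  qed (use H(4) k in auto)
  finally show ?thesis .
qed

lemma extend_map:
  fixes Y :: "'b::topological_space set"
  assumes Y: "gact b" "ginv b Y" and f: "gmap A act Y b f"
    and p: "path p" "path_image p \<subseteq> Y" "pathstart p = f (\<phi> 0)" "pathfinish p = f (\<phi> 1)"
  obtains F where "gmap X act Y b F" "\<And>x. x \<in> A \<Longrightarrow> F x = f x" "\<And>t. t \<in> {0..1} \<Longrightarrow> F (\<phi> t) = p t"
proof -
  note fd = f[unfolded gmap_def]
  have "\<exists>H. continuous_on ({0..1::real} \<times> X) H \<and> H ` ({0..1} \<times> X) \<subseteq> Y \<and>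
      (\<forall>s g x. s \<in> {0..1} \<longrightarrow> g \<in> Sym 3 \<longrightarrow> x \<in> X \<longrightarrow> H (s, act g x) = b g (H (s, x))) \<and>
      (\<forall>s x. s \<in> {0..1} \<longrightarrow> x \<in> A \<longrightarrow> H (s, x) = f x) \<and>
      (\<forall>s t. s \<in> {0..1} \<longrightarrow> t \<in> {0..1} \<longrightarrow> H (s, \<phi> t) = p t)"
  proof (rule extend[OF Y, where f = "\<lambda>z. f (snd z)" and \<pi> = "\<lambda>z. p (snd z)"])
    show "continuous_on ({0..1} \<times> A) (\<lambda>z. f (snd z))"
      using fd by (auto intro!: continuous_intros elim!: continuous_on_compose2)
    show "continuous_on ({0..1} \<times> {0..1}) (\<lambda>z. p (snd z))"
      by (rule continuous_on_compose2[OF p(1)[unfolded path_def]]) (auto intro!: continuous_intros)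
  qed (use fd p in \<open>auto simp: path_image_def pathstart_def pathfinish_def image_subset_iff\<close>)
  then obtain H where H: "continuous_on ({0..1::real} \<times> X) H" "H ` ({0..1} \<times> X) \<subseteq> Y"
      "\<And>s g x. s \<in> {0..1} \<Longrightarrow> g \<in> Sym 3 \<Longrightarrow> x \<in> X \<Longrightarrow> H (s, act g x) = b g (H (s, x))"
      "\<And>s x. s \<in> {0..1} \<Longrightarrow> x \<in> A \<Longrightarrow> H (s, x) = f x"
      "\<And>s t. s \<in> {0..1} \<Longrightarrow> t \<in> {0..1} \<Longrightarrow> H (s, \<phi> t) = p t"
    by blast
  have "continuous_on X (\<lambda>x. H (0, x))"
    by (rule continuous_on_compose2[OF H(1)]) (auto intro!: continuous_intros)
  then have "gmap X act Y b (\<lambda>x. H (0, x))"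
    using H by (auto simp: gmap_def)
  then show ?thesis using that H by fastforce
qed

end

lemma path_in_image:
  assumes "path p" "path_image p \<subseteq> A" "continuous_on A f" "f ` A \<subseteq> B"
  shows "path (f \<circ> p)" "path_image (f \<circ> p) \<subseteq> B"
proof -
  show "path (f \<circ> p)"
    using assms unfolding path_def path_image_def by (auto intro!: continuous_on_compose2[of A f] simp: o_def)
  show "path_image (f \<circ> p) \<subseteq> B"
    using assms unfolding path_image_def by auto
qed

text \<open>The image of \<open>\<psi>\<close> under \<open>H\<close> is chosen so that it undoes
  \<open>\<alpha>\<close> and \<open>\<beta>\<close> and adds the tracks of the ends of
  \<open>\<phi>\<close> under the homotopy from \<open>h \<circ> f\<close> to the identity. Then
  \<open>H \<circ> F\<close> meets the condition of \<open>ghom_if_square\<close>. What is obtained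
  for \<open>H\<close> has the form of what is assumed of \<open>F\<close>, with the two spaces
  exchanged.\<close>

lemma arc_left_inverse:
  fixes X A :: "'a::topological_space set" and Y B :: "'b::topological_space set"
  assumes X: "arc a X A \<phi> \<tau>" and Y: "arc b Y B \<psi> \<tau>'"
    and f: "gmap A a B b f" and h: "gmap B b A a h" and hf: "ghom A a A a (h \<circ> f) id"
    and F: "gmap X a Y b F" "\<And>x. x \<in> A \<Longrightarrow> F x = f x"
    and \<alpha>: "path \<alpha>" "path_image \<alpha> \<subseteq> B" "pathstart \<alpha> = f (\<phi> 0)" "pathfinish \<alpha> = \<psi> 0"
    and \<beta>: "path \<beta>" "path_image \<beta> \<subseteq> B" "pathstart \<beta> = \<psi> 1" "pathfinish \<beta> = f (\<phi> 1)"
    and F\<phi>: "homotopic_paths Y (F \<circ> \<phi>) (\<alpha> +++ (\<psi> +++ \<beta>))"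
  obtains H \<alpha>' \<beta>' where "gmap Y b X a H" "\<And>y. y \<in> B \<Longrightarrow> H y = h y"
    "path \<alpha>'" "path_image \<alpha>' \<subseteq> A" "pathstart \<alpha>' = h (\<psi> 0)" "pathfinish \<alpha>' = \<phi> 0"
    "path \<beta>'" "path_image \<beta>' \<subseteq> A" "pathstart \<beta>' = \<phi> 1" "pathfinish \<beta>' = h (\<psi> 1)"
    "homotopic_paths X (H \<circ> \<psi>) (\<alpha>' +++ (\<phi> +++ \<beta>'))" "ghom X a X a (H \<circ> F) id"
proof -
  interpret X: arc a X A \<phi> \<tau> by fact
  interpret Y: arc b Y B \<psi> \<tau>' by fact
  obtain k where k: "continuous_on ({0..1} \<times> A) k" "k ` ({0..1::real} \<times> A) \<subseteq> A"
       "\<forall>x\<in>A. k (0, x) = h (f x)" "\<forall>x\<in>A. k (1, x) = x"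
       "\<forall>t\<in>{0..1}. \<forall>g\<in>Sym 3. \<forall>x\<in>A. k (t, a g x) = a g (k (t, x))"
    using hf unfolding ghom_iff[OF X.ginvA] by auto
  define \<theta>0 \<theta>1 where \<theta>: "\<theta>0 = (\<lambda>s. k (s, \<phi> 0))" "\<theta>1 = (\<lambda>s. k (s, \<phi> 1))"
  have p\<theta>: "path \<theta>0" "path_image \<theta>0 \<subseteq> A" "path \<theta>1" "path_image \<theta>1 \<subseteq> A"
    unfolding \<theta> path_def path_image_def using X.ends k(2)
    by (auto intro!: continuous_on_compose2[OF k(1)] continuous_intros)
  have e\<theta>: "pathstart \<theta>0 = h (f (\<phi> 0))" "pathstart \<theta>1 = h (f (\<phi> 1))"
      "pathfinish \<theta>0 = \<phi> 0" "pathfinish \<theta>1 = \<phi> 1"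
    using k X.ends by (auto simp: \<theta> pathstart_def pathfinish_def)
  have hd: "continuous_on B h" "h ` B \<subseteq> A" using h by (auto simp: gmap_def)
  note p\<alpha> = path_in_image[OF \<alpha>(1,2) hd] and p\<beta> = path_in_image[OF \<beta>(1,2) hd]
  have e: "pathstart (h \<circ> \<alpha>) = h (f (\<phi> 0))" "pathfinish (h \<circ> \<alpha>) = h (\<psi> 0)"
     "pathstart (h \<circ> \<beta>) = h (\<psi> 1)" "pathfinish (h \<circ> \<beta>) = h (f (\<phi> 1))"
    using \<alpha>(3,4) \<beta>(3,4) by (auto simp: pathstart_compose pathfinish_compose)
  have p\<phi>: "path \<phi>" "path_image \<phi> \<subseteq> X" "pathstart \<phi> = \<phi> 0" "pathfinish \<phi> = \<phi> 1"
    using X.path X.arc_subset by (auto simp: path_def path_image_def pathstart_def pathfinish_def)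
  have p\<psi>: "path \<psi>" "path_image \<psi> \<subseteq> Y" "pathstart \<psi> = \<psi> 0" "pathfinish \<psi> = \<psi> 1"
    using Y.path Y.arc_subset by (auto simp: path_def path_image_def pathstart_def pathfinish_def)
  \<comment> \<open>With these, the image of \<open>\<phi>\<close> under \<open>H \<circ> F\<close>
    is, up to homotopy, \<open>h \<circ> \<alpha>\<close>, its reverse, \<open>\<theta>0\<close>,
    \<open>\<phi>\<close>, the reverse of \<open>\<theta>1\<close>, the reverse of
    \<open>h \<circ> \<beta>\<close> and \<open>h \<circ> \<beta>\<close>, and both outer pairs
    cancel.\<close>
  define \<alpha>' \<beta>' where ab: "\<alpha>' = reversepath (h \<circ> \<alpha>) +++ \<theta>0" "\<beta>' = reversepath \<theta>1 +++ reversepath (h \<circ> \<beta>)"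
  have ab': "path \<alpha>'" "path_image \<alpha>' \<subseteq> A" "pathstart \<alpha>' = h (\<psi> 0)" "pathfinish \<alpha>' = \<phi> 0"
    "path \<beta>'" "path_image \<beta>' \<subseteq> A" "pathstart \<beta>' = \<phi> 1" "pathfinish \<beta>' = h (\<psi> 1)"
    unfolding ab using p\<theta> e\<theta> p\<alpha> p\<beta> e by (auto simp: subset_path_image_join)
  have p: "path (\<alpha>' +++ (\<phi> +++ \<beta>'))" "path_image (\<alpha>' +++ (\<phi> +++ \<beta>')) \<subseteq> X"
    using ab' p\<phi> X.A_subset by (auto simp: subset_path_image_join)
  have h': "gmap B b X a h" using h X.A_subset by (auto simp: gmap_def)
  obtain H where H: "gmap Y b X a H" "\<And>y. y \<in> B \<Longrightarrow> H y = h y"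
      "\<And>t. t \<in> {0..1} \<Longrightarrow> H (\<psi> t) = (\<alpha>' +++ (\<phi> +++ \<beta>')) t"
    by (rule Y.extend_map[OF X.gact X.ginvX h' p]) (use ab' in auto)
  have Hd: "continuous_on Y H" "H ` Y \<subseteq> X" using H(1) by (auto simp: gmap_def)
  have H\<psi>: "homotopic_paths X (H \<circ> \<psi>) (\<alpha>' +++ (\<phi> +++ \<beta>'))"
    by (rule homotopic_paths_sym, rule homotopic_paths_eq) (use p H(3) in auto)
  have pA: "path_image (h \<circ> \<alpha>) \<subseteq> X" "path_image (h \<circ> \<beta>) \<subseteq> X" "path_image \<theta>0 \<subseteq> X" "path_image \<theta>1 \<subseteq> X"
    using p\<alpha> p\<beta> p\<theta> X.A_subset by auto
  have eq: "homotopic_paths X (H \<circ> \<alpha>) (h \<circ> \<alpha>)" "homotopic_paths X (H \<circ> \<beta>) (h \<circ> \<beta>)"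
    by (rule homotopic_paths_sym, rule homotopic_paths_eq;
        use p\<alpha> p\<beta> pA H(2) \<alpha>(2) \<beta>(2) in \<open>auto simp: path_image_def image_subset_iff\<close>)+
  have "homotopic_paths X (H \<circ> (F \<circ> \<phi>)) (H \<circ> (\<alpha> +++ (\<psi> +++ \<beta>)))"
    by (rule homotopic_paths_continuous_image[OF F\<phi> Hd(1)]) (use Hd(2) in auto)
  also have "H \<circ> (\<alpha> +++ (\<psi> +++ \<beta>)) = (H \<circ> \<alpha>) +++ ((H \<circ> \<psi>) +++ (H \<circ> \<beta>))"
    by (simp add: path_compose_join)
  also have "homotopic_paths X \<dots> ((h \<circ> \<alpha>) +++ ((\<alpha>' +++ (\<phi> +++ \<beta>')) +++ (h \<circ> \<beta>)))"
    by (intro homotopic_paths_join eq H\<psi>) (use \<alpha> \<beta> p\<psi> in \<open>auto simp: pathstart_compose pathfinish_compose\<close>)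
  also have "homotopic_paths X \<dots> (\<theta>0 +++ (\<phi> +++ reversepath \<theta>1))"
    unfolding ab by (rule homotopic_paths_conjugate) (use p\<phi> p\<theta> e\<theta> p\<alpha> p\<beta> e pA in auto)
  finally have hp: "homotopic_paths X ((H \<circ> F) \<circ> \<phi>) (\<theta>0 +++ ((id \<circ> \<phi>) +++ reversepath \<theta>1))"
    by (simp only: comp_assoc id_comp)
  have "ghom X a X a (H \<circ> F) id"
  proof (rule X.ghom_if_square[OF X.gact X.ginvX])
    show "gmap X a X a (H \<circ> F)" using F(1) H(1) by (rule gmap_comp)
    show "gmap X a X a id" by (auto simp: gmap_def)
    show "continuous_on ({0..1} \<times> A) k" by fact
    show "k ` ({0..1} \<times> A) \<subseteq> X" using k X.A_subset by blast
    show "\<forall>x\<in>A. k (0, x) = (H \<circ> F) x" using k F(2) H(2) f by (auto simp: gmap_def image_subset_iff)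
  qed (use k hp \<theta> in auto)
  then show ?thesis using that H ab' H\<psi> by blast
qed

text \<open>The map produced by \<open>arc_left_inverse\<close> satisfies the hypotheses of that lemma again, so
  it has a left inverse itself; a left inverse that has a left inverse is two-sided.\<close>

lemma arc_geqv:
  fixes X A :: "'a::topological_space set" and Y B :: "'b::topological_space set"
  assumes X: "arc a X A \<phi> \<tau>" and Y: "arc b Y B \<psi> \<tau>'" and fh: "geqv A a B b f h"
    and conn: "path_component B (f (\<phi> 0)) (\<psi> 0)" "path_component B (f (\<phi> 1)) (\<psi> 1)"
  obtains F H where "geqv X a Y b F H" "\<And>x. x \<in> A \<Longrightarrow> F x = f x"
proof -
  interpret X: arc a X A \<phi> \<tau> by fact
  interpret Y: arc b Y B \<psi> \<tau>' by fact
  note fd = fh[unfolded geqv_def]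
  obtain \<alpha> where \<alpha>: "path \<alpha>" "path_image \<alpha> \<subseteq> B" "pathstart \<alpha> = f (\<phi> 0)" "pathfinish \<alpha> = \<psi> 0"
    using conn(1) by (auto simp: path_component_def)
  obtain \<beta> where \<beta>: "path \<beta>" "path_image \<beta> \<subseteq> B" "pathstart \<beta> = \<psi> 1" "pathfinish \<beta> = f (\<phi> 1)"
    using path_component_sym[OF conn(2)] by (auto simp: path_component_def)
  have p\<psi>: "path \<psi>" "path_image \<psi> \<subseteq> Y" "pathstart \<psi> = \<psi> 0" "pathfinish \<psi> = \<psi> 1"
    using Y.path Y.arc_subset by (auto simp: path_def path_image_def pathstart_def pathfinish_def)
  have p: "path (\<alpha> +++ (\<psi> +++ \<beta>))" "path_image (\<alpha> +++ (\<psi> +++ \<beta>)) \<subseteq> Y"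
    using \<alpha> \<beta> p\<psi> Y.A_subset by (auto simp: subset_path_image_join)
  have f': "gmap A a Y b f" using fd Y.A_subset by (auto simp: gmap_def)
  obtain F where F: "gmap X a Y b F" "\<And>x. x \<in> A \<Longrightarrow> F x = f x"
      "\<And>t. t \<in> {0..1} \<Longrightarrow> F (\<phi> t) = (\<alpha> +++ (\<psi> +++ \<beta>)) t"
    by (rule X.extend_map[OF Y.gact Y.ginvX f' p]) (use \<alpha> \<beta> in auto)
  have F\<phi>: "homotopic_paths Y (F \<circ> \<phi>) (\<alpha> +++ (\<psi> +++ \<beta>))"
    by (rule homotopic_paths_sym, rule homotopic_paths_eq) (use p F(3) in auto)
  obtain H \<alpha>' \<beta>' where H: "gmap Y b X a H" "\<And>y. y \<in> B \<Longrightarrow> H y = h y"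
    "path \<alpha>'" "path_image \<alpha>' \<subseteq> A" "pathstart \<alpha>' = h (\<psi> 0)" "pathfinish \<alpha>' = \<phi> 0"
    "path \<beta>'" "path_image \<beta>' \<subseteq> A" "pathstart \<beta>' = \<phi> 1" "pathfinish \<beta>' = h (\<psi> 1)"
    "homotopic_paths X (H \<circ> \<psi>) (\<alpha>' +++ (\<phi> +++ \<beta>'))" and HF: "ghom X a X a (H \<circ> F) id"
    using arc_left_inverse[OF X Y _ _ _ F(1,2) \<alpha> \<beta> F\<phi>] fd by metis
  obtain F' where F': "gmap X a Y b F'" and F'H: "ghom Y b Y b (F' \<circ> H) id"
    using arc_left_inverse[OF Y X _ _ _ H(1-11)] fd by metis
  have "ghom Y b Y b (F \<circ> H) ((F' \<circ> H) \<circ> (F \<circ> H))"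
    using ghom_sym[OF ghom_comp_right[OF Y.ginvX Y.ginvX F'H gmap_comp[OF H(1) F(1)]]] by simp
  also have "(F' \<circ> H) \<circ> (F \<circ> H) = F' \<circ> ((H \<circ> F) \<circ> H)" by (simp add: comp_assoc)
  also have "ghom Y b Y b \<dots> (F' \<circ> (id \<circ> H))"
    by (rule ghom_comp_left[OF Y.ginvX ghom_comp_right[OF Y.ginvX X.ginvX HF H(1)] F'])
  also have "ghom Y b Y b (F' \<circ> (id \<circ> H)) id" using F'H by simp
  finally have "ghom Y b Y b (F \<circ> H) id" .
  then have "geqv X a Y b F H" using F(1) H(1) HF unfolding geqv_def by blast
  then show ?thesis using that F(2) by blast
qed

section \<open>Configurations of cells\<close>

text \<open>Vertices and edges of the tree are encoded as sets with one and two elements. A set of pairwise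
  disjoint such cells is an orbit of cells of the configuration complex; the cells in this orbit are
  the enumerations of the set, see \<open>Ord\<close>.\<close>

definition config :: "nat \<Rightarrow> nat set set \<Rightarrow> bool" where
  "config n s \<longleftrightarrow> card s = n \<and> pairwise disjnt s \<and> (\<forall>c\<in>s. card c = 1 \<or> card c = 2)"

definition bdry :: "nat set set \<Rightarrow> nat set set set" where
  "bdry s = {insert {v} (s - {e}) | e v. e \<in> s \<and> card e = 2 \<and> v \<in> e}"

definition cplx :: "nat \<Rightarrow> nat set set set \<Rightarrow> bool" where
  "cplx n K \<longleftrightarrow> (\<forall>s\<in>K. config n s \<and> bdry s \<subseteq> K)"

text \<open>Positions from 3 on carry the empty set, as in \<open>conf_cells\<close>, so that an
  enumeration is determined by its first three values.\<close>

definition Ord :: "nat set set set \<Rightarrow> (nat \<Rightarrow> nat set) set" where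
  "Ord K = {b. inj_on b {..<3} \<and> b ` {..<3} \<in> K \<and> (\<forall>i\<ge>3. b i = {})}"

definition pbox :: "(nat \<Rightarrow> nat set) \<Rightarrow> (nat \<Rightarrow> nat \<Rightarrow> real) set" where
  "pbox b = {x. (\<forall>i<3. x i \<in> closed_cell (b i)) \<and> (\<forall>i\<ge>3. x i = (\<lambda>_. 0))}"

definition geom :: "nat set set set \<Rightarrow> (nat \<Rightarrow> nat \<Rightarrow> real) set" where
  "geom K = (\<Union>b\<in>Ord K. pbox b)"

lemma lessThan3: "{..<3} = {0, 1, 2::nat}"
  by auto

lemma config_bdry:
  assumes "config n s" "t \<in> bdry s" shows "config n t"
proof -
  obtain e v where e: "e \<in> s" "v \<in> e" "t = insert {v} (s - {e})"
    using assms(2) by (auto simp: bdry_def)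
  have d: "disjnt c c'" if "c \<in> s" "c' \<in> s" "c \<noteq> c'" for c c'
    using assms(1) that by (auto simp: config_def pairwise_def)
  have "finite s \<or> n = 0" "card s = n" using assms(1) by (auto simp: config_def intro: ccontr)
  moreover have "{v} \<notin> s - {e}" using d[OF e(1)] e(2) by (auto simp: disjnt_def)
  ultimately have "card t = n"
    using e card_Suc_Diff1[of s e] by (cases "finite s") (auto simp: card_insert_if)
  moreover have "pairwise disjnt t"
    unfolding e(3) pairwise_insert using d[OF e(1)] e(2) d
    by (auto simp: pairwise_def disjnt_def)
  ultimately show ?thesis using assms(1) e(3) by (auto simp: config_def)
qed

lemma config_finite:
  assumes "config n s"
  shows "c \<in> s \<Longrightarrow> finite c" "n > 0 \<Longrightarrow> finite s"
proof -
  show "finite c" if "c \<in> s"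
  proof -
    have "card c = 1 \<or> card c = 2" using assms that by (simp add: config_def)
    then have "card c \<noteq> 0" by linarith
    then show ?thesis by (metis card.infinite)
  qed
  show "n > 0 \<Longrightarrow> finite s" using assms card_ge_0_finite[of s] by (simp add: config_def)
qed

lemma finite_Ord:
  assumes "finite K"
  shows "finite (Ord K)"
proof -
  let ?C = "\<Union>{s \<in> K. finite s}"
  have "finite ?C" using assms by auto
  then have "finite {b. \<forall>i. (i \<in> {..<3::nat} \<longrightarrow> b i \<in> ?C) \<and> (i \<notin> {..<3} \<longrightarrow> b i = {})}"
    by (rule finite_set_of_finite_funs[OF finite_lessThan])
  moreover have "b i \<in> ?C" if "b \<in> Ord K" "i < 3" for b i
  proof -
    have "b ` {..<3} \<in> {s \<in> K. finite s}" using that by (simp add: Ord_def)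
    then show ?thesis using that(2) by blast
  qed
  then have "Ord K \<subseteq> {b. \<forall>i. (i \<in> {..<3::nat} \<longrightarrow> b i \<in> ?C) \<and> (i \<notin> {..<3} \<longrightarrow> b i = {})}"
    by (auto simp del: Union_iff simp: Ord_def)
  ultimately show ?thesis by (rule finite_subset[rotated])
qed

lemma closed_closed_cell: "closed (closed_cell c)"
proof -
  have "closed_cell c = {x. \<forall>i. 0 \<le> x i} \<inter> (\<Inter>i\<in>-c. {x. x i = 0}) \<inter> {x. (\<Sum>i\<in>c. x i) = 1}"
    by (auto simp: closed_cell_def)
  then show ?thesis
    by (auto intro!: closed_Int closed_Collect_all closed_Collect_le closed_Collect_eq closed_INT continuous_intros)
qed

lemma continuous_coordinate: "continuous_on S (\<lambda>x::nat \<Rightarrow> nat \<Rightarrow> real. x i j)"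
  by (rule continuous_on_subset[of UNIV], rule continuous_on_compose2[of UNIV "\<lambda>f. f j"])
    (auto intro: continuous_on_product_coordinates)

lemma closed_pbox: "closed (pbox b)"
proof -
  have "pbox b = (\<Inter>i\<in>{..<3}. (\<lambda>x. x i) -` closed_cell (b i)) \<inter> (\<Inter>i\<in>{3..}. \<Inter>j. {x. x i j = 0})"
    by (auto simp: pbox_def)
  then show ?thesis
    by (auto intro!: closed_Int closed_INT closed_vimage closed_closed_cell closed_Collect_eq
        continuous_coordinate continuous_intros)
qed

lemma closed_geom: "finite K \<Longrightarrow> closed (geom K)"
  unfolding geom_def by (intro closed_UN finite_Ord ballI closed_pbox)

lemma Ord_step:
  assumes K: "cplx 3 K" and b: "b \<in> Ord K" and j: "j < 3" and c: "c \<subseteq> b j" "c \<noteq> {}"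
  shows "b(j := c) \<in> Ord K"
proof (cases "c = b j")
  case False
  let ?s = "b ` {..<3}"
  have s: "?s \<in> K" "inj_on b {..<3}" using b by (auto simp: Ord_def)
  then have cs: "config 3 ?s" "bdry ?s \<subseteq> K" using K by (auto simp: cplx_def)
  have bj: "b j \<in> ?s" using j by auto
  then have "card (b j) = 1 \<or> card (b j) = 2" using cs by (auto simp: config_def)
  then have "card (b j) = 2"
    using c False by (metis card_1_singletonE subset_singleton_iff)
  then obtain y z where yz: "b j = {y, z}" by (auto simp: card_2_iff)
  have "c = {y} \<or> c = {z}" using c False unfolding yz by blast
  then obtain v where v: "c = {v}" "v \<in> b j" using yz by auto
  have dis: "v \<notin> b k" if "k < 3" "k \<noteq> j" for k
  proof -
    have "b k \<noteq> b j" using s(2) that j by (auto simp: inj_on_def)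
    then show ?thesis using cs(1) v(2) that j by (auto simp: config_def pairwise_def disjnt_def)
  qed
  have img: "b(j := c) ` {..<3} = insert {v} (?s - {b j})"
    using s(2) j v by (auto simp: inj_on_def image_iff)
  have "b(j := c) ` {..<3} \<in> K"
    unfolding img using cs(2) bj \<open>card (b j) = 2\<close> v by (auto simp: bdry_def)
  moreover have "inj_on (b(j := c)) {..<3}"
    using s(2) dis v by (auto simp: inj_on_def)
  ultimately show ?thesis using b j by (auto simp: Ord_def)
qed (use b in simp)

text \<open>Obtained by shrinking one position after the other. It serves to read off cells from
  supports: if a point lies in the box of \<open>b\<close>, any product of nonempty parts of its
  support belongs to the complex.\<close>

lemma Ord_face:
  assumes K: "cplx 3 K" and b: "b \<in> Ord K" and c: "\<And>j. j < 3 \<Longrightarrow> c j \<subseteq> b j \<and> c j \<noteq> {}" "\<And>j. j \<ge> 3 \<Longrightarrow> c j = {}"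
  shows "c \<in> Ord K"
proof -
  have "b(0 := c 0, 1 := c 1, 2 := c 2) \<in> Ord K"
    by (intro Ord_step[OF K] b) (use c(1) in auto)
  moreover have "b(0 := c 0, 1 := c 1, 2 := c 2) = c"
  proof
    fix i :: nat
    have "i \<ge> 3" if "i \<noteq> 0" "i \<noteq> 1" "i \<noteq> 2" using that by linarith
    then show "(b(0 := c 0, 1 := c 1, 2 := c 2)) i = c i"
      using c(2)[of i] b by (simp add: Ord_def)
  qed
  ultimately show ?thesis by simp
qed

lemma Sym3: "g \<in> Sym 3 \<longleftrightarrow> g permutes {..<3}"
  by (simp add: Sym_def atLeast0LessThan)

lemma Ord_comp: "b \<in> Ord K \<Longrightarrow> g \<in> Sym 3 \<Longrightarrow> b \<circ> g \<in> Ord K"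
proof -
  assume b: "b \<in> Ord K" and g: "g \<in> Sym 3"
  have g': "g ` {..<3} = {..<3}" "inj_on g {..<3}" "\<forall>i\<ge>3. g i = i"
    using g by (auto simp: Sym3 permutes_image permutes_inj_on intro!: permutes_not_in[of g "{..<3}"])
  have "inj_on (b \<circ> g) {..<3}" "(b \<circ> g) ` {..<3} = b ` {..<3}"
    using b g' image_comp[of b g "{..<3}"] by (simp_all add: Ord_def comp_inj_on)
  then show "b \<circ> g \<in> Ord K" using b g'(3) by (simp add: Ord_def)
qed

lemma pbox_comp:
  assumes "x \<in> pbox b" "g \<in> Sym 3"
  shows "conf_act g x \<in> pbox (b \<circ> g)"
proof -
  have "g i < 3" if "i < 3" for i using assms(2) that permutes_in_image[of g "{..<3}" i] by (auto simp: Sym3)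
  moreover have "\<forall>i\<ge>3. g i = i" using assms(2) by (auto simp: Sym3 intro!: permutes_not_in[of g "{..<3}"])
  ultimately show ?thesis using assms(1) by (auto simp: pbox_def conf_act_def)
qed

lemma gact_conf_act: "gact (conf_act :: _ \<Rightarrow> (nat \<Rightarrow> nat \<Rightarrow> real) \<Rightarrow> _)"
proof -
  have "continuous_on UNIV (conf_act g :: (nat \<Rightarrow> nat \<Rightarrow> real) \<Rightarrow> _)" for g :: "nat \<Rightarrow> nat"
    unfolding conf_act_def
    by (rule continuous_on_coordinatewise_then_product) (rule continuous_on_product_coordinates)
  then show ?thesis by (simp add: gact_def conf_act_def)
qed

lemma ginv_geom: "ginv conf_act (geom K)"
  unfolding ginv_def geom_def
proof (intro ballI)
  fix g and x :: "nat \<Rightarrow> nat \<Rightarrow> real" assume g: "g \<in> Sym 3" and "x \<in> (\<Union>b\<in>Ord K. pbox b)"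
  then obtain b where "b \<in> Ord K" "x \<in> pbox b" by blast
  then show "conf_act g x \<in> (\<Union>b\<in>Ord K. pbox b)"
    by (intro UN_I[of "b \<circ> g"] Ord_comp pbox_comp g)
qed

text \<open>The cells of \<open>s\<close> are disjoint, so a vertex with nonzero coordinate at
  position \<open>i\<close> already tells which cell stands there. This is the freeness of the
  action on the boxes of an orbit.\<close>

lemma Ord_same:
  assumes "b \<in> Ord {s}" "b' \<in> Ord {s}" "config 3 s" "x \<in> pbox b" "x \<in> pbox b'"
  shows "b = b'"
proof
  fix i
  show "b i = b' i"
  proof (cases "i < 3")
    case True
    then have x: "x i \<in> closed_cell (b i)" "x i \<in> closed_cell (b' i)" using assms by (auto simp: pbox_def)
    then obtain v where "v \<in> b i" "x i v \<noteq> 0"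
      by (auto simp: closed_cell_def) (metis sum.neutral zero_neq_one)
    then have "v \<in> b' i" using x by (auto simp: closed_cell_def)
    moreover have "b i \<in> s" "b' i \<in> s" using assms(1,2) True unfolding Ord_def by blast+
    ultimately show ?thesis
      using assms(3) \<open>v \<in> b i\<close> by (auto simp: config_def pairwise_def disjnt_def)
  qed (use assms in \<open>auto simp: Ord_def\<close>)
qed

lemma Ord_transitive:
  assumes "b \<in> Ord {s}" "b' \<in> Ord {s}"
  obtains g where "g \<in> Sym 3" "b' = b \<circ> g"
proof -
  have b: "bij_betw b {..<3} s" "bij_betw b' {..<3} s" using assms by (auto simp: Ord_def bij_betw_def)
  define g where "g i = (if i < 3 then inv_into {..<3} b (b' i) else i)" for i :: nat
  have "bij_betw (inv_into {..<3} b \<circ> b') {..<3} {..<3}"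
    using bij_betw_trans[OF b(2) bij_betw_inv_into[OF b(1)]] .
  then have "bij_betw g {..<3} {..<3}"
    by (rule iffD2[OF bij_betw_cong, rotated]) (auto simp: g_def)
  then have "g permutes {..<3}" by (intro bij_imp_permutes) (auto simp: g_def)
  moreover have "b' = b \<circ> g"
  proof
    fix i show "b' i = (b \<circ> g) i"
    proof (cases "i < 3")
      case True
      then show ?thesis
        using bij_betw_inv_into_right[OF b(1), of "b' i"] bij_betw_apply[OF b(2), of i] by (simp add: g_def)
    next
      case False
      then show ?thesis using assms by (simp add: g_def Ord_def)
    qed
  qed
  ultimately show ?thesis using that by (auto simp: Sym3)
qed

section \<open>Vertex configurations and the segments between them\<close>

definition vpt :: "(nat \<Rightarrow> nat) \<Rightarrow> nat \<Rightarrow> nat \<Rightarrow> real" where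
  "vpt p = (\<lambda>j k. if j < 3 \<and> k = p j then 1 else 0)"

definition seg :: "(nat \<Rightarrow> nat) \<Rightarrow> (nat \<Rightarrow> nat) \<Rightarrow> real \<Rightarrow> nat \<Rightarrow> nat \<Rightarrow> real" where
  "seg p q t = (\<lambda>j k. (1 - t) * vpt p j k + t * vpt q j k)"

lemma seg_0 [simp]: "seg p q 0 = vpt p" and seg_1 [simp]: "seg p q 1 = vpt q"
  by (auto simp: seg_def)

lemma seg_in_pbox:
  assumes "\<And>j. j < 3 \<Longrightarrow> p j \<in> b j \<and> q j \<in> b j \<and> finite (b j)" "0 \<le> t" "t \<le> 1"
  shows "seg p q t \<in> pbox b"
proof -
  have "(\<Sum>k\<in>b j. seg p q t j k) = 1" if "j < 3" for j
    using assms(1)[OF that] that by (simp add: seg_def vpt_def sum.distrib flip: sum_distrib_left)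
  moreover have "0 \<le> seg p q t j k" for j k using assms(2,3) by (simp add: seg_def vpt_def)
  moreover have "seg p q t j k = 0" if "j < 3" "k \<notin> b j" for j k
    using assms(1)[OF that(1)] that(2) by (auto simp: seg_def vpt_def)
  moreover have "seg p q t j = (\<lambda>_. 0)" if "j \<ge> 3" for j
    using that by (simp add: seg_def vpt_def)
  ultimately show ?thesis unfolding pbox_def closed_cell_def by blast
qed

lemma continuous_seg: "continuous_on S (seg p q)"
  unfolding seg_def by (intro continuous_on_coordinatewise_then_product continuous_intros)

lemma Ord_finite: "cplx 3 K \<Longrightarrow> b \<in> Ord K \<Longrightarrow> j < 3 \<Longrightarrow> finite (b j)"
  by (auto simp: Ord_def cplx_def intro: config_finite)

lemma path_component_geom:
  assumes K: "cplx 3 K" and b: "b \<in> Ord K" and pq: "\<And>j. j < 3 \<Longrightarrow> p j \<in> b j \<and> q j \<in> b j"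
  shows "path_component (geom K) (vpt p) (vpt q)"
  unfolding path_component_def
proof (intro exI[of _ "seg p q"] conjI)
  show "path_image (seg p q) \<subseteq> geom K"
    unfolding path_image_def geom_def using seg_in_pbox[of p b q] pq Ord_finite[OF K b] b by auto
qed (auto simp: path_def continuous_seg pathstart_def pathfinish_def)

text \<open>A cell with a single edge is a segment between two vertex configurations that differ in
  the one position \<open>i\<close>; the barycentric coordinate of \<open>q i\<close> in this
  position is its parameter.\<close>

lemma arc_geom:
  assumes K: "cplx 3 K" "finite K" and i: "i < 3" and pq: "p i \<noteq> q i" "\<And>j. j < 3 \<Longrightarrow> j \<noteq> i \<Longrightarrow> p j = q j"
    and s: "s = (\<lambda>j. {p j, q j}) ` {..<3}" "config 3 s" "s \<notin> K"
    and f: "(\<lambda>v. {v}) ` p ` {..<3} \<in> K" "(\<lambda>v. {v}) ` q ` {..<3} \<in> K"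
  shows "arc conf_act (geom (insert s K)) (geom K) (seg p q) (\<lambda>x. x i (q i))"
proof -
  define b where "b j = (if j < 3 then {p j, q j} else {})" for j :: nat
  have bs: "b ` {..<3} = s" unfolding s(1) by (auto simp: b_def)
  then have "inj_on b {..<3}" using s(2) by (intro eq_card_imp_inj_on) (auto simp: config_def)
  then have b: "b \<in> Ord {s}" using bs by (auto simp: Ord_def b_def)
  have disj: "b j \<inter> b k = {}" if "j < 3" "k < 3" "j \<noteq> k" for j k
  proof -
    have "b j \<in> s" "b k \<in> s" "b j \<noteq> b k"
      using that \<open>inj_on b {..<3}\<close> bs by (auto simp: inj_on_def)
    then show ?thesis using s(2) by (auto simp: config_def pairwise_def disjnt_def)
  qed
  have pO: "(\<lambda>j. if j < 3 then {p j} else {}) \<in> Ord K"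
    using f disj by (auto simp: Ord_def inj_on_def b_def image_image)
  have qO: "(\<lambda>j. if j < 3 then {q j} else {}) \<in> Ord K"
    using f disj by (auto simp: Ord_def inj_on_def b_def image_image)
  have arc: "seg p q ` {0..1} = pbox b"
  proof
    show "seg p q ` {0..1} \<subseteq> pbox b" using seg_in_pbox[of p b q] by (auto simp: b_def)
    show "pbox b \<subseteq> seg p q ` {0..1}"
    proof
      fix x assume x: "x \<in> pbox b"
      have c: "x j \<in> closed_cell {p j, q j}" if "j < 3" for j using x that by (auto simp: pbox_def b_def)
      have xi: "x i (p i) = 1 - x i (q i)" "0 \<le> x i (q i)" "x i (q i) \<le> 1"
        using c[OF i] pq(1) by (auto simp: closed_cell_def) (metis add.commute diff_ge_0_iff_ge le_add_same_cancel2 add_diff_cancel_left')+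
      have "x j k = seg p q (x i (q i)) j k" for j k
      proof (cases "j < 3")
        case True
        show ?thesis
        proof (cases "j = i")
          case True
          then show ?thesis using c[OF i] xi pq(1) i by (auto simp: closed_cell_def seg_def vpt_def)
        next
          case False
          then show ?thesis using c[OF True] pq(2)[OF True False] True
            by (auto simp: closed_cell_def seg_def vpt_def)
        qed
      qed (use x in \<open>auto simp: pbox_def seg_def vpt_def\<close>)
      then have "x = seg p q (x i (q i))" by (intro ext)
      then show "x \<in> seg p q ` {0..1}" using xi by auto
    qed
  qed
  \<comment> \<open>An interior point has both ends of the edge in its support, so a box of
    \<open>K\<close> containing it would have the box of \<open>b\<close> as a face, and
    \<open>s\<close> would belong to \<open>K\<close>.\<close>
  have new: "seg p q t \<notin> geom K" if t: "0 < t" "t < 1" for t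
  proof
    assume "seg p q t \<in> geom K"
    then obtain b' where b': "b' \<in> Ord K" "seg p q t \<in> pbox b'" by (auto simp: geom_def)
    have "b \<in> Ord K"
    proof (rule Ord_face[OF K(1) b'(1)])
      fix j :: nat assume j: "j < 3"
      have "seg p q t j (p j) > 0" "seg p q t j (q j) > 0"
        using t j by (auto simp: seg_def vpt_def)
      moreover have "seg p q t j v = 0" if "v \<notin> b' j" for v
        using b'(2) j that by (auto simp: pbox_def closed_cell_def)
      ultimately show "b j \<subseteq> b' j \<and> b j \<noteq> {}" using j by (fastforce simp: b_def)
    qed (auto simp: b_def)
    then show False using s(3) bs by (auto simp: Ord_def)
  qed
  show ?thesis
  proof
    show "seg p q 0 \<in> geom K" "seg p q 1 \<in> geom K"
      using seg_in_pbox[of p "\<lambda>j. if j < 3 then {p j} else {}" p 0]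
        seg_in_pbox[of q "\<lambda>j. if j < 3 then {q j} else {}" q 0] pO qO
      by (auto simp: geom_def)
    have "Ord (insert s K) = Ord K \<union> Ord {s}" by (auto simp: Ord_def)
    moreover have "Ord {s} = (\<lambda>g. b \<circ> g) ` Sym 3"
      using Ord_comp[OF b] Ord_transitive[OF b] by blast
    moreover have "pbox (b \<circ> g) = conf_act g ` pbox b" if g: "g \<in> Sym 3" for g
    proof
      show "conf_act g ` pbox b \<subseteq> pbox (b \<circ> g)" using pbox_comp g by blast
      show "pbox (b \<circ> g) \<subseteq> conf_act g ` pbox b"
      proof
        fix x assume "x \<in> pbox (b \<circ> g)"
        then have "conf_act (inv g) x \<in> pbox (b \<circ> g \<circ> inv g)" by (rule pbox_comp) (rule Sym_inv[OF g])
        then have "conf_act (inv g) x \<in> pbox b" using Sym_inv_o[OF g] by (simp add: comp_assoc)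
        then show "x \<in> conf_act g ` pbox b" using gact_inv(2)[OF gact_conf_act g] by (metis imageI)
      qed
    qed
    ultimately show "geom (insert s K) = geom K \<union> (\<Union>g\<in>Sym 3. conf_act g ` seg p q ` {0..1})"
      unfolding arc by (auto simp: geom_def)
    show "g = id" if "g \<in> Sym 3" "0 < t" "t < 1" "0 < t'" "t' < 1" "conf_act g (seg p q t) = seg p q t'" for t t' g
    proof -
      have "seg p q t' \<in> pbox (b \<circ> g)" "seg p q t' \<in> pbox b"
        using that pbox_comp[of "seg p q t" b g] unfolding arc[symmetric] by force+
      then have e: "b \<circ> g = b" using Ord_same[OF Ord_comp[OF b] b s(2)] that by blast
      show "g = id"
      proof
        fix j
        have "g j < 3" if "j < 3" using \<open>g \<in> Sym 3\<close> that permutes_in_image[of g "{..<3}" j] by (auto simp: Sym3)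
        moreover have "b (g j) = b j" using fun_cong[OF e, of j] by simp
        moreover have "j \<ge> 3 \<Longrightarrow> g j = j" using \<open>g \<in> Sym 3\<close> by (auto simp: Sym3 intro!: permutes_not_in[of g "{..<3}"])
        ultimately show "g j = id j" using \<open>inj_on b {..<3}\<close> by (cases "j < 3") (auto simp: inj_on_def)
      qed
    qed
    show "closed (seg p q ` {0..1})" unfolding arc by (rule closed_pbox)
    show "continuous_on (seg p q ` {0..1}) (\<lambda>x. x i (q i))"
      by (rule continuous_coordinate)
    show "seg p q t i (q i) = t" if "0 \<le> t" "t \<le> 1" for t
      using that pq i by (simp add: seg_def vpt_def)
  qed (use gact_conf_act ginv_geom closed_geom[OF K(2)] new continuous_seg in auto)
qed

section \<open>Expansions\<close>

text \<open>The cell with an edge \<open>{u, w}\<close> and its face at \<open>w\<close> is pushed away from that face by the radial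
  projection from a point outside: in the direction of the edge \<open>{u, w}\<close> the projection point has
  barycentric coordinates \<open>-1\<close> at \<open>u\<close> and \<open>2\<close> at \<open>w\<close>, in the direction of any other cell it is the
  barycenter. The function \<open>width\<close> is normalized such that the projection scales by the inverse of the
  largest width.\<close>

definition center :: "nat \<Rightarrow> nat \<Rightarrow> nat set \<Rightarrow> nat \<Rightarrow> real" where
  "center u w c k = (if c = {u, w} then (if k = u then -1 else if k = w then 2 else 0)
     else if k \<in> c then 1 / real (card c) else 0)"

definition width :: "nat \<Rightarrow> nat \<Rightarrow> nat set \<Rightarrow> (nat \<Rightarrow> real) \<Rightarrow> real" where
  "width u w c y = (if c = {u, w} then (1 + y u) / 2 else (\<Sum>k\<in>c. \<bar>y k - 1 / real (card c)\<bar>))"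

definition scaled :: "nat \<Rightarrow> nat \<Rightarrow> real \<Rightarrow> nat set \<Rightarrow> (nat \<Rightarrow> real) \<Rightarrow> nat \<Rightarrow> real" where
  "scaled u w m c y k = center u w c k + m * (y k - center u w c k)"

lemma cell_cases:
  assumes "card c = 1 \<or> card c = 2"
  obtains (edge) "c = {u, w}" | (vertex) v where "c = {v}" "c \<noteq> {u, w}"
    | (other) p q where "c = {p, q}" "p \<noteq> q" "c \<noteq> {u, w}"
  using assms by (metis card_1_singletonE card_2_iff)

lemma closed_cell_edge:
  "p \<noteq> q \<Longrightarrow> y \<in> closed_cell {p, q} \<longleftrightarrow> 0 \<le> y p \<and> 0 \<le> y q \<and> y p + y q = 1 \<and> (\<forall>k. k \<noteq> p \<longrightarrow> k \<noteq> q \<longrightarrow> y k = 0)"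
  by (auto simp: closed_cell_def)

lemma closed_cell_vertex: "y \<in> closed_cell {p} \<longleftrightarrow> y p = 1 \<and> (\<forall>k. k \<noteq> p \<longrightarrow> y k = 0)"
  by (auto simp: closed_cell_def) (metis order_refl zero_le_one)

lemma width_other:
  assumes "p \<noteq> q" "{p, q} \<noteq> {u, w}" "y p + y q = 1"
  shows "width u w {p, q} y = \<bar>2 * y p - 1\<bar>"
proof -
  have "\<bar>y q - 1 / 2\<bar> = \<bar>y p - 1 / 2\<bar>" using assms(3) by linarith
  then have "width u w {p, q} y = 2 * \<bar>y p - 1 / 2\<bar>" using assms by (simp add: width_def)
  then show ?thesis by (auto simp: abs_if)
qed

text \<open>The lower bound in the direction of \<open>{u, w}\<close> keeps the largest width away
  from zero, so that the projection may divide by it.\<close>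

lemma width_bounds:
  assumes "card c = 1 \<or> card c = 2" "u \<noteq> w" "y \<in> closed_cell c"
  shows "width u w c y \<le> 1" "c = {u, w} \<Longrightarrow> 1 / 2 \<le> width u w c y"
proof -
  show "width u w c y \<le> 1"
    using assms(1)
  proof (cases rule: cell_cases[where u = u and w = w])
    case edge
    then show ?thesis using assms(2,3) by (auto simp: width_def closed_cell_edge)
  next
    case (vertex v)
    then show ?thesis using assms(3) by (auto simp: width_def closed_cell_vertex)
  next
    case (other p q)
    then show ?thesis
      using assms(3) width_other[of p q u w y] by (auto simp: closed_cell_edge)
  qed
  show "c = {u, w} \<Longrightarrow> 1 / 2 \<le> width u w c y"
    using assms(2,3) by (auto simp: width_def closed_cell_edge)
qed

lemma scaled_edge:
  assumes "u \<noteq> w" "y w = 1 - y u" "\<And>k. k \<noteq> u \<Longrightarrow> k \<noteq> w \<Longrightarrow> y k = 0"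
  shows "scaled u w m {u, w} y u = m * (1 + y u) - 1" "scaled u w m {u, w} y w = 2 - m * (1 + y u)"
    "k \<noteq> u \<Longrightarrow> k \<noteq> w \<Longrightarrow> scaled u w m {u, w} y k = 0"
proof -
  have "m * (y w - 2) = - (m * (1 + y u))" unfolding assms(2) by (simp add: algebra_simps)
  then show "scaled u w m {u, w} y w = 2 - m * (1 + y u)"
    using assms(1) by (simp add: scaled_def center_def)
qed (use assms in \<open>auto simp: scaled_def center_def\<close>)

lemma scaled_other:
  assumes "p \<noteq> q" "{p, q} \<noteq> {u, w}" "y q = 1 - y p" "\<And>k. k \<noteq> p \<Longrightarrow> k \<noteq> q \<Longrightarrow> y k = 0"
  shows "scaled u w m {p, q} y p = 1 / 2 + m * (2 * y p - 1) / 2"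
    "scaled u w m {p, q} y q = 1 / 2 - m * (2 * y p - 1) / 2"
    "k \<noteq> p \<Longrightarrow> k \<noteq> q \<Longrightarrow> scaled u w m {p, q} y k = 0"
proof -
  have d: "y p - 1 / 2 = (2 * y p - 1) / 2" "y q - 1 / 2 = - ((2 * y p - 1) / 2)"
    unfolding assms(3) by (simp_all add: field_simps)
  have c: "center u w {p, q} p = 1 / 2" "center u w {p, q} q = 1 / 2"
    using assms(1,2) by (simp_all add: center_def)
  show "scaled u w m {p, q} y p = 1 / 2 + m * (2 * y p - 1) / 2"
    "scaled u w m {p, q} y q = 1 / 2 - m * (2 * y p - 1) / 2"
    unfolding scaled_def c d by simp_all
qed (use assms in \<open>auto simp: scaled_def center_def\<close>)

text \<open>The bound on \<open>m * width\<close> stops the point before it passes an end that faces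
  away from the center. The bound \<open>1 \<le> m\<close> matters in the direction of
  \<open>{u, w}\<close>: there the center lies beyond \<open>w\<close>, and shrinking could draw the
  point out of the cell through \<open>w\<close>.\<close>

lemma scaled_in_cell:
  assumes c: "card c = 1 \<or> card c = 2" "u \<noteq> w" "y \<in> closed_cell c"
    and m: "1 \<le> m" "m * width u w c y \<le> 1"
  shows "scaled u w m c y \<in> closed_cell c"
  using c(1)
proof (cases rule: cell_cases[where u = u and w = w])
  case edge
  have y: "0 \<le> y u" "y w = 1 - y u" "\<And>k. k \<noteq> u \<Longrightarrow> k \<noteq> w \<Longrightarrow> y k = 0"
    using c edge by (auto simp: closed_cell_edge)
  have "m * (1 + y u) \<le> 2" using m edge by (simp add: width_def)
  moreover have "1 \<le> m * (1 + y u)" using mult_mono[of 1 m 1 "1 + y u"] m y by simp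
  ultimately show ?thesis
    using y(1) scaled_edge[OF c(2) y(2,3)] unfolding edge closed_cell_edge[OF c(2)] by auto
next
  case (vertex v)
  then have "scaled u w m c y = y"
    using c(3) by (auto simp: scaled_def center_def closed_cell_vertex)
  then show ?thesis using c by simp
next
  case (other p q)
  have y: "y q = 1 - y p" "\<And>k. k \<noteq> p \<Longrightarrow> k \<noteq> q \<Longrightarrow> y k = 0"
    using c other by (auto simp: closed_cell_edge)
  have "m * \<bar>2 * y p - 1\<bar> \<le> 1" using m other y width_other[of p q u w y] by simp
  then have "\<bar>m * (2 * y p - 1)\<bar> \<le> 1" using m by (simp add: abs_mult)
  then show ?thesis
    using scaled_other[OF other(2) other(3)[unfolded other(1)] y]
    unfolding other(1) closed_cell_edge[OF other(2)] abs_le_iff by auto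
qed

lemma closed_cell_end:
  assumes "p \<noteq> q" "y \<in> closed_cell {p, q}" "y p = 1"
  shows "y \<in> closed_cell {p}"
proof -
  have "y k = 0" if "k \<noteq> p" for k
    using assms that unfolding closed_cell_edge[OF assms(1)] by (cases "k = q") auto
  then show ?thesis using assms(3) by (simp add: closed_cell_vertex)
qed

text \<open>Motion away from the center stops at an end of the cell. On \<open>{u, w}\<close> this
  end is \<open>u\<close>, since the center lies on the side of \<open>w\<close>; this is why the
  projection avoids the face at \<open>w\<close>.\<close>

lemma scaled_extreme:
  assumes c: "card c = 1 \<or> card c = 2" "u \<noteq> w" "y \<in> closed_cell c"
    and m: "1 \<le> m" "m * width u w c y = 1"
  obtains v where "v \<in> c" "card c = 2" "c = {u, w} \<longrightarrow> v = u" "scaled u w m c y \<in> closed_cell {v}"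
  using c(1)
proof (cases rule: cell_cases[where u = u and w = w])
  case edge
  have y: "y w = 1 - y u" "\<And>k. k \<noteq> u \<Longrightarrow> k \<noteq> w \<Longrightarrow> y k = 0"
    using c edge by (auto simp: closed_cell_edge)
  have "m * (1 + y u) = 2" using m edge by (simp add: width_def)
  then have "scaled u w m {u, w} y u = 1"
    using scaled_edge(1)[OF c(2) y, where m = m] by simp
  then have "scaled u w m c y \<in> closed_cell {u}"
    using closed_cell_end[OF c(2)] scaled_in_cell[OF c m(1)] m(2) unfolding edge by simp
  then show ?thesis using that[of u] edge c(2) by simp
next
  case (vertex v)
  then have "width u w c y = 0"
    using c(3) by (auto simp: width_def closed_cell_vertex)
  then show ?thesis using m by simp
next
  case (other p q)
  have y: "y q = 1 - y p" "\<And>k. k \<noteq> p \<Longrightarrow> k \<noteq> q \<Longrightarrow> y k = 0"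
    using c other by (auto simp: closed_cell_edge)
  have "m * \<bar>2 * y p - 1\<bar> = 1" using m other y width_other[of p q u w y] by simp
  then have "\<bar>m * (2 * y p - 1)\<bar> = 1" using m by (simp add: abs_mult)
  then have "m * (2 * y p - 1) = 1 \<or> m * (2 * y p - 1) = -1" by linarith
  then have "scaled u w m {p, q} y p = 1 \<or> scaled u w m {p, q} y q = 1"
    using scaled_other(1,2)[OF other(2) other(3)[unfolded other(1)] y, where m = m] by auto
  moreover have "scaled u w m {p, q} y \<in> closed_cell {p, q}"
    using scaled_in_cell[OF c m(1)] m(2) other(1) by simp
  ultimately have "scaled u w m c y \<in> closed_cell {p} \<or> scaled u w m c y \<in> closed_cell {q}"
    using closed_cell_end[OF other(2)] closed_cell_end[OF other(2)[symmetric]]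
    unfolding other(1) by (metis insert_commute)
  then show ?thesis using that[of p] that[of q] other by auto
qed

text \<open>Width below 1 means that no end facing away from the center has been reached. In the
  direction of \<open>{u, w}\<close> this says nothing about the coordinate of \<open>u\<close>,
  which vanishes at \<open>w\<close>.\<close>

lemma width_interior:
  assumes c: "card c = 1 \<or> card c = 2" "u \<noteq> w" "y \<in> closed_cell c" "width u w c y < 1"
    and k: "k \<in> c" "c = {u, w} \<Longrightarrow> k = w"
  shows "y k > 0"
  using c(1)
proof (cases rule: cell_cases[where u = u and w = w])
  case edge
  then show ?thesis using c k by (auto simp: width_def closed_cell_edge)
next
  case (vertex v)
  then show ?thesis using c k by (auto simp: closed_cell_vertex)
next
  case (other p q)
  then show ?thesis using c k width_other[of p q u w y] by (auto simp: closed_cell_edge)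
qed

text \<open>On the ray from the center, a position of largest width is the first to reach an end of
  its cell. A maximum over positions is also insensitive to their order, which makes the projection
  equivariant.\<close>

definition maxwidth :: "nat \<Rightarrow> nat \<Rightarrow> (nat \<Rightarrow> nat set) \<Rightarrow> (nat \<Rightarrow> nat \<Rightarrow> real) \<Rightarrow> real" where
  "maxwidth u w b x = Max ((\<lambda>j. width u w (b j) (x j)) ` {..<3})"

definition push :: "nat \<Rightarrow> nat \<Rightarrow> (nat \<Rightarrow> nat set) \<Rightarrow> real \<Rightarrow> (nat \<Rightarrow> nat \<Rightarrow> real) \<Rightarrow> nat \<Rightarrow> nat \<Rightarrow> real" where
  "push u w b t x = (\<lambda>j k. if j < 3 then scaled u w (1 - t + t / maxwidth u w b x) (b j) (x j) k else 0)"

lemma maxwidth_eq: "maxwidth u w b x =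
    max (width u w (b 0) (x 0)) (max (width u w (b 1) (x 1)) (width u w (b 2) (x 2)))"
  by (simp add: maxwidth_def lessThan3)

lemma continuous_maxwidth: "continuous_on S (maxwidth u w b)"
proof -
  have "continuous_on S (\<lambda>x::nat \<Rightarrow> nat \<Rightarrow> real. width u w (b j) (x j))" for j
    unfolding width_def by (cases "b j = {u, w}") (auto intro!: continuous_intros continuous_coordinate)
  then show ?thesis
    unfolding maxwidth_eq[abs_def] by (intro continuous_on_max)
qed

lemma config_disjnt: "config n s \<Longrightarrow> c \<in> s \<Longrightarrow> c' \<in> s \<Longrightarrow> c \<noteq> c' \<Longrightarrow> disjnt c c'"
  by (auto simp: config_def dest: pairwiseD)

text \<open>On each box of \<open>s\<close> the radial projection ends in the faces other than the
  free one, and it moves no point that lies in \<open>geom K\<close> already. It therefore glues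
  with the identity of \<open>geom K\<close> to an equivariant strong deformation
  retraction.\<close>

lemma expansion_geom:
  assumes K: "cplx 3 K" "finite K" and s: "config 3 s" "{u, w} \<in> s" "u \<noteq> w"
    and a: "a = insert {w} (s - {{u, w}})" "s \<notin> K" "a \<notin> K" "bdry s - {a} \<subseteq> K"
  obtains r where "geqv (geom (insert s (insert a K))) conf_act (geom K) conf_act r id"
    "\<And>x. x \<in> geom K \<Longrightarrow> r x = x"
proof -
  let ?X = "geom (insert s (insert a K))" and ?L = "maxwidth u w" and ?P = "push u w"
  have cell: "card (b j) = 1 \<or> card (b j) = 2" if "b \<in> Ord {s}" "j < 3" for b j
    using that s(1) by (auto simp: Ord_def config_def)
  have xc: "x j \<in> closed_cell (b j)" if "x \<in> pbox b" "j < 3" for x b j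
    using that by (simp add: pbox_def)
  have edge: "\<exists>i<3. b i = {u, w}" if "b \<in> Ord {s}" for b
    using that s(2) by (auto simp: Ord_def)
  have Ord_insert: "Ord (insert s (insert a K)) = Ord {s} \<union> Ord {a} \<union> Ord K"
    by (auto simp: Ord_def)
  have Lge: "width u w (b j) (x j) \<le> ?L b x" if "j < 3" for b x j
    unfolding maxwidth_def using that by (intro Max_ge) auto
  have L: "1 / 2 \<le> ?L b x" "?L b x \<le> 1" if b: "b \<in> Ord {s}" "x \<in> pbox b" for b x
  proof -
    obtain i where i: "i < 3" "b i = {u, w}" using edge[OF b(1)] by blast
    show "1 / 2 \<le> ?L b x"
      using width_bounds(2)[OF cell[OF b(1) i(1)] s(3) xc[OF b(2) i(1)] i(2)] Lge[OF i(1)] by (rule order_trans)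
    show "?L b x \<le> 1"
      unfolding maxwidth_def using width_bounds(1)[OF cell[OF b(1)] s(3) xc[OF b(2)]]
      by (intro Max.boundedI) (auto simp: lessThan_empty_iff)
  qed
  define m where "m b t x = 1 - t + t / ?L b x" for b x and t :: real
  have m: "1 \<le> m b t x" "m b t x * ?L b x \<le> 1" if "b \<in> Ord {s}" "x \<in> pbox b" "0 \<le> t" "t \<le> 1" for b x t
  proof -
    have "1 \<le> 1 / ?L b x" using L[OF that(1,2)] by (simp add: field_simps)
    then have "t * 1 \<le> t * (1 / ?L b x)" using that by (intro mult_left_mono) auto
    then show "1 \<le> m b t x" by (simp add: m_def)
    have "(1 - t) * ?L b x \<le> (1 - t) * 1" using L[OF that(1,2)] that by (intro mult_left_mono) auto
    moreover have "m b t x * ?L b x = (1 - t) * ?L b x + t" using L[OF that(1,2)] by (simp add: m_def field_simps)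
    ultimately show "m b t x * ?L b x \<le> 1" by simp
  qed
  have P: "?P b t x j = scaled u w (m b t x) (b j) (x j)" if "j < 3" for b t x j
    using that by (auto simp: push_def m_def)
  have P_in: "?P b t x \<in> pbox b" if "b \<in> Ord {s}" "x \<in> pbox b" "0 \<le> t" "t \<le> 1" for b x t
    unfolding pbox_def
  proof (intro CollectI conjI allI impI)
    fix j :: nat assume j: "j < 3"
    have "m b t x * width u w (b j) (x j) \<le> m b t x * ?L b x"
      using m(1)[OF that] by (intro mult_left_mono Lge[OF j]) auto
    also note m(2)[OF that]
    finally show "?P b t x j \<in> closed_cell (b j)"
      unfolding P[OF j]
      by (intro scaled_in_cell cell[OF that(1) j] s(3) xc[OF that(2) j] m(1)[OF that])
  qed (simp add: push_def)
  have P1: "?P b 1 x \<in> geom K" if b: "b \<in> Ord {s}" "x \<in> pbox b" for b x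
  proof -
    have "?L b x \<in> (\<lambda>j. width u w (b j) (x j)) ` {..<3}"
      unfolding maxwidth_def by (intro Max_in) (auto simp: lessThan_empty_iff)
    then obtain j where j: "j < 3" "?L b x = width u w (b j) (x j)" by auto
    have m1: "m b 1 x * width u w (b j) (x j) = 1" using L[OF b] j by (simp add: m_def)
    obtain v where v: "v \<in> b j" "card (b j) = 2" "b j = {u, w} \<longrightarrow> v = u" "?P b 1 x j \<in> closed_cell {v}"
      unfolding P[OF j(1)]
      by (rule scaled_extreme[OF cell[OF b(1) j(1)] s(3) xc[OF b(2) j(1)] m(1)[OF b zero_le_one order_refl] m1])
    let ?t = "insert {v} (s - {b j})"
    have bj: "b j \<in> s" "inj_on b {..<3}" "b ` {..<3} = s" using b(1) j(1) by (auto simp: Ord_def)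
    have dis: "v \<notin> b k" if "k < 3" "k \<noteq> j" for k
    proof -
      have "b k \<noteq> b j" "b k \<in> s" using bj that j by (auto simp: inj_on_def)
      then show ?thesis using s(1) v(1) bj(1) by (auto simp: config_def pairwise_def disjnt_def)
    qed
    have "?t \<in> bdry s" using bj v by (auto simp: bdry_def)
    \<comment> \<open>Either the edge \<open>{u, w}\<close> has reached an end, which is
      \<open>u\<close> and yields a cell that \<open>a\<close> does not have; or another edge has,
      and \<open>{u, w}\<close> survives, which \<open>a\<close> does not contain either.\<close>
    moreover have "?t \<noteq> a"
    proof (cases "b j = {u, w}")
      case True
      have "{u} \<notin> a"
      proof
        assume "{u} \<in> a"
        then have "{u} \<in> s" and "{u} \<noteq> {u, w}" using a(1) s(3) by auto
        have "pairwise disjnt s" using s(1) by (simp add: config_def)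
        from pairwiseD[OF this \<open>{u} \<in> s\<close> s(2) \<open>{u} \<noteq> {u, w}\<close>] show False by simp
      qed
      then show ?thesis using v True by auto
    next
      case False
      then have "{u, w} \<in> ?t" using s(2) by auto
      moreover have "{u, w} \<notin> a" using a(1) s(3) by auto
      ultimately show ?thesis by metis
    qed
    ultimately have t: "?t \<in> K" using a(4) by auto
    have "b(j := {v}) ` {..<3} = ?t" using bj j(1) by (auto simp: inj_on_def)
    moreover have "inj_on (b(j := {v})) {..<3}" using bj(2) dis by (auto simp: inj_on_def)
    ultimately have "b(j := {v}) \<in> Ord K" using t b(1) j(1) by (simp add: Ord_def)
    moreover have "?P b 1 x \<in> pbox (b(j := {v}))"
      using P_in[OF b, of 1] v(4) by (auto simp: pbox_def)
    ultimately show ?thesis by (auto simp: geom_def)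
  qed
  \<comment> \<open>If all widths were below 1, the support of \<open>x\<close> would contain
    \<open>w\<close> and every vertex of the other two cells, so a box of \<open>K\<close> through
    \<open>x\<close> would have an enumeration of \<open>a\<close> as a face.\<close>
  have L1: "?L b x = 1" if b: "b \<in> Ord {s}" "x \<in> pbox b" and x: "x \<in> geom K" for b x
  proof (rule ccontr)
    assume "?L b x \<noteq> 1"
    then have lt: "width u w (b j) (x j) < 1" if "j < 3" for j using L(2)[OF b] Lge[OF that, of b x] by linarith
    obtain b' where b': "b' \<in> Ord K" "x \<in> pbox b'" using x by (auto simp: geom_def)
    obtain i where i: "i < 3" "b i = {u, w}" using edge[OF b(1)] by blast
    have ne: "b j \<noteq> {u, w}" if "j < 3" "j \<noteq> i" for j
      using that i b(1) by (auto simp: Ord_def inj_on_def)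
    have pos: "k \<in> b' j" if "j < 3" "k \<in> b j" "b j = {u, w} \<Longrightarrow> k = w" for j k
    proof -
      have "x j k \<noteq> 0"
        using width_interior[OF cell[OF b(1) that(1)] s(3) xc[OF b(2) that(1)] lt[OF that(1)] that(2,3)] by simp
      then show ?thesis using xc[OF b'(2) that(1)] unfolding closed_cell_def by blast
    qed
    have "b(i := {w}) \<in> Ord K"
    proof (rule Ord_face[OF K(1) b'(1)])
      fix j :: nat assume j: "j < 3"
      have "b j \<noteq> {}" using cell[OF b(1) j] by auto
      then show "(b(i := {w})) j \<subseteq> b' j \<and> (b(i := {w})) j \<noteq> {}"
        using pos[OF j] ne[OF j] i by (cases "j = i") auto
    qed (use b(1) i in \<open>auto simp: Ord_def\<close>)
    moreover have "b(i := {w}) ` {..<3} = a"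
      using b(1) i a(1) by (auto simp: Ord_def inj_on_def)
    ultimately show False using a(3) by (simp add: Ord_def)
  qed
  have Pfix: "?P b t x = x" if b: "b \<in> Ord {s}" "x \<in> pbox b" and "x \<in> geom K \<or> t = 0" for b t x
  proof (intro ext)
    fix j k
    have "m b t x = 1" using that L1[OF b] by (auto simp: m_def)
    then show "?P b t x j k = x j k"
      using P[of j] b(2) by (cases "j < 3") (auto simp: scaled_def push_def pbox_def)
  qed
  \<comment> \<open>The boxes of \<open>a\<close> are faces of boxes of \<open>s\<close> and
    contribute no further points.\<close>
  have X: "?X = geom K \<union> (\<Union>b\<in>Ord {s}. pbox b)"
  proof -
    have "pbox b \<subseteq> (\<Union>b\<in>Ord {s}. pbox b)" if b: "b \<in> Ord {a}" for b
    proof -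
      have bi: "inj_on b {..<3}" "b ` {..<3} = a" using b by (auto simp: Ord_def)
      have "{w} \<in> b ` {..<3}" using bi(2) a(1) by simp
      then obtain i where i: "i < 3" "b i = {w}" by (metis imageE lessThan_iff)
      have d: "disjnt c {u, w}" if "c \<in> s - {{u, w}}" for c
        using config_disjnt[OF s(1) _ s(2)] that by auto
      have "{w} \<notin> s - {{u, w}}" using d[of "{w}"] by (auto simp: disjnt_def)
      have im: "b ` ({..<3} - {i}) = s - {{u, w}}"
      proof -
        have "b ` ({..<3} - {i}) = b ` {..<3} - b ` {i}"
          by (rule inj_on_image_set_diff[OF bi(1)]) (use i in auto)
        also have "\<dots> = insert {w} (s - {{u, w}}) - {{w}}" unfolding bi(2) a(1) using i(2) by simp
        also have "\<dots> = s - {{u, w}}" using \<open>{w} \<notin> s - {{u, w}}\<close> by simp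
        finally show ?thesis .
      qed
      have "b(i := {u, w}) ` {..<3} = insert {u, w} (b ` ({..<3} - {i}))"
        by (subst fun_upd_image) (simp add: i(1))
      then have "b(i := {u, w}) ` {..<3} = s" unfolding im using s(2) by (simp add: insert_absorb)
      moreover have "inj_on (b(i := {u, w})) {..<3}"
        using calculation s(1) by (intro eq_card_imp_inj_on) (auto simp: config_def)
      ultimately have "b(i := {u, w}) \<in> Ord {s}" using b i by (simp add: Ord_def)
      moreover have "closed_cell {w} \<subseteq> closed_cell {u, w}"
        using s(3) by (auto simp: closed_cell_edge closed_cell_vertex)
      then have "x j \<in> closed_cell ((b(i := {u, w})) j)" if "x \<in> pbox b" "j < 3" for x j
        using xc[OF that] i by (cases "j = i") auto
      then have "pbox b \<subseteq> pbox (b(i := {u, w}))" unfolding pbox_def by blast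
      ultimately show ?thesis by blast
    qed
    then show ?thesis unfolding geom_def Ord_insert by blast
  qed
  \<comment> \<open>By \<open>Ord_same\<close> a point lies in at most one box of \<open>s\<close>,
    so the description is unambiguous; in \<open>geom K\<close> both cases agree by
    \<open>Pfix\<close>.\<close>
  define H where "H z = (if snd z \<in> geom K then snd z
     else ?P (THE b. b \<in> Ord {s} \<and> snd z \<in> pbox b) (fst z) (snd z))" for z :: "real \<times> (nat \<Rightarrow> nat \<Rightarrow> real)"
  have HP: "H (t, x) = ?P b t x" if b: "b \<in> Ord {s}" "x \<in> pbox b" for b t x
  proof (cases "x \<in> geom K")
    case False
    have "(THE b. b \<in> Ord {s} \<and> x \<in> pbox b) = b"
      using b Ord_same[OF _ _ s(1)] by (intro the_equality) auto
    then show ?thesis using False by (simp add: H_def)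
  qed (use Pfix[OF b] in \<open>simp add: H_def\<close>)
  have HK: "H (t, x) = x" if "x \<in> geom K" for t x
    using that by (simp add: H_def)
  have contP: "continuous_on ({0..1} \<times> pbox b) (\<lambda>z. ?P b (fst z) (snd z))" if b: "b \<in> Ord {s}" for b
  proof (rule continuous_on_coordinatewise_then_product)+
    fix j k
    have cx: "continuous_on ({0..1} \<times> pbox b) (\<lambda>z. snd z j k)"
      by (rule continuous_on_compose2[OF continuous_coordinate[of UNIV] continuous_on_snd[OF continuous_on_id] subset_UNIV])
    have cL: "continuous_on ({0..1} \<times> pbox b) (\<lambda>z. ?L b (snd z))"
      by (rule continuous_on_compose2[OF continuous_maxwidth[of UNIV] continuous_on_snd[OF continuous_on_id] subset_UNIV])
    have "?L b (snd z) \<noteq> 0" if "z \<in> {0..1::real} \<times> pbox b" for z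
      using L(1)[OF b, of "snd z"] that by force
    then show "continuous_on ({0..1} \<times> pbox b) (\<lambda>z. ?P b (fst z) (snd z) j k)"
      unfolding push_def scaled_def by (cases "j < 3") (auto intro!: continuous_intros cx cL)
  qed
  have contH: "continuous_on ({0..1} \<times> ?X) H"
  proof -
    have "continuous_on ({0..1} \<times> geom K) H"
      by (rule continuous_on_eq[OF continuous_on_snd[OF continuous_on_id]]) (auto simp: HK)
    moreover have "continuous_on ({0..1} \<times> pbox b) H" if b: "b \<in> Ord {s}" for b
      by (rule continuous_on_eq[OF contP[OF b]]) (auto simp: HP[OF b])
    moreover have "finite (Ord {s})" by (simp add: finite_Ord)
    ultimately have "continuous_on ({0..1::real} \<times> geom K \<union> (\<Union>b\<in>Ord {s}. {0..1} \<times> pbox b)) H"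
      by (intro continuous_on_closed_Un continuous_on_closed_Union closed_UN closed_Times ballI
          closed_geom K closed_pbox closed_atLeastAtMost)
    moreover have "{0..1::real} \<times> geom K \<union> (\<Union>b\<in>Ord {s}. {0..1} \<times> pbox b) = {0..1} \<times> ?X"
      unfolding X by blast
    ultimately show ?thesis by simp
  qed
  have HX: "H (t, x) \<in> ?X" "H (1, x) \<in> geom K" "H (0, x) = x" if "x \<in> ?X" "0 \<le> t" "t \<le> 1" for t x
  proof -
    consider "x \<in> geom K" | b where "b \<in> Ord {s}" "x \<in> pbox b" using \<open>x \<in> ?X\<close> X by auto
    then have "H (t, x) \<in> ?X \<and> H (1, x) \<in> geom K \<and> H (0, x) = x"
    proof cases
      case 1
      then show ?thesis using HK X by simp
    next
      case (2 b)
      then show ?thesis using HP[OF 2] P_in[OF 2 that(2,3)] P1[OF 2] Pfix[OF 2] X by auto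
    qed
    then show "H (t, x) \<in> ?X" "H (1, x) \<in> geom K" "H (0, x) = x" by auto
  qed
  have Heq: "H (t, conf_act g x) = conf_act g (H (t, x))" if "x \<in> ?X" and g: "g \<in> Sym 3" for t g x
  proof -
    consider "x \<in> geom K" | b where "b \<in> Ord {s}" "x \<in> pbox b" using \<open>x \<in> ?X\<close> X by auto
    then show ?thesis
    proof cases
      case 1
      then show ?thesis using HK ginv_geom g by (simp add: ginv_def)
    next
      case (2 b)
      have gi: "g ` {..<3} = {..<3}" "g j < 3 \<longleftrightarrow> j < 3" for j
        using g permutes_image[of g "{..<3}"] permutes_in_image[of g "{..<3}" j] by (auto simp: Sym3)
      have "?L (b \<circ> g) (conf_act g x) = ?L b x"
      proof -
        have "(\<lambda>j. width u w ((b \<circ> g) j) (conf_act g x j)) ` {..<3} = (\<lambda>j. width u w (b j) (x j)) ` (g ` {..<3})"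
          by (simp add: image_image conf_act_def)
        then show ?thesis unfolding maxwidth_def gi(1) by simp
      qed
      then have "?P (b \<circ> g) t (conf_act g x) = conf_act g (?P b t x)"
        by (intro ext) (simp add: push_def conf_act_def gi(2))
      then show ?thesis using HP[OF 2] HP[OF Ord_comp[OF 2(1) g] pbox_comp[OF 2(2) g]] by simp
    qed
  qed
  define r where "r x = H (1, x)" for x
  have sub: "geom K \<subseteq> ?X" using X by blast
  have gr: "gmap ?X conf_act (geom K) conf_act r"
    unfolding gmap_def
  proof (intro conjI ballI)
    show "continuous_on ?X r"
      unfolding r_def by (rule continuous_on_compose2[OF contH]) (auto intro!: continuous_intros)
  qed (use HX(2)[of _ 0] Heq in \<open>auto simp: r_def\<close>)
  have gid: "gmap (geom K) conf_act ?X conf_act id"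
    using sub by (auto simp: gmap_def)
  have "ghom ?X conf_act ?X conf_act id (id \<circ> r)"
    unfolding ghom_iff[OF ginv_geom]
    by (intro exI[of _ H]) (use contH HX(1,2) HX(3)[OF _ order_refl zero_le_one] Heq in \<open>auto simp: r_def\<close>)
  moreover have "ghom (geom K) conf_act (geom K) conf_act (r \<circ> id) id"
    by (rule ghom_cong[OF ginv_geom gmap_ghom_refl[of _ _ _ _ id]]) (auto simp: r_def HK gmap_def)
  ultimately have "geqv ?X conf_act (geom K) conf_act r id"
    using gr gid by (simp add: geqv_def ghom_sym)
  then show ?thesis using that HK by (simp add: r_def)
qed

section \<open>Building complexes of disjoint cells\<close>

text \<open>The number counts orbits of arcs only. The relation is purely combinatorial and does not
  fix the number of points, so that a construction for n points can be turned into one for n + 1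
  points by adding a cell to every configuration, see \<open>builds_image\<close>.\<close>

inductive builds :: "nat set set set \<Rightarrow> nat \<Rightarrow> nat set set set \<Rightarrow> bool" for K where
  builds_refl: "builds K 0 K"
| builds_expand: "builds K n L \<Longrightarrow> {u, w} \<in> s \<Longrightarrow> u \<noteq> w \<Longrightarrow> a = insert {w} (s - {{u, w}}) \<Longrightarrow>
    s \<notin> L \<Longrightarrow> a \<notin> L \<Longrightarrow> bdry s - {a} \<subseteq> L \<Longrightarrow> builds K n (insert s (insert a L))"
| builds_arc: "builds K n L \<Longrightarrow> {u, w} \<in> s \<Longrightarrow> u \<noteq> w \<Longrightarrow> (\<And>c. c \<in> s \<Longrightarrow> c \<noteq> {u, w} \<Longrightarrow> card c = 1) \<Longrightarrow>
    s \<notin> L \<Longrightarrow> bdry s \<subseteq> L \<Longrightarrow> builds K (Suc n) (insert s L)"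

lemma builds_mono: "builds K n L \<Longrightarrow> K \<subseteq> L"
  by (induction rule: builds.induct) auto

lemma builds_trans: "builds L m M \<Longrightarrow> builds K n L \<Longrightarrow> builds K (n + m) M"
proof (induction rule: builds.induct)
  case (builds_expand m M u w s a)
  then show ?case by (auto intro: builds.builds_expand)
next
  case (builds_arc m M u w s)
  then have "builds K (n + m) M" by simp
  then have "builds K (Suc (n + m)) (insert s M)" by (rule builds.builds_arc) (use builds_arc.hyps in auto)
  then show ?case by simp
qed simp

lemma bdry_insert:
  assumes "c \<notin> s"
  shows "bdry (insert c s) = insert c ` bdry s \<union> {insert {v} s | v. v \<in> c \<and> card c = 2}"
proof
  show "bdry (insert c s) \<subseteq> insert c ` bdry s \<union> {insert {v} s | v. v \<in> c \<and> card c = 2}"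
  proof
    fix t assume "t \<in> bdry (insert c s)"
    then obtain e v where e: "e \<in> insert c s" "card e = 2" "v \<in> e" "t = insert {v} (insert c s - {e})"
      by (auto simp: bdry_def)
    show "t \<in> insert c ` bdry s \<union> {insert {v} s | v. v \<in> c \<and> card c = 2}"
    proof (cases "e = c")
      case True
      then show ?thesis using e assms by auto
    next
      case False
      then have "t = insert c (insert {v} (s - {e}))" "e \<in> s" using e by auto
      then show ?thesis using e by (auto simp: bdry_def)
    qed
  qed
  show "insert c ` bdry s \<union> {insert {v} s | v. v \<in> c \<and> card c = 2} \<subseteq> bdry (insert c s)"
  proof (intro Un_least subsetI)
    fix t assume "t \<in> insert c ` bdry s"
    then obtain e v where e: "e \<in> s" "card e = 2" "v \<in> e" "t = insert c (insert {v} (s - {e}))"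
      by (auto simp: bdry_def)
    then have "t = insert {v} (insert c s - {e})" using assms by auto
    then show "t \<in> bdry (insert c s)" using e by (auto simp: bdry_def)
  next
    fix t assume "t \<in> {insert {v} s | v. v \<in> c \<and> card c = 2}"
    then obtain v where v: "v \<in> c" "card c = 2" "t = insert {v} s" by blast
    then have "t = insert {v} (insert c s - {c})" using assms by auto
    then show "t \<in> bdry (insert c s)" using v by (auto simp: bdry_def)
  qed
qed

lemma insert_notin_image:
  assumes "c \<notin> s" "s \<notin> L" "\<And>t. t \<in> L \<Longrightarrow> c \<notin> t" "insert c s \<notin> M"
  shows "insert c s \<notin> M \<union> insert c ` L"
proof
  assume "insert c s \<in> M \<union> insert c ` L"
  then obtain t where "t \<in> L" "insert c s = insert c t" using assms(4) by blast
  then show False using assms(1-3) insert_ident[of c s t] by metis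
qed

text \<open>Adding a vertex \<open>c\<close> to all configurations keeps dimensions, so arcs remain
  arcs. Adding an edge raises dimensions by one: arcs would become squares, hence
  \<open>n = 0\<close>, and the faces with an endpoint of \<open>c\<close> must be present in
  \<open>M\<close> beforehand.\<close>

lemma builds_image:
  assumes "builds K n L" "\<And>s. s \<in> L \<Longrightarrow> c \<notin> s" "\<And>s. s \<in> L - K \<Longrightarrow> insert c s \<notin> M"
    "card c = 2 \<Longrightarrow> n = 0 \<and> (\<forall>s\<in>L - K. \<forall>v\<in>c. insert {v} s \<in> M)" "card c = 1 \<or> card c = 2"
  shows "builds (M \<union> insert c ` K) n (M \<union> insert c ` L)"
  using assms
proof (induction rule: builds.induct)
  case builds_refl
  show ?case by (rule builds.builds_refl)
next
  case (builds_expand n L u w s a)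
  have K: "K \<subseteq> L" by (rule builds_mono) fact
  have cs: "c \<notin> s" "c \<notin> a" "s \<notin> K" "a \<notin> K" 
    using builds_expand.prems(1)[of s] builds_expand.prems(1)[of a] builds_expand.hyps(5,6) K by blast+
  have IH: "builds (M \<union> insert c ` K) n (M \<union> insert c ` L)"
    using builds_expand.prems by (intro builds_expand.IH) auto
  have "builds (M \<union> insert c ` K) n (insert (insert c s) (insert (insert c a) (M \<union> insert c ` L)))"
  proof (rule builds.builds_expand[OF IH])
    show "{u, w} \<in> insert c s" "u \<noteq> w" using builds_expand.hyps(2,3) by auto
    show "insert c a = insert {w} (insert c s - {{u, w}})"
    proof -
      have "{u, w} \<noteq> c" using cs(1) builds_expand.hyps(2) by blast
      then have "insert c s - {{u, w}} = insert c (s - {{u, w}})" by blast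
      then show ?thesis using builds_expand.hyps(4) by (simp add: insert_commute)
    qed
    show "insert c s \<notin> M \<union> insert c ` L"
      by (rule insert_notin_image) (use builds_expand.prems(1) builds_expand.prems(2)[of s] builds_expand.hyps(5) cs in auto)
    show "insert c a \<notin> M \<union> insert c ` L"
      by (rule insert_notin_image) (use builds_expand.prems(1) builds_expand.prems(2)[of a] builds_expand.hyps(6) cs in auto)
    show "bdry (insert c s) - {insert c a} \<subseteq> M \<union> insert c ` L"
      unfolding bdry_insert[OF cs(1)] using builds_expand.hyps(5,7) builds_expand.prems(3) cs(3) by blast
  qed
  then show ?case by (simp add: insert_commute)
next
  case (builds_arc n L u w s)
  have K: "K \<subseteq> L" by (rule builds_mono) fact
  have c1: "card c = 1" using builds_arc.prems(3,4) by auto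
  have cs: "c \<notin> s" "s \<notin> K" using builds_arc.prems(1)[of s] builds_arc.hyps(5) K by blast+
  have IH: "builds (M \<union> insert c ` K) n (M \<union> insert c ` L)"
    using builds_arc.prems c1 by (intro builds_arc.IH) auto
  have "builds (M \<union> insert c ` K) (Suc n) (insert (insert c s) (M \<union> insert c ` L))"
  proof (rule builds.builds_arc[OF IH])
    show "{u, w} \<in> insert c s" "u \<noteq> w" using builds_arc.hyps(2,3) by auto
    show "card d = 1" if "d \<in> insert c s" "d \<noteq> {u, w}" for d
      using that c1 builds_arc.hyps(4) by auto
    show "insert c s \<notin> M \<union> insert c ` L"
      by (rule insert_notin_image) (use builds_arc.prems(1) builds_arc.prems(2)[of s] builds_arc.hyps(5) cs in auto)
    show "bdry (insert c s) \<subseteq> M \<union> insert c ` L"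
      unfolding bdry_insert[OF cs(1)] using builds_arc.hyps(6) c1 by auto
  qed
  then show ?case by simp
qed

lemma builds_Un:
  assumes "builds K n L" "\<And>s. s \<in> L - K \<Longrightarrow> s \<notin> M"
  shows "builds (M \<union> K) n (M \<union> L)"
  using assms
proof (induction rule: builds.induct)
  case builds_refl
  show ?case by (rule builds.builds_refl)
next
  case (builds_expand n L u w s a)
  have K: "K \<subseteq> L" by (rule builds_mono) fact
  have IH: "builds (M \<union> K) n (M \<union> L)"
    using builds_expand.prems by (intro builds_expand.IH) auto
  have "builds (M \<union> K) n (insert s (insert a (M \<union> L)))"
    by (rule builds.builds_expand[OF IH builds_expand.hyps(2-4)])
       (use builds_expand.hyps(5-7) K builds_expand.prems in blast)+
  then show ?case by simp
next
  case (builds_arc n L u w s)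
  have K: "K \<subseteq> L" by (rule builds_mono) fact
  have IH: "builds (M \<union> K) n (M \<union> L)"
    using builds_arc.prems by (intro builds_arc.IH) auto
  have "builds (M \<union> K) (Suc n) (insert s (M \<union> L))"
    by (rule builds.builds_arc[OF IH builds_arc.hyps(2-4)])
       (use builds_arc.hyps(5,6) K builds_arc.prems in blast)+
  then show ?case by simp
qed

lemma builds_arcs:
  assumes "finite S"
    and "\<And>s. s \<in> S \<Longrightarrow> \<exists>u w. u \<noteq> w \<and> {u, w} \<in> s \<and> (\<forall>c\<in>s. c \<noteq> {u, w} \<longrightarrow> card c = 1)"
    and "\<And>s. s \<in> S \<Longrightarrow> s \<notin> K \<and> bdry s \<subseteq> K"
  shows "builds K (card S) (K \<union> S)"
  using assms
proof (induction S rule: finite_induct)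
  case empty
  show ?case by (simp add: builds_refl)
next
  case (insert s S)
  obtain u w where uw: "u \<noteq> w" "{u, w} \<in> s" "\<forall>c\<in>s. c \<noteq> {u, w} \<longrightarrow> card c = 1"
    using insert.prems(1)[of s] by auto
  have "builds K (Suc (card S)) (insert s (K \<union> S))"
    by (rule builds_arc[of _ _ _ u w]) (use insert uw in auto)
  then show ?case using insert.hyps by simp
qed

definition dimension :: "nat set set \<Rightarrow> nat" where
  "dimension s = card {e \<in> s. card e = 2}"

lemma dimension_bdry:
  assumes "finite s" "t \<in> bdry s" shows "dimension t < dimension s"
proof -
  obtain e v where e: "e \<in> s" "card e = 2" "v \<in> e" "t = insert {v} (s - {e})"
    using assms(2) by (auto simp: bdry_def)
  then have "e \<noteq> {v}" by auto
  then have "e \<notin> t" using e by simp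
  then have "{e \<in> t. card e = 2} \<subset> {e \<in> s. card e = 2}" using e by auto
  then show ?thesis unfolding dimension_def using assms(1) by (intro psubset_card_mono) auto
qed

text \<open>The cylinder \<open>{u, w}\<close> times \<open>M\<close>, whose end at \<open>u\<close>
  lies in \<open>L\<close>. Each cell over \<open>s\<close> comes together with its free face at
  \<open>w\<close>, in an order in which the faces of \<open>s\<close> have been treated before
  \<open>s\<close>.\<close>

lemma builds_pairs:
  assumes "finite M" "\<And>s. s \<in> M \<Longrightarrow> finite s \<and> bdry s \<subseteq> M" "u \<noteq> w"
    "\<And>s. s \<in> M \<Longrightarrow> {u, w} \<notin> s \<and> {w} \<notin> s \<and> insert {u} s \<in> L \<and> insert {w} s \<notin> L \<and> insert {u, w} s \<notin> L"
  shows "builds L 0 (L \<union> insert {w} ` M \<union> insert {u, w} ` M)"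
  using assms(1,2,4)
proof (induction "card M" arbitrary: M)
  case 0
  then show ?case by (simp add: builds_refl)
next
  case (Suc n)
  then have "M \<noteq> {}" by auto
  \<comment> \<open>A cell of largest dimension is not a face of another one, so the rest of
    \<open>M\<close> is still closed under faces; the pair over \<open>s\<close> is added
    last.\<close>
  then obtain s where s: "s \<in> M" "\<And>t. t \<in> M \<Longrightarrow> dimension t \<le> dimension s"
    using Max_in[of "dimension ` M"] Max_ge[of "dimension ` M"] Suc.prems(1) by (metis (no_types, lifting) finite_imageI image_is_empty imageE imageI)
  let ?M = "M - {s}"
  have M': "s \<notin> bdry t" if "t \<in> M" for t
    using dimension_bdry[of t s] s(2)[OF that] Suc.prems(2)[OF that] by auto
  have IH: "builds L 0 (L \<union> insert {w} ` ?M \<union> insert {u, w} ` ?M)"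
    by (rule Suc.hyps(1)) (use Suc s M' in auto)
  note p = Suc.prems(3)
  have inj: "insert {w} s \<noteq> insert {w} t \<and> insert {u, w} s \<noteq> insert {u, w} t" if "t \<in> ?M" for t
  proof -
    have "insert {w} s = insert {w} t \<longleftrightarrow> s = t" "insert {u, w} s = insert {u, w} t \<longleftrightarrow> s = t"
      by (rule insert_ident; use p[OF s(1)] p[of t] that in blast)+
    then show ?thesis using that by blast
  qed
  have ne: "insert {w} t \<noteq> insert {u, w} t'" if "t \<in> M" for t t'
    using p[OF that] assms(3) by auto
  have "builds L 0 (insert (insert {u, w} s) (insert (insert {w} s) (L \<union> insert {w} ` ?M \<union> insert {u, w} ` ?M)))"
  proof (rule builds_expand[OF IH _ assms(3)])
    show "{u, w} \<in> insert {u, w} s" by simp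
    show "insert {w} s = insert {w} (insert {u, w} s - {{u, w}})" using p[OF s(1)] by auto
    show "insert {u, w} s \<notin> L \<union> insert {w} ` ?M \<union> insert {u, w} ` ?M"
    proof -
      have "insert {u, w} s \<noteq> insert {w} t" if "t \<in> ?M" for t using ne[of t s] that by simp
      then show ?thesis using p[OF s(1)] inj by blast
    qed
    show "insert {w} s \<notin> L \<union> insert {w} ` ?M \<union> insert {u, w} ` ?M"
    proof -
      have "insert {w} s \<noteq> insert {u, w} t" for t using ne[OF s(1)] by simp
      then show ?thesis using p[OF s(1)] inj by blast
    qed
    have b: "bdry s \<subseteq> ?M" using Suc.prems(2)[OF s(1)] M'[OF s(1)] by auto
    show "bdry (insert {u, w} s) - {insert {w} s} \<subseteq> L \<union> insert {w} ` ?M \<union> insert {u, w} ` ?M"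
      using b p[OF s(1)] by (subst bdry_insert) auto
  qed
  moreover have "insert (insert {u, w} s) (insert (insert {w} s) (L \<union> insert {w} ` ?M \<union> insert {u, w} ` ?M))
     = L \<union> insert {w} ` M \<union> insert {u, w} ` M" using s(1) by auto
  ultimately show ?case by simp
qed

section \<open>Configuration complexes of induced subgraphs\<close>

definition nbrs :: "nat set set \<Rightarrow> nat set \<Rightarrow> nat \<Rightarrow> nat set" where
  "nbrs E W u = {v \<in> W. {u, v} \<in> E}"

definition edges_in :: "nat set set \<Rightarrow> nat set \<Rightarrow> nat set set" where
  "edges_in E W = {e \<in> E. e \<subseteq> W}"

definition cells_in :: "nat set set \<Rightarrow> nat set \<Rightarrow> nat set set" where
  "cells_in E W = (\<lambda>v. {v}) ` W \<union> edges_in E W"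

text \<open>The orbits of cells of the discretized configuration space of n points on the subgraph
  induced by \<open>W\<close>.\<close>

definition D :: "nat set set \<Rightarrow> nat \<Rightarrow> nat set \<Rightarrow> nat set set set" where
  "D E n W = {s. finite s \<and> card s = n \<and> s \<subseteq> cells_in E W \<and> pairwise disjnt s}"

definition graph :: "nat set set \<Rightarrow> bool" where
  "graph E \<longleftrightarrow> (\<forall>e\<in>E. card e = 2)"

lemma cells_in_subset: "c \<in> cells_in E W \<Longrightarrow> c \<subseteq> W"
  by (auto simp: cells_in_def edges_in_def)

lemma cells_in_card: "graph E \<Longrightarrow> c \<in> cells_in E W \<Longrightarrow> card c = 1 \<or> card c = 2"
  by (auto simp: cells_in_def edges_in_def graph_def)

lemma cells_in_iff: "c \<subseteq> W' \<Longrightarrow> W' \<subseteq> W \<Longrightarrow> c \<in> cells_in E W \<Longrightarrow> c \<in> cells_in E W'"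
  by (auto simp: cells_in_def edges_in_def)

lemma cells_in_mono: "W' \<subseteq> W \<Longrightarrow> cells_in E W' \<subseteq> cells_in E W"
  by (auto simp: cells_in_def edges_in_def)

lemma D_mono: "W' \<subseteq> W \<Longrightarrow> D E n W' \<subseteq> D E n W"
  using cells_in_mono[of W' W E] by (auto simp: D_def)

lemma finite_cells_in: "finite W \<Longrightarrow> finite (cells_in E W)"
  unfolding cells_in_def edges_in_def
  by (auto intro: finite_subset[of _ "Pow W"])

lemma finite_D: "finite W \<Longrightarrow> finite (D E n W)"
  by (rule finite_subset[of _ "Pow (cells_in E W)"]) (auto simp: D_def finite_cells_in)

lemma cplx_D:
  assumes "graph E" shows "cplx n (D E n W)"
  unfolding cplx_def
proof (intro ballI conjI subsetI)
  fix s assume s: "s \<in> D E n W"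
  show c: "config n s" using s cells_in_card[OF assms] by (auto simp: D_def config_def)
  fix t assume t: "t \<in> bdry s"
  then obtain e v where e: "e \<in> s" "v \<in> e" "t = insert {v} (s - {e})" by (auto simp: bdry_def)
  have "e \<in> cells_in E W" using s e(1) by (auto simp: D_def)
  then have "v \<in> W" using e(2) cells_in_subset[of e E W] by blast
  then have "{v} \<in> cells_in E W" by (simp add: cells_in_def)
  then have "finite t" "t \<subseteq> cells_in E W" using s e(3) by (auto simp: D_def)
  then show "t \<in> D E n W" using config_bdry[OF c t] by (auto simp: D_def config_def)
qed

lemma D_insertI:
  assumes "s \<in> D E n W'" "W' \<subseteq> W" "c \<in> cells_in E W" "c \<inter> W' = {}" "c \<noteq> {}"
  shows "insert c s \<in> D E (Suc n) W" "c \<notin> s"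
proof -
  have d: "d \<subseteq> W'" if "d \<in> s" for d using assms(1) that cells_in_subset by (auto simp: D_def)
  then show "c \<notin> s" using assms(4,5) by blast
  have "disjnt c y \<and> disjnt y c" if "y \<in> s" for y
    using d[OF that] assms(4) by (auto simp: disjnt_def)
  then have "pairwise disjnt (insert c s)"
    using assms(1) by (simp add: D_def pairwise_insert)
  moreover have "insert c s \<subseteq> cells_in E W"
    using assms(1,3) cells_in_mono[OF assms(2), of E] by (auto simp: D_def)
  ultimately show "insert c s \<in> D E (Suc n) W"
    using assms(1) \<open>c \<notin> s\<close> by (simp add: D_def)
qed

lemma D_removeI:
  assumes "s \<in> D E (Suc n) W" "c \<in> s"
  shows "s - {c} \<in> D E n (W - c)" "s = insert c (s - {c})"
proof -
  have "d \<in> cells_in E (W - c)" if "d \<in> s" "d \<noteq> c" for d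
  proof (rule cells_in_iff)
    have "disjnt d c" using assms that by (auto simp: D_def pairwise_def)
    moreover have "d \<subseteq> W" using assms that cells_in_subset by (auto simp: D_def)
    ultimately show "d \<subseteq> W - c" by (auto simp: disjnt_def)
    show "d \<in> cells_in E W" using assms that by (auto simp: D_def)
  qed auto
  then show "s - {c} \<in> D E n (W - c)"
    using assms by (auto simp: D_def pairwise_def)
qed (use assms in auto)

lemma D_not: "s \<in> D E n W \<Longrightarrow> c \<in> s \<Longrightarrow> c \<subseteq> W"
  using cells_in_subset by (auto simp: D_def)

lemma graph_edge:
  assumes "graph E" "e \<in> E" "w \<in> e" obtains x where "e = {w, x}" "x \<noteq> w"
proof -
  have "card e = 2" using assms by (simp add: graph_def)
  then obtain y z where "e = {y, z}" "y \<noteq> z" by (auto simp: card_2_iff)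
  then show ?thesis using that[of y] that[of z] assms(3) by (auto simp: insert_commute)
qed

lemma D_insert:
  assumes E: "graph E" and w: "w \<notin> W" "u \<in> W" "nbrs E W w = {u}"
  shows "D E (Suc n) (insert w W) = D E (Suc n) W \<union> insert {u, w} ` D E n (W - {u}) \<union> insert {w} ` D E n W"
proof -
  have uw: "{u, w} \<in> E" using w by (auto simp: nbrs_def insert_commute)
  have edge: "e = {u, w}" if e: "e \<in> E" "e \<subseteq> insert w W" "w \<in> e" for e
  proof -
    obtain x where "e = {w, x}" "x \<noteq> w" using graph_edge[OF E e(1,3)] .
    then have "x \<in> nbrs E W w" using e by (auto simp: nbrs_def)
    then show ?thesis using w(3) \<open>e = {w, x}\<close> by auto
  qed
  have cells: "cells_in E (insert w W) = insert {w} (insert {u, w} (cells_in E W))"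
  proof -
    have "edges_in E (insert w W) = insert {u, w} (edges_in E W)"
    proof (intro equalityI subsetI)
      fix e assume e: "e \<in> edges_in E (insert w W)"
      show "e \<in> insert {u, w} (edges_in E W)"
        using edge[of e] e by (cases "w \<in> e") (simp_all add: edges_in_def subset_insert)
    qed (use uw w in \<open>auto simp: edges_in_def\<close>)
    then show ?thesis by (simp add: cells_in_def insert_commute)
  qed
  show ?thesis
  proof (intro equalityI subsetI)
    fix s assume s: "s \<in> D E (Suc n) (insert w W)"
    consider "{u, w} \<in> s" | "{w} \<in> s" | "{u, w} \<notin> s" "{w} \<notin> s" by blast
    then show "s \<in> D E (Suc n) W \<union> insert {u, w} ` D E n (W - {u}) \<union> insert {w} ` D E n W"
    proof cases
      case 1
      have "insert w W - {u, w} = W - {u}" using w by auto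
      then have "s - {{u, w}} \<in> D E n (W - {u})" using D_removeI(1)[OF s 1] by simp
      then have "s \<in> insert {u, w} ` D E n (W - {u})" using D_removeI(2)[OF s 1] by (rule rev_image_eqI)
      then show ?thesis by simp
    next
      case 2
      have "insert w W - {w} = W" using w by auto
      then have "s - {{w}} \<in> D E n W" using D_removeI(1)[OF s 2] by simp
      then have "s \<in> insert {w} ` D E n W" using D_removeI(2)[OF s 2] by (rule rev_image_eqI)
      then show ?thesis by simp
    next
      case 3
      have "s \<subseteq> insert {w} (insert {u, w} (cells_in E W))" using s cells by (simp add: D_def)
      then have "s \<subseteq> cells_in E W" using 3 by (simp add: subset_insert)
      then show ?thesis using s by (simp add: D_def)
    qed
  next
    fix s assume "s \<in> D E (Suc n) W \<union> insert {u, w} ` D E n (W - {u}) \<union> insert {w} ` D E n W"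
    then consider "s \<in> D E (Suc n) W" | t where "t \<in> D E n (W - {u})" "s = insert {u, w} t"
      | t where "t \<in> D E n W" "s = insert {w} t" by blast
    then show "s \<in> D E (Suc n) (insert w W)"
    proof cases
      case 1
      then show ?thesis using D_mono[of W "insert w W"] by blast
    next
      case (2 t)
      show ?thesis unfolding 2(2) by (rule D_insertI(1)[OF 2(1)]) (use cells w in auto)
    next
      case (3 t)
      show ?thesis unfolding 3(2) by (rule D_insertI(1)[OF 3(1)]) (use cells w in auto)
    qed
  qed
qed

text \<open>The recursion on the number of points. The cells with the edge \<open>{u, w}\<close>
  form a cylinder over \<open>D E n (W - {u})\<close>, attached at its \<open>u\<close> end; after
  its expansion the cells still missing are \<open>{w}\<close> together with the cells by which
  \<open>D E n W\<close> exceeds \<open>D E n (W - {u})\<close>. The set \<open>R\<close> allows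
  some of them to be held back, for arcs that are to be attached by hand.\<close>

lemma builds_leaf:
  assumes E: "graph E" and W: "finite W" and w: "w \<notin> W" "u \<in> W" "nbrs E W w = {u}"
    and b: "builds (D E n (W - {u})) m (D E n W - R)" and R: "R \<subseteq> D E n W - D E n (W - {u})"
  shows "builds (D E (Suc n) W) m (D E (Suc n) (insert w W) - insert {w} ` R)"
proof -
  let ?M = "D E n (W - {u})" and ?L = "D E (Suc n) W"
  let ?L1 = "?L \<union> insert {w} ` ?M \<union> insert {u, w} ` ?M"
  have uw: "u \<noteq> w" using w by auto
  have nw: "{w} \<notin> s" "{u, w} \<notin> s" if "s \<in> D E k W'" "W' \<subseteq> W" for s k W'
    using D_not[OF that(1)] that(2) w by blast+
  have sub: "?M \<subseteq> D E n W" by (rule D_mono) auto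
  have b1: "builds ?L 0 ?L1"
  proof (rule builds_pairs)
    fix s assume s: "s \<in> ?M"
    show "finite s \<and> bdry s \<subseteq> ?M" using s cplx_D[OF E, of n "W - {u}"] by (auto simp: cplx_def D_def)
    have "{u} \<in> cells_in E W" using w by (auto simp: cells_in_def)
    then have "insert {u} s \<in> ?L" using D_insertI(1)[OF s, of W "{u}"] by auto
    then show "{u, w} \<notin> s \<and> {w} \<notin> s \<and> insert {u} s \<in> ?L \<and> insert {w} s \<notin> ?L \<and> insert {u, w} s \<notin> ?L"
      using nw[OF s] nw(1)[of "insert {w} s" "Suc n" W] nw(2)[of "insert {u, w} s" "Suc n" W] by blast
  qed (use W uw finite_D in auto)
  \<comment> \<open>The start of the lifted construction is the \<open>w\<close> end of the cylinder
    and so belongs to \<open>?L1\<close> already.\<close>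
  have b2: "builds (?L1 \<union> insert {w} ` ?M) m (?L1 \<union> insert {w} ` (D E n W - R))"
  proof (rule builds_image[OF b])
    show "{w} \<notin> s" if "s \<in> D E n W - R" for s using nw[of s n W] that by auto
    fix s assume "s \<in> D E n W - R - ?M"
    then have s: "s \<in> D E n W" "s \<notin> ?M" by auto
    have "{u, w} \<notin> insert {w} s" using nw(2)[OF s(1)] uw by simp
    then have "insert {w} s \<noteq> insert {u, w} t" for t by blast
    moreover have "insert {w} s \<noteq> insert {w} t" if "t \<in> ?M" for t
      using insert_ident[OF nw(1)[OF s(1)] nw(1)[OF that]] s(2) that by auto
    moreover have "insert {w} s \<notin> ?L" using nw(1)[of "insert {w} s" "Suc n" W] by blast
    ultimately show "insert {w} s \<notin> ?L1" by blast
  qed auto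
  have b3: "?L1 \<union> insert {w} ` ?M = ?L1" by blast
  have "builds ?L (0 + m) (?L1 \<union> insert {w} ` (D E n W - R))"
    by (rule builds_trans[OF b2[unfolded b3] b1])
  moreover have "?L1 \<union> insert {w} ` (D E n W - R) = D E (Suc n) (insert w W) - insert {w} ` R"
  proof -
    have inj: "inj_on (insert {w}) (D E n W)" 
      by (rule inj_onI) (metis insert_ident nw(1) order_refl)
    have im: "insert {w} ` (D E n W - R) = insert {w} ` D E n W - insert {w} ` R"
      by (rule inj_on_image_set_diff[OF inj]) (use R in auto)
    have "insert {w} ` ?M \<subseteq> insert {w} ` (D E n W - R)" by (rule image_mono) (use R sub in blast)
    moreover have "{w} \<notin> s" if "s \<in> ?L \<union> insert {u, w} ` ?M" for s
      using that nw(1)[of _ "Suc n" W] nw(1)[of _ n "W - {u}"] uw by auto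
    then have "(?L \<union> insert {u, w} ` ?M) \<inter> insert {w} ` R = {}" by blast
    moreover have "A \<union> C' \<union> B \<union> (C - F) = A \<union> B \<union> C - F"
      if "C' \<subseteq> C - F" "(A \<union> B) \<inter> F = {}" for A B C C' F :: "nat set set set"
      using that by blast
    ultimately show ?thesis unfolding im D_insert[OF E w] by simp
  qed
  ultimately show ?thesis by simp
qed

lemma nbrs_not_self: "graph E \<Longrightarrow> v \<in> nbrs E W u \<Longrightarrow> v \<noteq> u"
  by (auto simp: nbrs_def graph_def)

lemma D_1: "D E (Suc 0) W = (\<lambda>c. {c}) ` cells_in E W"
  by (auto simp: D_def card_1_singleton_iff)

lemma edges_in_remove:
  assumes "graph E" "u \<in> W"
  shows "edges_in E W = edges_in E (W - {u}) \<union> (\<lambda>v. {u, v}) ` nbrs E W u"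
    "edges_in E (W - {u}) \<inter> (\<lambda>v. {u, v}) ` nbrs E W u = {}"
proof -
  have "e \<in> (\<lambda>v. {u, v}) ` nbrs E W u" if e: "e \<in> edges_in E W" "u \<in> e" for e
  proof -
    have "e \<in> E" using e by (simp add: edges_in_def)
    then obtain x where "e = {u, x}" using graph_edge[OF assms(1) _ e(2)] by blast
    then show ?thesis using e by (auto simp: nbrs_def edges_in_def)
  qed
  then show "edges_in E W = edges_in E (W - {u}) \<union> (\<lambda>v. {u, v}) ` nbrs E W u"
    using assms(2) by (auto simp: edges_in_def nbrs_def)
qed (auto simp: edges_in_def)

lemma card_edges_in_remove:
  assumes "graph E" "finite W" "u \<in> W"
  shows "card (edges_in E W) = card (edges_in E (W - {u})) + card (nbrs E W u)"
proof -
  have "finite (edges_in E (W - {u}))" "finite (nbrs E W u)"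
    using assms(2) by (auto simp: edges_in_def nbrs_def intro: finite_subset[of _ "Pow W"])
  moreover have "inj_on (\<lambda>v. {u, v}) (nbrs E W u)" by (auto simp: inj_on_def doubleton_eq_iff)
  ultimately show ?thesis
    using edges_in_remove[OF assms(1,3)] by (simp add: card_Un_disjoint card_image)
qed

lemma cells_in_remove:
  assumes "graph E" "u \<in> W"
  shows "cells_in E W = insert {u} (cells_in E (W - {u}) \<union> (\<lambda>v. {u, v}) ` nbrs E W u)"
  using edges_in_remove(1)[OF assms] assms(2) by (auto simp: cells_in_def)

text \<open>The vertex \<open>u\<close> enters as the free end of the edge to \<open>a\<close>.
  After that, every other edge at \<open>u\<close> has both ends present and is an arc. The set
  \<open>S\<close> selects which of these arcs are attached now.\<close>

lemma builds_D_1: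
  assumes E: "graph E" and W: "finite W" "u \<in> W" and a: "a \<in> nbrs E W u" and S: "S \<subseteq> nbrs E W u - {a}"
  shows "builds (D E (Suc 0) (W - {u})) (card S) (D E (Suc 0) W - (\<lambda>v. {{u, v}}) ` (nbrs E W u - {a} - S))"
proof -
  let ?N = "nbrs E W u" and ?K = "D E (Suc 0) (W - {u})" and ?e = "\<lambda>v. {{u, v}}"
  have notK: "{c} \<notin> ?K" if "u \<in> c" for c
    using that cells_in_subset[of c E "W - {u}"] by (auto simp: D_1)
  have inK: "{{v}} \<in> ?K" if "v \<in> ?N" for v
    using that nbrs_not_self[OF E that] by (auto simp: D_1 cells_in_def nbrs_def)
  have bd: "bdry (?e v) = {{{u}}, {{v}}}" if "v \<in> ?N" for v
    using nbrs_not_self[OF E that] by (auto simp: bdry_def)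
  have neq: "{{u}} \<noteq> ?e v" if "v \<in> ?N" for v using nbrs_not_self[OF E that] by auto
  have K1: "builds ?K 0 (insert (?e a) (insert {{u}} ?K))"
  proof (rule builds_expand[OF builds_refl, of a u])
    show "{a, u} \<in> ?e a" "a \<noteq> u" using nbrs_not_self[OF E a] by auto
    show "{{u}} = insert {u} (?e a - {{a, u}})" by (auto simp: insert_commute)
    show "?e a \<notin> ?K" "{{u}} \<notin> ?K" using notK by auto
    show "bdry (?e a) - {{{u}}} \<subseteq> ?K" using bd[OF a] inK[OF a] by auto
  qed
  have fS: "finite S" using S W by (auto simp: nbrs_def intro: finite_subset)
  have inj: "inj_on ?e S" by (auto simp: inj_on_def doubleton_eq_iff)
  have "builds (insert (?e a) (insert {{u}} ?K)) (card (?e ` S)) (insert (?e a) (insert {{u}} ?K) \<union> ?e ` S)"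
  proof (rule builds_arcs)
    fix s assume "s \<in> ?e ` S"
    then obtain v where v: "v \<in> ?N" "v \<noteq> a" "s = ?e v" using S by auto
    show "\<exists>u w. u \<noteq> w \<and> {u, w} \<in> s \<and> (\<forall>c\<in>s. c \<noteq> {u, w} \<longrightarrow> card c = 1)"
      using v nbrs_not_self[OF E v(1)] by auto
    show "s \<notin> insert (?e a) (insert {{u}} ?K) \<and> bdry s \<subseteq> insert (?e a) (insert {{u}} ?K)"
      using v(2) notK[of "{u, v}"] neq[OF v(1)] bd[OF v(1)] inK[OF v(1)] unfolding v(3)
      by (auto simp: doubleton_eq_iff)
  qed (use fS in auto)
  then have "builds ?K (0 + card S) (insert (?e a) (insert {{u}} ?K) \<union> ?e ` S)"
    using builds_trans[OF _ K1] by (simp add: card_image[OF inj])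
  moreover have "insert (?e a) (insert {{u}} ?K) \<union> ?e ` S = D E (Suc 0) W - ?e ` (?N - {a} - S)"
  proof -
    have "D E (Suc 0) W = insert {{u}} (?K \<union> ?e ` ?N)"
      unfolding D_1 cells_in_remove[OF E W(2)] by auto
    moreover have N: "?N = insert a (S \<union> (?N - {a} - S))" using S a by auto
    have "?e ` ?N = insert (?e a) (?e ` S \<union> ?e ` (?N - {a} - S))"
      by (subst N) (simp only: image_insert image_Un)
    moreover have "(insert (?e a) (insert {{u}} ?K) \<union> ?e ` S) \<inter> ?e ` (?N - {a} - S) = {}"
      using notK neq S by (auto simp: doubleton_eq_iff)
    moreover have "insert x (insert y K) \<union> T = insert y (K \<union> insert x (T \<union> F)) - F"
      if "(insert x (insert y K) \<union> T) \<inter> F = {}" for x y and K T F :: "nat set set set"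
      using that by blast
    ultimately show ?thesis by simp
  qed
  ultimately show ?thesis by simp
qed

text \<open>Acyclicity, phrased so that it passes to subsets and directly supplies the leaf or
  isolated vertex that an induction removes.\<close>

definition forest :: "nat set set \<Rightarrow> nat set \<Rightarrow> bool" where
  "forest E W \<longleftrightarrow> (\<forall>U\<subseteq>W. U \<noteq> {} \<longrightarrow> (\<exists>w\<in>U. card (nbrs E U w) \<le> 1))"

lemma forest_mono: "forest E W \<Longrightarrow> U \<subseteq> W \<Longrightarrow> forest E U"
  by (auto simp: forest_def)

text \<open>\<open>Z\<close> takes one vertex from each component, from which the component grows
  leaf by leaf; the count is the Euler characteristic.\<close>

lemma builds_forest:
  assumes E: "graph E" and W: "finite W" "forest E W"
  shows "\<exists>Z\<subseteq>W. builds ((\<lambda>z. {{z}}) ` Z) 0 (D E (Suc 0) W) \<and> card Z + card (edges_in E W) = card W"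
  using W
proof (induction "card W" arbitrary: W)
  case 0
  then have "cells_in E W = {}" using E by (auto simp: cells_in_def edges_in_def graph_def)
  moreover have "edges_in E W = {}" using calculation by (auto simp: cells_in_def)
  ultimately show ?case using 0 by (intro exI[of _ "{}"]) (auto simp: D_1 builds_refl)
next
  case (Suc n)
  then obtain w where w: "w \<in> W" "card (nbrs E W w) \<le> 1"
    unfolding forest_def by (metis card.empty nat.simps(3) order_refl)
  let ?W = "W - {w}"
  have "n = card ?W" "finite ?W" "forest E ?W" using Suc w(1) by (auto intro: forest_mono)
  then obtain Z where Z: "Z \<subseteq> ?W" "builds ((\<lambda>z. {{z}}) ` Z) 0 (D E (Suc 0) ?W)"
      "card Z + card (edges_in E ?W) = card ?W"
    using Suc.hyps(1) by blast
  have fZ: "finite Z" "w \<notin> Z" using Z(1) Suc.prems(1) by (auto intro: finite_subset)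
  note card_W = card_edges_in_remove[OF E Suc.prems(1) w(1)]
  have cW: "card W = Suc (card ?W)" using \<open>n = card ?W\<close> Suc by simp
  have fN: "finite (nbrs E W w)" using Suc.prems(1) by (simp add: nbrs_def)
  show ?case
  proof (cases "nbrs E W w = {}")
    case True
    have "D E (Suc 0) W = {{{w}}} \<union> D E (Suc 0) ?W"
      unfolding D_1 cells_in_remove[OF E w(1)] True by auto
    moreover have "builds ({{{w}}} \<union> (\<lambda>z. {{z}}) ` Z) 0 ({{{w}}} \<union> D E (Suc 0) ?W)"
      by (rule builds_Un[OF Z(2)]) (auto simp: D_1 dest: cells_in_subset)
    ultimately have "builds ((\<lambda>z. {{z}}) ` insert w Z) 0 (D E (Suc 0) W)" by simp
    moreover have "card (insert w Z) + card (edges_in E W) = card W"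
      using fZ Z(3) card_W cW True by simp
    ultimately show ?thesis using Z(1) w(1) by (intro exI[of _ "insert w Z"]) auto
  next
    case False
    then obtain x where x: "nbrs E W w = {x}"
      using w(2) fN by (metis card_0_eq card_1_singletonE le_antisym less_one linorder_not_less)
    have "builds (D E (Suc 0) ?W) (card ({} :: nat set)) (D E (Suc 0) W - (\<lambda>v. {{w, v}}) ` (nbrs E W w - {x} - {}))"
      by (rule builds_D_1[OF E Suc.prems(1) w(1)]) (use x in auto)
    then have "builds (D E (Suc 0) ?W) 0 (D E (Suc 0) W)" by (simp add: x)
    then have "builds ((\<lambda>z. {{z}}) ` Z) 0 (D E (Suc 0) W)" using builds_trans[OF _ Z(2)] by fastforce
    then show ?thesis using Z(1,3) card_W cW x by (intro exI[of _ Z]) auto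
  qed
qed

text \<open>In a tree where \<open>v\<close> has degree 2, deleting \<open>u\<close> and
  \<open>v\<close> removes two vertices and one edge more than the degree of \<open>u\<close>, so
  the number of components left is the degree of \<open>u\<close>. With one point on
  \<open>{u, v}\<close>, each component costs one arc, for a position of the other point, and is
  filled by expansions.\<close>

lemma builds_insert_edge:
  assumes E: "graph E" and W: "finite W" "forest E W" and v: "u \<in> W" "v \<in> nbrs E W u"
    and count: "card W = Suc (card (edges_in E W))" and d2: "card (nbrs E W v) = 2"
    and M: "\<And>s. s \<in> D E (Suc 0) (W - {u, v}) \<Longrightarrow> insert {u} s \<in> M \<and> insert {v} s \<in> M \<and> insert {u, v} s \<notin> M"
  shows "builds M (card (nbrs E W u)) (M \<union> insert {u, v} ` D E (Suc 0) (W - {u, v}))"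
proof -
  let ?W = "W - {u, v}"
  have uv: "u \<noteq> v" using nbrs_not_self[OF E v(2)] by auto
  obtain Z where Z: "Z \<subseteq> ?W" "builds ((\<lambda>z. {{z}}) ` Z) 0 (D E (Suc 0) ?W)"
      "card Z + card (edges_in E ?W) = card ?W"
    using builds_forest[OF E, of ?W] W forest_mono[of E W ?W] by auto
  have vW: "v \<in> W" "u \<in> nbrs E W v" using v by (auto simp: nbrs_def insert_commute)
  have "card (edges_in E W) = card (edges_in E (W - {u})) + card (nbrs E W u)"
    by (rule card_edges_in_remove) (use E W v in auto)
  moreover have "card (edges_in E (W - {u})) = card (edges_in E (W - {u} - {v})) + card (nbrs E (W - {u}) v)"
    by (rule card_edges_in_remove) (use E W vW uv in auto)
  moreover have "W - {u} - {v} = ?W" by auto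
  moreover have "nbrs E (W - {u}) v = nbrs E W v - {u}" by (auto simp: nbrs_def)
  then have "card (nbrs E (W - {u}) v) = 1" using d2 vW by simp
  moreover have "card ?W = card W - 2" using v vW uv W by (simp add: card_Diff_subset)
  moreover have "card W \<ge> 2" using card_mono[of W "{u, v}"] v vW uv W by simp
  ultimately have cZ: "card Z = card (nbrs E W u)" using Z(3) count by simp
  let ?S = "(\<lambda>z. {{u, v}, {z}}) ` Z"
  have fZ: "finite Z" using Z(1) W(1) by (auto intro: finite_subset)
  have zin: "{{z}} \<in> D E (Suc 0) ?W" if "z \<in> Z" for z
  proof -
    have "z \<in> ?W" using Z(1) that by blast
    then show ?thesis by (simp add: D_1 cells_in_def)
  qed
  have b1: "builds M (card ?S) (M \<union> ?S)"
  proof (rule builds_arcs)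
    fix s assume "s \<in> ?S"
    then obtain z where z: "z \<in> Z" "s = {{u, v}, {z}}" by auto
    show "\<exists>u w. u \<noteq> w \<and> {u, w} \<in> s \<and> (\<forall>c\<in>s. c \<noteq> {u, w} \<longrightarrow> card c = 1)"
      using z uv by (intro exI[of _ u] exI[of _ v]) auto
    have "bdry s = {{{u}, {z}}, {{v}, {z}}}"
      unfolding z(2) by (subst bdry_insert) (use Z(1) z uv in \<open>auto simp: bdry_def\<close>)
    then show "s \<notin> M \<and> bdry s \<subseteq> M" using M[OF zin[OF z(1)]] z(2) by auto
  qed (use fZ in auto)
  have "inj_on (\<lambda>z. {{u, v}, {z}}) Z"
    by (rule inj_onI) (use Z(1) uv in \<open>auto simp: doubleton_eq_iff\<close>)
  then have cS: "card ?S = card (nbrs E W u)" using cZ by (simp add: card_image)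
  have S: "?S = insert {u, v} ` (\<lambda>z. {{z}}) ` Z" by auto
  have b2: "builds (M \<union> insert {u, v} ` (\<lambda>z. {{z}}) ` Z) 0 (M \<union> insert {u, v} ` D E (Suc 0) ?W)"
    by (rule builds_image[OF Z(2)]) (use M uv in \<open>auto simp: D_1 dest: cells_in_subset\<close>)
  show ?thesis using builds_trans[OF b2[folded S] b1] by (simp add: cS)
qed

text \<open>One edge \<open>{u, a}\<close> serves to bring in all configurations with a point at
  \<open>u\<close>, by expansions. Each of the remaining edges at \<open>u\<close> then contributes
  as many arcs as \<open>u\<close> has neighbours, by \<open>builds_insert_edge\<close>.\<close>

lemma builds_D_2:
  assumes E: "graph E" and W: "finite W" "forest E W" "card W = Suc (card (edges_in E W))" and u: "u \<in> W"
    and N: "nbrs E W u \<noteq> {}" "\<And>v. v \<in> nbrs E W u \<Longrightarrow> card (nbrs E W v) = 2"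
  shows "builds (D E 2 (W - {u})) (card (nbrs E W u) * (card (nbrs E W u) - 1)) (D E 2 W)"
proof -
  let ?N = "nbrs E W u" and ?K = "D E 2 (W - {u})"
  obtain a where a: "a \<in> ?N" using N(1) by blast
  have au: "a \<noteq> u" "a \<in> W" "{u, a} \<in> E" using nbrs_not_self[OF E a] a by (auto simp: nbrs_def)
  have "u \<in> nbrs E W a" "finite (nbrs E W a)" using a u W(1) by (auto simp: nbrs_def insert_commute)
  moreover have "card (nbrs E W a) = 2" using N(2)[OF a] .
  ultimately obtain a' where a': "nbrs E W a = {u, a'}" "a' \<noteq> u"
    by (metis card_2_iff doubleton_eq_iff insertE singletonD)
  have aa': "a' \<in> W" "{a, a'} \<in> E" "a \<noteq> a'" using a' nbrs_not_self[OF E, of a' W a] by (auto simp: nbrs_def)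
  let ?M = "D E (Suc 0) (W - {u, a})"
  let ?L1 = "?K \<union> insert {u} ` ?M \<union> insert {a, u} ` ?M"
  have two: "2 = Suc (Suc 0)" by simp
  have Kin: "insert c s \<in> ?K" if "s \<in> D E (Suc 0) W'" "W' \<subseteq> W - {u}" "c \<in> cells_in E (W - {u})" "c \<inter> W' = {}" "c \<noteq> {}" for c s W'
    unfolding two using D_insertI(1)[OF that] .
  have notu: "u \<notin> \<Union>s" if "s \<in> D E k W'" "W' \<subseteq> W - {u}" for s k W'
    using D_not[OF that(1)] that(2) by blast
  have "builds ?K 0 ?L1"
  proof (rule builds_pairs)
    fix s assume s: "s \<in> ?M"
    show "finite s \<and> bdry s \<subseteq> ?M" using s cplx_D[OF E, of "Suc 0" "W - {u, a}"] by (auto simp: cplx_def D_def)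
    have "{a} \<in> cells_in E (W - {u})" using au by (auto simp: cells_in_def)
    then have "insert {a} s \<in> ?K" using Kin[OF s] by auto
    moreover have "{a, u} \<notin> s" "{u} \<notin> s" using notu[OF s] by auto
    moreover have "insert {u} s \<notin> ?K" "insert {a, u} s \<notin> ?K" using notu by fastforce+
    ultimately show "{a, u} \<notin> s \<and> {u} \<notin> s \<and> insert {a} s \<in> ?K \<and> insert {u} s \<notin> ?K \<and> insert {a, u} s \<notin> ?K"
      by blast
  qed (use W au finite_D in auto)
  \<comment> \<open>The cylinder over \<open>{u, a}\<close> omits the configurations with a point at
    \<open>u\<close> and the other at \<open>a\<close> or on an edge at \<open>a\<close>. Since
    \<open>a\<close> has degree 2, there are exactly these two, and they form a single
    expansion.\<close>
  let ?s = "{{u}, {a, a'}}" and ?b = "{{u}, {a}}"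
  let ?L2 = "insert ?s (insert ?b ?L1)"
  have Min: "{c} \<in> ?M \<longleftrightarrow> c \<in> cells_in E (W - {u, a})" for c by (auto simp: D_1)
  have M_iff: "{{u}, c} \<in> ?L1 \<longleftrightarrow> {c} \<in> ?M" if "u \<notin> c" for c
  proof -
    have "{{u}, c} \<notin> ?K" using notu[of "{{u}, c}" 2 "W - {u}"] by auto
    moreover have "{{u}, c} \<noteq> {{a, u}, d}" for d using that au by (auto simp: doubleton_eq_iff)
    then have "{{u}, c} \<notin> insert {a, u} ` ?M" by (simp add: D_1 image_iff)
    moreover have "{{u}, c} = {{u}, d} \<longleftrightarrow> c = d" for d using that by (auto simp: doubleton_eq_iff)
    then have "{{u}, c} \<in> insert {u} ` ?M \<longleftrightarrow> {c} \<in> ?M" by (simp add: D_1 image_iff)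
    ultimately show ?thesis by (simp only: Un_iff simp_thms)
  qed
  have "builds ?K 0 ?L2"
  proof (rule builds_expand[OF \<open>builds ?K 0 ?L1\<close>, of a' a])
    show "{a', a} \<in> ?s" "a' \<noteq> a" using aa' by auto
    show "?b = insert {a} (?s - {{a', a}})" using au a' by (auto simp: doubleton_eq_iff)
    show "?s \<notin> ?L1" using M_iff[of "{a, a'}"] au a' Min[of "{a, a'}"] by (auto dest: cells_in_subset)
    show "?b \<notin> ?L1" using M_iff[of "{a}"] au Min[of "{a}"] by (auto dest: cells_in_subset)
    have "bdry ?s = {{{u}, {a}}, {{u}, {a'}}}"
      by (subst bdry_insert) (use au a' aa' in \<open>auto simp: bdry_def doubleton_eq_iff\<close>)
    moreover have "{{u}, {a'}} \<in> ?L1"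
      using M_iff[of "{a'}"] Min[of "{a'}"] a'(2) aa' by (auto simp: cells_in_def)
    ultimately show "bdry ?s - {?b} \<subseteq> ?L1" by auto
  qed
  have uL2: "insert {u} s \<in> ?L2" if s: "s \<in> D E (Suc 0) (W - {u})" for s
  proof -
    obtain c where c: "s = {c}" "c \<in> cells_in E (W - {u})" using s by (auto simp: D_1)
    show ?thesis
    proof (cases "a \<in> c")
      case False
      then have "c \<in> cells_in E (W - {u, a})"
        using cells_in_subset[OF c(2)] cells_in_iff[of c "W - {u, a}" "W - {u}" E] c(2) by blast
      then show ?thesis using c(1) by (auto simp: D_1)
    next
      case True
      have "c = {a} \<or> c = {a, a'}"
      proof (cases "c \<in> E")
        case ce: True
        obtain y where y: "c = {a, y}" "y \<noteq> a" using graph_edge[OF E ce True] by blast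
        then have "y \<in> nbrs E W a" "y \<noteq> u" using cells_in_subset[OF c(2)] ce by (auto simp: nbrs_def)
        then show ?thesis using a'(1) y by auto
      next
        case False
        then show ?thesis using c(2) True by (auto simp: cells_in_def edges_in_def)
      qed
      then have "insert {u} s = ?b \<or> insert {u} s = ?s" using c(1) by (elim disjE) simp_all
      then show ?thesis by (elim disjE) simp_all
    qed
  qed
  \<comment> \<open>\<open>S\<close> is the set of neighbours whose edge to \<open>u\<close> has
    been treated.\<close>
  define LS where "LS S = ?L2 \<union> (\<Union>v\<in>S. insert {u, v} ` D E (Suc 0) (W - {u, v}))" for S
  have LS: "builds ?K (card S * card ?N) (LS S)" if "finite S" "S \<subseteq> ?N - {a}" for S
    using that
  proof (induction S rule: finite_induct)
    case empty
    show ?case using \<open>builds ?K 0 ?L2\<close> by (simp add: LS_def)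
  next
    case (insert v S)
    have v: "v \<in> ?N" "v \<noteq> a" using insert.prems by auto
    have uv: "v \<noteq> u" "v \<in> W" using nbrs_not_self[OF E v(1)] v(1) by (auto simp: nbrs_def)
    have "builds (LS S) (card ?N) (LS S \<union> insert {u, v} ` D E (Suc 0) (W - {u, v}))"
    proof (rule builds_insert_edge[OF E W(1,2) u v(1) W(3) N(2)[OF v(1)]])
      fix s assume s: "s \<in> D E (Suc 0) (W - {u, v})"
      have "insert {u} s \<in> ?L2" by (rule uL2, rule subsetD[OF D_mono s]) auto
      moreover have "insert {v} s \<in> ?K" using Kin[OF s] uv by (auto simp: cells_in_def)
      moreover have "insert {u, v} s \<notin> LS S"
      proof -
        have pK: "{u, v} \<notin> t" if "t \<in> ?K" for t using notu[OF that] by auto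
        have pM: "{u, v} \<notin> t" if t: "t \<in> ?M" for t using notu[OF t] by auto
        have p1: "{u, v} \<notin> t" if "t \<in> insert {u} ` ?M" for t
          using that pM uv by (auto simp: doubleton_eq_iff)
        have p2: "{u, v} \<notin> t" if "t \<in> insert {a, u} ` ?M" for t
          using that pM uv v(2) by (auto simp: doubleton_eq_iff)
        have p3: "{u, v} \<notin> ?s" "{u, v} \<notin> ?b" using uv au a'(2) by (auto simp: doubleton_eq_iff)
        have p4: "{u, v} \<notin> t" if t: "v' \<in> S" "t \<in> insert {u, v'} ` D E (Suc 0) (W - {u, v'})" for t v'
        proof -
          obtain r where r: "r \<in> D E (Suc 0) (W - {u, v'})" "t = insert {u, v'} r" using t(2) by blast
          have "{u, v} \<notin> r" using notu[OF r(1)] by auto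
          moreover have "v \<noteq> v'" using t(1) insert.hyps by auto
          ultimately show ?thesis using r(2) by (auto simp: doubleton_eq_iff)
        qed
        have "{u, v} \<notin> t" if "t \<in> LS S" for t
          using that unfolding LS_def
          by (elim UnE insertE UN_E) (simp_all only: pK p1 p2 p3 p4 not_False_eq_True)
        then show ?thesis by blast
      qed
      ultimately show "insert {u} s \<in> LS S \<and> insert {v} s \<in> LS S \<and> insert {u, v} s \<notin> LS S"
        unfolding LS_def by blast
    qed
    moreover have "LS S \<union> insert {u, v} ` D E (Suc 0) (W - {u, v}) = LS (insert v S)" by (auto simp: LS_def)
    moreover have "builds ?K (card S * card ?N) (LS S)" using insert by auto
    ultimately have "builds ?K (card S * card ?N + card ?N) (LS (insert v S))" using builds_trans by fastforce
    then show ?case using insert.hyps by (simp add: add.commute)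
  qed
  have fN: "finite ?N" using W by (simp add: nbrs_def)
  have "LS (?N - {a}) = D E 2 W"
  proof
    have e: "insert {u, v} s \<in> D E 2 W" if "v \<in> ?N" "s \<in> D E (Suc 0) (W - {u, v})" for v s
      unfolding two
      by (rule D_insertI(1)[OF that(2)]) (use that(1) u in \<open>auto simp: cells_in_def edges_in_def nbrs_def\<close>)
    have v: "insert {u} s \<in> D E 2 W" if "s \<in> D E (Suc 0) (W - {u})" for s
      unfolding two by (rule D_insertI(1)[OF that]) (use u in \<open>auto simp: cells_in_def\<close>)
    have "{{a, a'}} \<in> D E (Suc 0) (W - {u})" "{{a}} \<in> D E (Suc 0) (W - {u})"
      using au aa' a' by (auto simp: D_1 cells_in_def edges_in_def)
    note A = v[OF this(1)] v[OF this(2)]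
    then have A1: "?s \<in> D E 2 W" "?b \<in> D E 2 W" by simp_all
    have A2: "?K \<subseteq> D E 2 W" by (rule D_mono) auto
    have A3: "insert {u} ` ?M \<subseteq> D E 2 W"
      by (rule image_subsetI, rule v, rule subsetD[OF D_mono]) auto
    have A4: "insert {a, u} ` ?M \<subseteq> D E 2 W"
      using e[OF a] by (intro image_subsetI) (simp add: insert_commute)
    have A5: "(\<Union>v\<in>?N - {a}. insert {u, v} ` D E (Suc 0) (W - {u, v})) \<subseteq> D E 2 W"
      by (intro UN_least image_subsetI e) auto
    show "LS (?N - {a}) \<subseteq> D E 2 W"
      unfolding LS_def by (simp only: Un_subset_iff insert_subset A1 A2 A3 A4 A5 simp_thms)
    show "D E 2 W \<subseteq> LS (?N - {a})"
    proof
      fix s assume s: "s \<in> D E 2 W"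
      show "s \<in> LS (?N - {a})"
      proof (cases "u \<in> \<Union>s")
        case False
        have "c \<in> cells_in E (W - {u})" if "c \<in> s" for c
          proof -
            have "c \<in> cells_in E W" using s that by (auto simp: D_def)
            moreover have "c \<subseteq> W - {u}" using cells_in_subset[OF calculation] False that by blast
            ultimately show ?thesis using cells_in_iff[of c "W - {u}" W E] by blast
          qed
        then have "s \<in> ?K" using s by (auto simp: D_def)
        then show ?thesis by (auto simp: LS_def)
      next
        case True
        then obtain c where c: "c \<in> s" "u \<in> c" by blast
        have s': "s - {c} \<in> D E (Suc 0) (W - c)" "s = insert c (s - {c})"
          using D_removeI[of s E "Suc 0" W c] s c unfolding two by auto
        have "c \<in> cells_in E W" using s c by (auto simp: D_def)
        then consider "c = {u}" | "c \<in> edges_in E W" using c(2) by (auto simp: cells_in_def)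
        then show ?thesis
        proof cases
          case 1
          then have "s - {c} \<in> D E (Suc 0) (W - {u})" using s'(1) by simp
          then have "insert {u} (s - {c}) \<in> ?L2" by (rule uL2)
          then show ?thesis using s'(2) 1 by (auto simp: LS_def)
        next
          case 2
          then obtain v where v: "c = {u, v}" using graph_edge[OF E _ c(2)] by (auto simp: edges_in_def)
          then have vN: "v \<in> ?N" using 2 by (auto simp: nbrs_def edges_in_def)
          show ?thesis
          proof (cases "v = a")
            case True
            then have "s \<in> insert {a, u} ` ?M" using s' v by (metis imageI insert_commute)
            then show ?thesis by (auto simp: LS_def)
          next
            case False
            then have "s \<in> (\<Union>v\<in>?N - {a}. insert {u, v} ` D E (Suc 0) (W - {u, v}))"
              using s' vN unfolding v by blast
            then show ?thesis by (auto simp: LS_def)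
          qed
        qed
      qed
    qed
  qed
  moreover have "card (?N - {a}) = card ?N - 1" using a fN by simp
  ultimately show ?thesis using LS[of "?N - {a}"] fN by (simp add: mult.commute)
qed

section \<open>Growing a tree\<close>

text \<open>Inside a forest this count says that \<open>W\<close> induces a connected graph.\<close>

definition subtree :: "nat set set \<Rightarrow> nat set \<Rightarrow> bool" where
  "subtree E W \<longleftrightarrow> finite W \<and> card W = Suc (card (edges_in E W))"

lemma nbrs_irrefl: "graph E \<Longrightarrow> u \<notin> nbrs E W u"
  using nbrs_not_self by blast

lemma finite_nbrs: "finite W \<Longrightarrow> finite (nbrs E W u)"
  by (simp add: nbrs_def)

lemma nbrs_sym: "u \<in> W \<Longrightarrow> v \<in> nbrs E W u \<Longrightarrow> u \<in> nbrs E W v"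
  by (simp add: nbrs_def insert_commute)

lemma card_edges_in_forest:
  assumes E: "graph E" and W: "finite W" "forest E W" "W \<noteq> {}"
  shows "card (edges_in E W) < card W"
  using W
proof (induction "card W" arbitrary: W)
  case (Suc n)
  then obtain w where w: "w \<in> W" "card (nbrs E W w) \<le> 1" by (auto simp: forest_def)
  have c: "card W = Suc (card (W - {w}))" using Suc w(1) by (metis card.remove)
  show ?case
  proof (cases "W - {w} = {}")
    case True
    have "edges_in E {w} = {}" using E by (auto simp: edges_in_def graph_def subset_singleton_iff)
    moreover have "W = {w}" using True w(1) by auto
    ultimately show ?thesis by simp
  next
    case False
    have "card (edges_in E (W - {w})) < card (W - {w})"
      using Suc c False by (intro Suc.hyps(1)) (auto intro: forest_mono)
    then show ?thesis using card_edges_in_remove[OF E Suc.prems(1) w(1)] w(2) c by linarith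
  qed
qed auto

text \<open>A second edge from \<open>w\<close> to \<open>W\<close> would make the number of edges
  reach the number of vertices, which \<open>card_edges_in_forest\<close> excludes.\<close>

lemma subtree_insert:
  assumes E: "graph E" and V: "finite V" "forest E V" and W: "W \<subseteq> V" "subtree E W"
    and w: "w \<in> V" "w \<notin> W" "x \<in> W" "{x, w} \<in> E"
  shows "nbrs E W w = {x}" "subtree E (insert w W)"
    "y \<in> W \<Longrightarrow> y \<noteq> x \<Longrightarrow> nbrs E (insert w W) y = nbrs E W y"
    "nbrs E (insert w W) x = insert w (nbrs E W x)" "nbrs E (insert w W) w = {x}"
proof -
  have fW: "finite W" using W by (simp add: subtree_def)
  have self: "nbrs E (insert w W) w = nbrs E W w" using E by (auto simp: nbrs_def graph_def)
  have *: "card (edges_in E (insert w W)) = card (edges_in E W) + card (nbrs E W w)"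
    using card_edges_in_remove[OF E, of "insert w W" w] fW w(2) self by simp
  moreover have "card (edges_in E (insert w W)) < card (insert w W)"
    by (rule card_edges_in_forest[OF E]) (use fW V W w in \<open>auto intro: forest_mono\<close>)
  ultimately have "card (nbrs E W w) \<le> 1" using W(2) fW w(2) by (simp add: subtree_def)
  moreover have x: "x \<in> nbrs E W w" using w by (simp add: nbrs_def insert_commute)
  moreover have "finite (nbrs E W w)" using fW by (rule finite_nbrs)
  ultimately show 1: "nbrs E W w = {x}"
    by (metis One_nat_def card_le_Suc0_iff_eq is_singletonI is_singletonI' is_singleton_the_elem singletonD empty_iff)
  then show "nbrs E (insert w W) w = {x}" using self by simp
  show "subtree E (insert w W)" using * 1 W(2) fW w(2) by (simp add: subtree_def)
  show "nbrs E (insert w W) x = insert w (nbrs E W x)" using w by (auto simp: nbrs_def)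
  show "nbrs E (insert w W) y = nbrs E W y" if "y \<in> W" "y \<noteq> x"
  proof -
    have "{y, w} \<notin> E"
    proof
      assume "{y, w} \<in> E"
      then have "y \<in> nbrs E W w" using that(1) by (simp add: nbrs_def insert_commute)
      then show False using 1 that(2) by simp
    qed
    then show ?thesis by (auto simp: nbrs_def)
  qed
qed

text \<open>For positive \<open>r\<close> this is \<open>m_num\<close> of the subgraph induced by
  \<open>W\<close>, with degrees taken in \<open>W\<close>; vertices of degree at most
  \<open>r\<close> contribute zero.\<close>

definition branch_sum :: "nat set set \<Rightarrow> nat set \<Rightarrow> nat \<Rightarrow> nat" where
  "branch_sum E W r = (\<Sum>v\<in>W. (card (nbrs E W v) - 1) choose r)"

text \<open>The predicted number of orbits of arcs for \<open>W\<close>, equal to the number of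
  orbits of edges when the multiplicities m_2 + m_3, m_2 + m_3 and m_2 are added up.\<close>

definition rank :: "nat set set \<Rightarrow> nat set \<Rightarrow> nat" where
  "rank E W = 3 * branch_sum E W 2 + 2 * branch_sum E W 3"

text \<open>Only the degree of \<open>x\<close> changes, and the new leaf contributes zero. The
  equation is additive to avoid subtraction of natural numbers.\<close>

lemma branch_sum_insert:
  assumes E: "graph E" and V: "finite V" "forest E V" and W: "W \<subseteq> V" "subtree E W"
    and w: "w \<in> V" "w \<notin> W" "x \<in> W" "{x, w} \<in> E" and r: "0 < r"
  shows "branch_sum E (insert w W) r + ((card (nbrs E W x) - 1) choose r) =
    branch_sum E W r + (card (nbrs E W x) choose r)"
proof -
  note n = subtree_insert[OF E V W w]
  have fW: "finite W" using W by (simp add: subtree_def)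
  let ?f = "\<lambda>v. (card (nbrs E (insert w W) v) - 1) choose r"
  have w': "w \<notin> nbrs E W x" using w(2) by (simp add: nbrs_def)
  have "branch_sum E (insert w W) r = ?f w + (?f x + sum ?f (W - {x}))"
    unfolding branch_sum_def using fW w by (simp add: sum.remove[of W x])
  moreover have "?f w = 0" using n(5) r by simp
  moreover have "?f x = card (nbrs E W x) choose r" using n(4) w' finite_nbrs[OF fW] by simp
  moreover have "sum ?f (W - {x}) = (\<Sum>v\<in>W - {x}. (card (nbrs E W v) - 1) choose r)"
    by (rule sum.cong) (use n(3) in auto)
  moreover have "branch_sum E W r = ((card (nbrs E W x) - 1) choose r) + (\<Sum>v\<in>W - {x}. (card (nbrs E W v) - 1) choose r)"
    unfolding branch_sum_def using fW w by (simp add: sum.remove[of W x])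
  ultimately show ?thesis by simp
qed

lemma builds_D_2_leaf:
  assumes E: "graph E" and W: "finite W" and w: "w \<notin> W" "u \<in> W" "nbrs E W w = {u}" and ne: "nbrs E W u \<noteq> {}"
  shows "builds (D E 2 W) (card (nbrs E W u) - 1) (D E 2 (insert w W))"
proof -
  obtain a where a: "a \<in> nbrs E W u" using ne by blast
  have "builds (D E (Suc 0) (W - {u})) (card (nbrs E W u - {a})) (D E (Suc 0) W - {})"
    using builds_D_1[OF E W w(2) a order_refl] by simp
  from builds_leaf[OF E W w this] show ?thesis
    using a finite_nbrs[OF W] by (simp add: numeral_2_eq_2)
qed

lemma builds_D_3_leaf:
  assumes E: "graph E" and W: "finite W" and w: "w \<notin> W" "u \<in> W" "nbrs E W w = {u}"
    and b: "builds (D E 2 (W - {u})) n (D E 2 W)"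
  shows "builds (D E 3 W) n (D E 3 (insert w W))"
  using builds_leaf[OF E W w, of 2 n "{}"] b by (simp add: numeral_3_eq_3 numeral_2_eq_2)

text \<open>The binomial identity that matches topology and count: for k = \<open>Suc j\<close>,
  raising the degree of a vertex from k to k + 1 increases the rank by the k (k - 1) arcs of the
  first new vertex and the k - 1 arcs of the second.\<close>

lemma rank_step:
  "3 * (Suc j choose 2) + 2 * (Suc j choose 3) =
   3 * (j choose 2) + 2 * (j choose 3) + (Suc j * (Suc j - 1) + (Suc j - 1))"
proof -
  have "Suc j choose 2 = j + (j choose 2)" by (simp add: numeral_2_eq_2)
  moreover have "Suc j choose 3 = (j choose 2) + (j choose 3)" by (simp add: numeral_3_eq_3 numeral_2_eq_2)
  moreover have "even (j * (j - 1))" by (cases j) auto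
  then have "2 * (j choose 2) = j * (j - 1)" by (simp add: choose_two)
  moreover have "j * (j - 1) + 3 * j = Suc j * j + j" by (cases j) simp_all
  ultimately show ?thesis by simp
qed

text \<open>The induction keeps the invariant that the neighbour of every leaf of \<open>W\<close>
  has degree 2, in \<open>W\<close> and in \<open>V\<close>. So a vertex whose degree in
  \<open>V\<close> is not 2 is never next to a leaf, and all its neighbours in \<open>W\<close> have
  degree 2, as \<open>builds_D_2\<close> requires. \<open>P\<close> stands for any property that
  constructions carry along; in the end it says that the complex is equivalent to the graphs with
  \<open>m\<close> orbits of edges.\<close>

lemma tree_growth:
  assumes E: "graph E" and V: "finite V" "forest E V"
    and cross: "\<And>W. W \<subseteq> V \<Longrightarrow> W \<noteq> {} \<Longrightarrow> W \<noteq> V \<Longrightarrow> \<exists>x\<in>W. \<exists>w\<in>V - W. {x, w} \<in> E"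
    and subdiv: "\<And>x y. {x, y} \<in> E \<Longrightarrow> card (nbrs E V x) = 2 \<or> card (nbrs E V y) = 2"
    and step: "\<And>W W' m n. P W m \<Longrightarrow> W \<subseteq> W' \<Longrightarrow> W' \<subseteq> V \<Longrightarrow> builds (D E 3 W) n (D E 3 W') \<Longrightarrow> P W' (m + n)"
    and W: "W \<subseteq> V" "subtree E W" "\<And>y. y \<in> W \<Longrightarrow> nbrs E W y \<noteq> {}"
      "\<And>y z. y \<in> W \<Longrightarrow> nbrs E W y = {z} \<Longrightarrow> card (nbrs E W z) = 2 \<and> card (nbrs E V z) = 2"
      "P W (rank E W)"
  shows "P V (rank E V)"
  using W
proof (induction "card (V - W)" arbitrary: W rule: less_induct)
  case less
  note W = less.prems
  have fW: "finite W" using W(2) by (simp add: subtree_def)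
  show ?case
  proof (cases "W = V")
    case False
    have "W \<noteq> {}" using W(2) by (auto simp: subtree_def)
    then obtain x w where w: "w \<in> V" "w \<notin> W" "x \<in> W" "{x, w} \<in> E"
      using cross[OF W(1) _ False] by blast
    note s1 = subtree_insert[OF E V W(1,2) w]
    let ?W1 = "insert w W"
    define k where "k = card (nbrs E W x)"
    have k: "k \<ge> 1" unfolding k_def using W(3)[OF w(3)] finite_nbrs[OF fW] by (simp add: Suc_leI card_gt_0_iff)
    have ck: "card (nbrs E ?W1 x) = Suc k"
      using s1(4) w(2) finite_nbrs[OF fW] by (simp add: k_def nbrs_def)
    have W1: "?W1 \<subseteq> V" using W(1) w(1) by auto
    have mono: "nbrs E W y \<subseteq> nbrs E V y" for y using W(1) by (auto simp: nbrs_def)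
    have bs1: "branch_sum E ?W1 r + (k - 1 choose r) = branch_sum E W r + (k choose r)" if "0 < r" for r
      using branch_sum_insert[OF E V W(1,2) w that] by (simp add: k_def)
    show ?thesis
    proof (cases "card (nbrs E V x) = 2")
      case True
      have "nbrs E ?W1 x \<subseteq> nbrs E V x" using W1 by (auto simp: nbrs_def)
      then have "Suc k \<le> 2" using card_mono[OF finite_nbrs[OF V(1)]] ck True by metis
      \<comment> \<open>Here \<open>x\<close> is a leaf of \<open>W\<close>, and lengthening the
        branch beyond it costs no arc.\<close>
      then have k1: "k = 1" using k by simp
      then obtain y where y: "nbrs E W x = {y}" unfolding k_def by (meson card_1_singletonE)
      have y2: "card (nbrs E W y) = 2" using W(4)[OF w(3) y] by simp
      have "builds (D E 2 (W - {x})) 0 (D E 2 W)"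
        using builds_D_2[OF E fW forest_mono[OF V(2) W(1)] _ w(3)] W(2) y y2 by (simp add: subtree_def)
      then have "builds (D E 3 W) 0 (D E 3 ?W1)" by (rule builds_D_3_leaf[OF E fW w(2,3) s1(1)])
      then have P1: "P ?W1 (rank E W)" using step[OF W(5) _ W1, of 0] by auto
      have "branch_sum E ?W1 r = branch_sum E W r" if "2 \<le> r" for r using bs1[of r] that k1 by (simp add: binomial_eq_0)
      then have P1: "P ?W1 (rank E ?W1)" using P1 by (simp add: rank_def)
      show ?thesis
      proof (rule less.hyps[OF _ W1 s1(2) _ _ P1])
        show "card (V - ?W1) < card (V - W)" using V(1) w by (intro psubset_card_mono) auto
        show "nbrs E ?W1 z \<noteq> {}" if "z \<in> ?W1" for z
          using that s1(3)[of z] s1(4,5) W(3)[of z] by (cases "z = x"; cases "z = w") auto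
        show "card (nbrs E ?W1 z') = 2 \<and> card (nbrs E V z') = 2" if z: "z \<in> ?W1" "nbrs E ?W1 z = {z'}" for z z'
        proof -
          consider "z = w" | "z = x" | "z \<in> W" "z \<noteq> x" using z by auto
          then show ?thesis
          proof cases
            case 1
            then have "z' = x" using z(2) s1(5) by simp
            then show ?thesis using ck k1 True by simp
          next
            case 2
            then show ?thesis using z(2) ck k by simp
          next
            case 3
            then have "nbrs E W z = {z'}" using s1(3) z(2) by simp
            then have c: "card (nbrs E W z') = 2" "card (nbrs E V z') = 2" "z' \<in> W"
              using W(4)[OF 3(1)] by (auto simp: nbrs_def)
            then have "z' \<noteq> x" using y by auto
            then show ?thesis using s1(3) c by simp
          qed
        qed
      qed
    next
      \<comment> \<open>Now \<open>w\<close> has degree 2 in \<open>V\<close>, and it is attached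
        together with its next neighbour \<open>w'\<close>; with \<open>w\<close> alone, a leaf next
        to \<open>x\<close> would violate the invariant.\<close>
      case nV: False
      then have wV: "card (nbrs E V w) = 2" using subdiv[OF w(4)] by simp
      have "x \<in> nbrs E V w" using w W(1) by (auto simp: nbrs_def insert_commute)
      then obtain w' where w': "w' \<in> nbrs E V w" "w' \<noteq> x" using wV
        by (metis One_nat_def card_1_singleton_iff insertI1 is_singletonI' is_singleton_def numeral_2_eq_2 old.nat.inject empty_iff nat.distinct(1))
      have w'W: "w' \<in> V" "w' \<notin> ?W1" "w \<in> ?W1" "{w, w'} \<in> E"
      proof -
        show "w' \<in> V" "{w, w'} \<in> E" "w \<in> ?W1" using w'(1) by (auto simp: nbrs_def)
        have "w' \<noteq> w" using nbrs_not_self[OF E w'(1)] .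
        moreover have "w' \<notin> W"
        proof
          assume "w' \<in> W"
          then have "w' \<in> nbrs E W w" using w'(1) by (simp add: nbrs_def)
          then show False using s1(1) w'(2) by simp
        qed
        ultimately show "w' \<notin> ?W1" by simp
      qed
      note s2 = subtree_insert[OF E V W1 s1(2) w'W]
      let ?W2 = "insert w' ?W1"
      have W2: "?W2 \<subseteq> V" using W1 w'W by auto
      have f1: "finite ?W1" using fW by simp
      \<comment> \<open>The degree in \<open>V\<close> is 2 by subdivision, so the degree in
        \<open>W\<close> is at most 2; it is not 1, because \<open>y\<close> would be a leaf next to
        \<open>x\<close>.\<close>
      have y2: "card (nbrs E W y) = 2" if y: "y \<in> nbrs E W x" for y
      proof -
        have yW: "y \<in> W" "{x, y} \<in> E" using y by (auto simp: nbrs_def)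
        have "card (nbrs E V y) = 2" using subdiv[OF yW(2)] nV by simp
        then have "card (nbrs E W y) \<le> 2" using card_mono[OF finite_nbrs[OF V(1)] mono] by metis
        moreover have "card (nbrs E W y) \<noteq> 0" using W(3)[OF yW(1)] finite_nbrs[OF fW] by simp
        moreover have "card (nbrs E W y) \<noteq> 1"
        proof
          assume "card (nbrs E W y) = 1"
          then obtain z where "nbrs E W y = {z}" by (meson card_1_singletonE)
          moreover have "x \<in> nbrs E W y" using nbrs_sym[OF w(3) y] .
          ultimately have "nbrs E W y = {x}" by simp
          then show False using W(4)[OF yW(1)] nV by simp
        qed
        ultimately show ?thesis by linarith
      qed
      have b1: "builds (D E 3 W) (k * (k - 1)) (D E 3 ?W1)"
        unfolding k_def
        by (rule builds_D_3_leaf[OF E fW w(2,3) s1(1)], rule builds_D_2[OF E fW forest_mono[OF V(2) W(1)] _ w(3)])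
          (use W(2) W(3)[OF w(3)] y2 in \<open>auto simp: subtree_def\<close>)
      \<comment> \<open>Two uses of the recursion: \<open>w'\<close> is a leaf at \<open>w\<close>,
        and \<open>w\<close> itself was a leaf at \<open>x\<close>, so the problem reduces to one
        point near \<open>x\<close>.\<close>
      have b2: "builds (D E 3 ?W1) (k - 1) (D E 3 ?W2)"
      proof (rule builds_D_3_leaf[OF E f1 w'W(2,3) s2(1)])
        have "?W1 - {w} = W" using w(2) by auto
        then show "builds (D E 2 (?W1 - {w})) (k - 1) (D E 2 ?W1)"
          using builds_D_2_leaf[OF E fW w(2,3) s1(1) W(3)[OF w(3)]] by (simp add: k_def)
      qed
      have P2: "P ?W2 (rank E W + (k * (k - 1) + (k - 1)))"
        by (rule step[OF W(5) _ W2 builds_trans[OF b2 b1]]) auto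
      have bs2: "branch_sum E ?W2 r = branch_sum E ?W1 r" if "2 \<le> r" for r
        using branch_sum_insert[OF E V W1 s1(2) w'W, of r] s1(5) that by (simp add: binomial_eq_0)
      obtain j where j: "k = Suc j" using k by (cases k) auto
      have "rank E ?W2 + (3 * (j choose 2) + 2 * (j choose 3)) = rank E W + (3 * (Suc j choose 2) + 2 * (Suc j choose 3))"
        using bs1[of 2] bs1[of 3] bs2[of 2] bs2[of 3] unfolding rank_def j by simp
      then have rk: "rank E ?W2 = rank E W + (k * (k - 1) + (k - 1))" using rank_step[of j] j by simp
      show ?thesis
      proof (rule less.hyps[OF _ W2 s2(2) _ _ P2[folded rk]])
        show "card (V - ?W2) < card (V - W)" using V(1) w by (intro psubset_card_mono) auto
        have n2: "nbrs E ?W2 z = (if z = w' then {w} else if z = w then {w', x} else if z = x then insert w (nbrs E W x) else nbrs E W z)"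
          if "z \<in> ?W2" for z
          using that s1(3)[of z] s1(4,5) s2(3)[of z] s2(4,5) w w'W by auto
        have xw: "x \<noteq> w" "x \<noteq> w'" "w \<noteq> w'" using w w'W by auto
        show "nbrs E ?W2 z \<noteq> {}" if "z \<in> ?W2" for z
          using n2[OF that] W(3)[of z] that by auto
        show "card (nbrs E ?W2 z') = 2 \<and> card (nbrs E V z') = 2" if z: "z \<in> ?W2" "nbrs E ?W2 z = {z'}" for z z'
        proof -
          consider "z = w'" | "z = w" | "z = x" | "z \<in> W" "z \<noteq> x" "z \<noteq> w" "z \<noteq> w'" using z w w'W by auto
          then show ?thesis
          proof cases
            case 1
            then have "z' = w" using z n2 by auto
            then show ?thesis using n2[of w] xw wV by simp
          next
            case 2
            then show ?thesis using z n2[of w] xw w' by auto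
          next
            case 3
            have "nbrs E ?W2 x = insert w (nbrs E W x)" using n2[of x] xw w by simp
            then have e: "{z'} = insert w (nbrs E W x)" using z(2) 3 by simp
            have "w \<notin> nbrs E W x" using w(2) by (simp add: nbrs_def)
            then have "card (insert w (nbrs E W x)) = Suc k" using finite_nbrs[OF fW] by (simp add: k_def)
            then have "card {z'} = Suc k" unfolding e .
            then show ?thesis using k by simp
          next
            case 4
            then have "nbrs E W z = {z'}" using n2[OF z(1)] z(2) by simp
            then have c: "card (nbrs E W z') = 2" "card (nbrs E V z') = 2" "z' \<in> W"
              using W(4)[OF 4(1)] by (auto simp: nbrs_def)
            then have "z' \<noteq> x" "z' \<noteq> w" "z' \<noteq> w'" using nV w w'W by auto
            then show ?thesis using n2[of z'] c by simp
          qed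
        qed
      qed
    qed
  qed (use W in simp)
qed

section \<open>Finite trees as connected forests\<close>

lemma finite_tree_graph:
  assumes "finite_tree V E"
  shows "finite V" "graph E" "\<And>e. e \<in> E \<Longrightarrow> e \<subseteq> V"
  using assms by (auto simp: finite_tree_def graph_def)

lemma finite_tree_cross:
  assumes T: "finite_tree V E" and W: "W \<subseteq> V" "W \<noteq> {}" "W \<noteq> V"
  shows "\<exists>x\<in>W. \<exists>w\<in>V - W. {x, w} \<in> E"
proof -
  obtain a b where ab: "a \<in> W" "b \<in> V" "b \<notin> W" using W by blast
  then obtain p where p: "is_path E p" "hd p = a" "last p = b"
    using T W(1) unfolding finite_tree_def by blast
  have pn: "p \<noteq> []" "\<And>i. Suc i < length p \<Longrightarrow> {p ! i, p ! Suc i} \<in> E" using p(1) by (auto simp: is_path_def)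
  \<comment> \<open>The first place where the path from \<open>a\<close> to \<open>b\<close> has
    left \<open>W\<close>.\<close>
  define i where "i = (LEAST i. i < length p \<and> p ! i \<notin> W)"
  have "length p - 1 < length p \<and> p ! (length p - 1) \<notin> W" using pn p(3) ab by (simp add: last_conv_nth)
  then have i: "i < length p" "p ! i \<notin> W" unfolding i_def by (metis (mono_tags, lifting) LeastI)+
  have "i \<noteq> 0" using i p(2) ab pn by (metis hd_conv_nth)
  then obtain j where j: "i = Suc j" by (cases i) auto
  have "j < i" using j by simp
  then have "\<not> (j < length p \<and> p ! j \<notin> W)" unfolding i_def by (rule not_less_Least)
  then have "p ! j \<in> W" using i j by simp
  moreover have e: "{p ! j, p ! i} \<in> E" using pn(2)[of j] i j by simp
  moreover have "p ! i \<in> V" using finite_tree_graph(3)[OF T e] by simp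
  ultimately show ?thesis using i(2) by blast
qed

text \<open>In a set whose vertices all have two neighbours, the last vertex of a longest path has
  all its neighbours on the path, and one that is not the preceding vertex closes a cycle.\<close>

lemma finite_tree_forest:
  assumes T: "finite_tree V E"
  shows "forest E V"
  unfolding forest_def
proof (intro allI impI)
  fix U assume U: "U \<subseteq> V" "U \<noteq> {}"
  have fU: "finite U" using U(1) finite_tree_graph(1)[OF T] by (rule finite_subset)
  show "\<exists>w\<in>U. card (nbrs E U w) \<le> 1"
  proof (rule ccontr)
    assume no: "\<not> (\<exists>w\<in>U. card (nbrs E U w) \<le> 1)"
    define Q where "Q p \<longleftrightarrow> is_path E p \<and> set p \<subseteq> U" for p
    obtain u where "u \<in> U" using U(2) by blast
    then have "Q [u]" by (simp add: Q_def is_path_def)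
    moreover have "length p \<le> card U" if "Q p" for p
      using that fU card_mono[of U "set p"] by (auto simp: Q_def is_path_def distinct_card)
    ultimately have "\<exists>p. Q p \<and> (\<forall>q. Q q \<longrightarrow> length q \<le> length p)"
      by (intro ex_has_greatest_nat[where b = "Suc (card U)"]) (auto intro: le_SucI simp: less_Suc_eq_le)
    then obtain p where p: "Q p" "\<And>q. Q q \<Longrightarrow> length q \<le> length p" by blast
    have pp: "p \<noteq> []" "distinct p" "\<And>i. Suc i < length p \<Longrightarrow> {p ! i, p ! Suc i} \<in> E" "set p \<subseteq> U"
      using p(1) by (auto simp: Q_def is_path_def)
    define x where "x = last p"
    have xU: "x \<in> U" using pp by (auto simp: x_def)
    have N: "nbrs E U x \<subseteq> set p"
    proof
      fix y assume y: "y \<in> nbrs E U x"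
      show "y \<in> set p"
      proof (rule ccontr)
        assume "y \<notin> set p"
        have "{(p @ [y]) ! i, (p @ [y]) ! Suc i} \<in> E" if "Suc i < length (p @ [y])" for i
        proof (cases "Suc i < length p")
          case True
          then show ?thesis using pp(3)[OF True] by (simp add: nth_append)
        next
          case False
          then have "i = length p - 1" "Suc i = length p" using that by auto
          then have "(p @ [y]) ! i = x" "(p @ [y]) ! Suc i = y"
            using pp(1) by (auto simp: nth_append x_def last_conv_nth)
          then show ?thesis using y by (simp add: nbrs_def)
        qed
        then have "Q (p @ [y])" using pp \<open>y \<notin> set p\<close> y by (auto simp: Q_def is_path_def nbrs_def)
        then show False using p(2)[of "p @ [y]"] by simp
      qed
    qed
    have c2: "card (nbrs E U x) > 1" using no xU by auto
    \<comment> \<open>The vertex removed is the predecessor of \<open>x\<close>. On a path with one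
      vertex the truncated index gives \<open>x\<close> itself, and the position of \<open>y\<close>
      computed below then contradicts the length of the path.\<close>
    have "nbrs E U x - {p ! (length p - 2)} \<noteq> {}"
    proof
      assume "nbrs E U x - {p ! (length p - 2)} = {}"
      then have "nbrs E U x \<subseteq> {p ! (length p - 2)}" by blast
      then have "card (nbrs E U x) \<le> 1" using card_mono[of "{p ! (length p - 2)}"] by fastforce
      then show False using c2 by simp
    qed
    then obtain y where y: "y \<in> nbrs E U x" "y \<noteq> p ! (length p - 2)" by blast
    then obtain i where i: "i < length p" "y = p ! i" using N by (metis in_set_conv_nth subsetD)
    have "y \<noteq> x" using nbrs_not_self[OF finite_tree_graph(2)[OF T] y(1)] .
    then have "i \<noteq> length p - 1" using i(2) pp(1) by (auto simp: x_def last_conv_nth)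
    moreover have "i \<noteq> length p - 2" using i(2) y(2) by auto
    ultimately have il: "i + 3 \<le> length p" using i(1) by linarith
    have "is_cycle E (drop i p)"
      unfolding is_cycle_def is_path_def
    proof (intro conjI allI impI)
      show "3 \<le> length (drop i p)" "drop i p \<noteq> []" "distinct (drop i p)" using il pp(2) by auto
      show "{drop i p ! j, drop i p ! Suc j} \<in> E" if "Suc j < length (drop i p)" for j
        using pp(3)[of "i + j"] that by simp
      have "last (drop i p) = x" "hd (drop i p) = y" using i by (auto simp: x_def hd_drop_conv_nth)
      then show "{last (drop i p), hd (drop i p)} \<in> E" using y(1) by (simp add: nbrs_def)
    qed
    then show False using T unfolding finite_tree_def by blast
  qed
qed

lemma deg_eq_card_nbrs:
  assumes T: "finite_tree V E" shows "deg E v = card (nbrs E V v)"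
proof -
  have "{e \<in> E. v \<in> e} = (\<lambda>x. {v, x}) ` nbrs E V v"
  proof (intro equalityI subsetI)
    fix e assume e: "e \<in> {e \<in> E. v \<in> e}"
    then obtain x where x: "e = {v, x}" using graph_edge[OF finite_tree_graph(2)[OF T], of e v] by blast
    then have "x \<in> V" using finite_tree_graph(3)[OF T, of e] e by auto
    then show "e \<in> (\<lambda>x. {v, x}) ` nbrs E V v" using x e by (auto simp: nbrs_def)
  qed (auto simp: nbrs_def)
  moreover have "inj_on (\<lambda>x. {v, x}) (nbrs E V v)" by (auto simp: inj_on_def doubleton_eq_iff)
  ultimately show ?thesis by (simp add: deg_def card_image)
qed

lemma m_num_eq_branch_sum:
  assumes T: "finite_tree V E" and r: "0 < r"
  shows "m_num V E r = branch_sum E V r"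
  unfolding m_num_def branch_sum_def deg_eq_card_nbrs[OF T]
  by (rule sum.mono_neutral_left) (use finite_tree_graph(1)[OF T] r in \<open>auto intro!: binomial_eq_0\<close>)

text \<open>The form in which subdivision enters: the path along a single edge is too short to join
  two vertices of degree other than 2.\<close>

lemma suff_subdivided_edge:
  assumes T: "finite_tree V E" and S: "suff_subdivided 3 E" and e: "{x, y} \<in> E"
  shows "card (nbrs E V x) = 2 \<or> card (nbrs E V y) = 2"
proof (rule ccontr)
  assume "\<not> ?thesis"
  then have d: "deg E x \<noteq> 2" "deg E y \<noteq> 2" using deg_eq_card_nbrs[OF T] by auto
  have "x \<noteq> y" using e finite_tree_graph(2)[OF T] by (auto simp: graph_def)
  then have "is_path E [x, y]" using e by (auto simp: is_path_def less_Suc_eq)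
  then show False using S d \<open>x \<noteq> y\<close> unfolding suff_subdivided_def by fastforce
qed

section \<open>The target graph\<close>

text \<open>Left multiplication by \<open>perm f\<close> leads from the tail to the head of each
  edge in family \<open>f\<close>. It commutes with the action, which multiplies on the right, so
  the pairs of a family form a single free orbit, see \<open>fam_pairs\<close>. Families 1 and 2
  belong to transpositions, which accounts for their edges in both directions.\<close>

definition perm :: "nat \<Rightarrow> nat \<Rightarrow> nat" where
  "perm f = (if f = 0 then pv 2 0 1 else if f = 1 then pv 1 0 2 else pv 0 2 1)"

definition orbit_edges :: "(nat \<Rightarrow> nat) \<Rightarrow> gedge set" where
  "orbit_edges N = {(f, x, perm f \<circ> x, k) | f x k. f < 3 \<and> x \<in> Sym 3 \<and> k < N f}"

text \<open>The realization for arbitrary multiplicities \<open>N\<close> of the three families,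
  needed for comparison with the intermediate complexes.\<close>

definition R :: "(nat \<Rightarrow> nat) \<Rightarrow> (gidx \<Rightarrow> real) set" where
  "R N = gvert ` Sym 3 \<union> (\<Union>e\<in>orbit_edges N. gpt e ` {0..1})"

text \<open>The permutation of coordinates induced by right multiplication on labels; the inverse
  appears because a function is pulled back. The copy number \<open>k\<close> of an edge is
  kept.\<close>

definition ract :: "(nat \<Rightarrow> nat) \<Rightarrow> (gidx \<Rightarrow> real) \<Rightarrow> gidx \<Rightarrow> real" where
  "ract g z = (\<lambda>j. case j of Inl q \<Rightarrow> z (Inl (q \<circ> inv g))
     | Inr (f, x, y, k) \<Rightarrow> z (Inr (f, x \<circ> inv g, y \<circ> inv g, k)))"

lemma pv_simps [simp]: "pv i j k 0 = i" "pv i j k (Suc 0) = j" "pv i j k 2 = k" "n \<ge> 3 \<Longrightarrow> pv i j k n = n"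
  by (auto simp: pv_def)

lemma less3_cases: "n < (3::nat) \<Longrightarrow> n = 0 \<or> n = 1 \<or> n = 2"
  by auto

lemma Sym3_eq_pv:
  assumes "g \<in> Sym 3" shows "g = pv (g 0) (g 1) (g 2)"
proof
  fix n
  have "g n = n" if "n \<ge> 3" using assms that by (auto simp: Sym3 intro!: permutes_not_in[of g "{..<3}"])
  then show "g n = pv (g 0) (g 1) (g 2) n"
    using less3_cases[of n] by (cases "n < 3") (auto simp: pv_def)
qed

lemma pv_in_Sym3:
  assumes "{i, j, k} = {0, 1, 2::nat}" shows "pv i j k \<in> Sym 3"
proof -
  have img: "pv i j k ` {..<3} = {..<3}" using assms by (simp add: lessThan3)
  then have "bij_betw (pv i j k) {..<3} {..<3}"
    by (simp add: bij_betw_def finite_surj_inj)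
  then show ?thesis unfolding Sym3 by (rule bij_imp_permutes) simp
qed

lemma G3_vertices: "G3_vertices = Sym 3"
proof
  show "G3_vertices \<subseteq> Sym 3"
    unfolding G3_vertices_def by (intro insert_subsetI empty_subsetI pv_in_Sym3) auto
  show "Sym 3 \<subseteq> G3_vertices"
  proof
    fix g :: "nat \<Rightarrow> nat" assume g: "g \<in> Sym 3"
    have i: "g n < 3" if "n < 3" for n
      using g that permutes_in_image[of g "{..<3}" n] by (simp add: Sym3)
    have "inj g" using g permutes_inj by (auto simp: Sym3)
    then have "g 0 \<noteq> g 1" "g 0 \<noteq> g 2" "g 1 \<noteq> g 2" by (auto simp: inj_eq)
    moreover have "g 0 = 0 \<or> g 0 = 1 \<or> g 0 = 2" "g 1 = 0 \<or> g 1 = 1 \<or> g 1 = 2" "g 2 = 0 \<or> g 2 = 1 \<or> g 2 = 2"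
      using i[of 0] i[of 1] i[of 2] by (auto dest!: less3_cases)
    ultimately have "pv (g 0) (g 1) (g 2) \<in> G3_vertices"
      unfolding G3_vertices_def by (elim disjE) simp_all
    then show "g \<in> G3_vertices" using Sym3_eq_pv[OF g] by simp
  qed
qed

lemma perm_in_Sym3: "perm f \<in> Sym 3"
  by (auto simp: perm_def intro!: pv_in_Sym3)

lemma perm_neq: "perm f \<circ> x \<noteq> x" if "x \<in> Sym 3"
proof
  assume "perm f \<circ> x = x"
  then have "perm f \<circ> (x \<circ> inv x) = x \<circ> inv x" by (metis comp_assoc)
  then have "perm f = id" using Sym_inv_o[OF that] by simp
  then have "perm f 0 = 0" "perm f 1 = 1" by simp_all
  then show False by (auto simp: perm_def split: if_splits)
qed

lemma comp_pv: "g \<in> Sym 3 \<Longrightarrow> g \<circ> pv i j k = pv (g i) (g j) (g k)"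
proof
  fix n assume g: "g \<in> Sym 3"
  have "g n = n" if "n \<ge> 3" using g that by (auto simp: Sym3 intro!: permutes_not_in[of g "{..<3}"])
  then show "(g \<circ> pv i j k) n = pv (g i) (g j) (g k) n" by (simp add: pv_def)
qed

lemma both_ways_insert:
  "both_ways {} = {}" "both_ways (insert (x, y) P) = insert (x, y) (insert (y, x) (both_ways P))"
  by (auto simp: both_ways_def)

lemma fam_pairs: "f < 3 \<Longrightarrow> fam_pairs f = (\<lambda>x. (x, perm f \<circ> x)) ` Sym 3"
proof -
  assume "f < 3"
  then consider "f = 0" | "f = 1" | "f = 2" using less3_cases by blast
  then show ?thesis
  proof cases
    case 1
    show ?thesis
      unfolding G3_vertices[symmetric] G3_vertices_def image_insert image_empty comp_pv[OF perm_in_Sym3]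
      by (simp add: 1 fam_pairs_def perm_def, intro equalityI subsetI; elim insertE emptyE; simp)
  next
    case 2
    show ?thesis
      unfolding G3_vertices[symmetric] G3_vertices_def image_insert image_empty comp_pv[OF perm_in_Sym3]
      by (simp add: 2 fam_pairs_def perm_def both_ways_insert, intro equalityI subsetI; elim insertE emptyE; simp)
  next
    case 3
    show ?thesis
      unfolding G3_vertices[symmetric] G3_vertices_def image_insert image_empty comp_pv[OF perm_in_Sym3]
      by (simp add: 3 fam_pairs_def perm_def both_ways_insert, intro equalityI subsetI; elim insertE emptyE; simp)
  qed
qed

lemma G3_edges: "G3_edges V E = orbit_edges (fam_mult V E)"
proof -
  have "(f < 3 \<and> (x, y) \<in> fam_pairs f \<and> k < fam_mult V E f) \<longleftrightarrow>
      (f < 3 \<and> x \<in> Sym 3 \<and> y = perm f \<circ> x \<and> k < fam_mult V E f)" for f x y k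
    using fam_pairs[of f] by auto
  then show ?thesis unfolding G3_edges_def orbit_edges_def by auto
qed

lemma G3_real: "G3_real V E = R (fam_mult V E)"
  by (simp add: G3_real_def R_def G3_edges G3_vertices)

lemma comp_inv_eq: "g \<in> Sym 3 \<Longrightarrow> q \<circ> inv g = p \<longleftrightarrow> q = p \<circ> g"
  using Sym_inv_o[of g 3] by (metis comp_assoc comp_id)

lemma ract_gvert: "g \<in> Sym 3 \<Longrightarrow> ract g (gvert p) = gvert (p \<circ> g)"
  by (rule ext) (auto simp: ract_def gvert_def comp_inv_eq split: sum.split)

lemma ract_gpt: "g \<in> Sym 3 \<Longrightarrow> ract g (gpt (f, x, y, k) t) = gpt (f, x \<circ> g, y \<circ> g, k) t"
  by (rule ext) (simp add: ract_def gpt_def comp_inv_eq split: sum.split prod.split)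

lemma gact_ract: "gact ract"
  unfolding gact_def
proof (intro conjI ballI allI)
  fix g h :: "nat \<Rightarrow> nat" and x :: "gidx \<Rightarrow> real"
  assume g: "g \<in> Sym 3" and h: "h \<in> Sym 3"
  have "inv (g \<circ> h) = inv h \<circ> inv g"
    using g h by (intro o_inv_distrib) (auto simp: Sym3 permutes_bij)
  then show "ract (g \<circ> h) x = ract h (ract g x)"
    by (intro ext) (simp add: ract_def comp_assoc split: sum.split prod.split)
next
  fix g :: "nat \<Rightarrow> nat"
  show "continuous_on UNIV (ract g)"
    unfolding ract_def
  proof (rule continuous_on_coordinatewise_then_product)
    fix j :: gidx
    show "continuous_on UNIV (\<lambda>z::gidx \<Rightarrow> real. case j of Inl q \<Rightarrow> z (Inl (q \<circ> inv g))
     | Inr (f, x, y, k) \<Rightarrow> z (Inr (f, x \<circ> inv g, y \<circ> inv g, k)))"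
      by (cases j) (auto split: prod.split)
  qed
next
  fix x show "ract id x = x"
    by (rule ext) (simp add: ract_def split: sum.split prod.split)
qed

lemma orbit_edges_act: "(f, x, y, k) \<in> orbit_edges N \<Longrightarrow> g \<in> Sym 3 \<Longrightarrow> (f, x \<circ> g, y \<circ> g, k) \<in> orbit_edges N"
  using Sym_comp[of _ 3 g] by (fastforce simp: orbit_edges_def comp_assoc)

lemma ginv_R: "ginv ract (R N)"
  unfolding ginv_def
proof (intro ballI)
  fix g z assume g: "g \<in> Sym 3" and "z \<in> R N"
  then consider p where "p \<in> Sym 3" "z = gvert p"
    | f x y k t where "(f, x, y, k) \<in> orbit_edges N" "t \<in> {0..1}" "z = gpt (f, x, y, k) t"
    unfolding R_def by force
  then show "ract g z \<in> R N"
  proof cases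
    case (1 p)
    then show ?thesis using ract_gvert[OF g] Sym_comp[OF _ g] by (auto simp: R_def)
  next
    case (2 f x y k t)
    then show ?thesis using ract_gpt[OF g] orbit_edges_act[OF 2(1) g] by (force simp: R_def)
  qed
qed

lemma gpt_ends: "gpt (f, x, y, k) 0 = gvert x" "gpt (f, x, y, k) 1 = gvert y"
  by (auto simp: gpt_def gvert_def)

lemma continuous_gpt: "continuous_on S (gpt e)"
proof (rule continuous_on_coordinatewise_then_product)
  fix j
  obtain f x y k where e: "e = (f, x, y, k)" by (cases e) auto
  have 1: "continuous_on S (\<lambda>t. if P then 1 - t else (0::real))" for P by (cases P) (auto intro!: continuous_intros)
  have 2: "continuous_on S (\<lambda>t. if P then t else (0::real))" for P by (cases P) (auto intro!: continuous_intros)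
  have 3: "continuous_on S (\<lambda>t. if P then min t (1 - t) else (0::real))" for P by (cases P) (auto intro!: continuous_intros)
  show "continuous_on S (\<lambda>t. gpt e t j)"
    unfolding gpt_def e prod.case by (intro continuous_on_add 1 2 3)
qed

lemma compact_imp_closed_fun:
  fixes S :: "('i \<Rightarrow> real) set"
  assumes "compact S" shows "closed S"
proof -
  have "Hausdorff_space (product_topology (\<lambda>_::'i. euclidean :: real topology) UNIV)"
    by (simp add: Hausdorff_space_product_topology)
  then have "Hausdorff_space (euclidean :: ('i \<Rightarrow> real) topology)"
    by (simp add: euclidean_product_topology)
  then show ?thesis
    using compactin_imp_closedin[of "euclidean :: ('i \<Rightarrow> real) topology" S] assms by simp
qed

lemma closed_gpt: "closed (gpt e ` {0..1})"
  by (intro compact_imp_closed_fun compact_continuous_image continuous_gpt compact_Icc)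

lemma finite_orbit_edges: "finite (orbit_edges N)"
proof -
  have "orbit_edges N \<subseteq> (\<Union>f\<in>{..<3}. (\<lambda>(x, k). (f, x, perm f \<circ> x, k)) ` (Sym 3 \<times> {..<N f}))"
    by (force simp: orbit_edges_def)
  then show ?thesis by (rule finite_subset) (auto intro!: finite_cartesian_product finite_Sym)
qed

lemma closed_R: "closed (R N)"
  unfolding R_def
  by (intro closed_Un closed_UN finite_orbit_edges closed_gpt compact_imp_closed_fun finite_imp_compact
      finite_imageI finite_Sym ballI)

lemma R_zero: "z \<in> R N \<Longrightarrow> e \<notin> orbit_edges N \<Longrightarrow> z (Inr e) = 0"
  by (auto simp: R_def gvert_def gpt_def split: prod.splits)

lemma orbit_edges_Suc:
  assumes "f < 3"
  shows "orbit_edges (N(f := Suc (N f))) = orbit_edges N \<union> (\<lambda>x. (f, x, perm f \<circ> x, N f)) ` Sym 3"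
  using assms by (auto simp: orbit_edges_def less_Suc_eq split: if_splits)

text \<open>The new arc has a coordinate of its own, positive inside, which separates it from
  \<open>R N\<close>. Since its head differs from its tail, the coordinate of the head is the
  parameter.\<close>

lemma arc_R:
  assumes f: "f < 3"
  shows "arc ract (R (N(f := Suc (N f)))) (R N) (gpt (f, id, perm f, N f)) (\<lambda>z. z (Inl (perm f)))"
proof
  let ?e = "(f, id, perm f, N f)"
  have ne: "?e \<notin> orbit_edges N" by (auto simp: orbit_edges_def)
  have nid: "perm f \<noteq> id" using perm_neq[OF Sym_id, of f] by simp
  show "gpt ?e 0 \<in> R N" "gpt ?e 1 \<in> R N"
    unfolding gpt_ends R_def using Sym_id perm_in_Sym3 by auto
  show "R (N(f := Suc (N f))) = R N \<union> (\<Union>g\<in>Sym 3. ract g ` gpt ?e ` {0..1})"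
  proof -
    have "ract g ` gpt ?e ` {0..1} = gpt (f, g, perm f \<circ> g, N f) ` {0..1}" if "g \<in> Sym 3" for g
      using ract_gpt[OF that, of f id "perm f" "N f"] by (simp add: image_image)
    then show ?thesis unfolding R_def orbit_edges_Suc[OF f] by auto
  qed
  show "gpt ?e t \<notin> R N" if "0 < t" "t < 1" for t
    using R_zero[OF _ ne, of "gpt ?e t"] that by (auto simp: gpt_def)
  show "g = id" if "0 < t" "t < 1" "0 < t'" "t' < 1" "g \<in> Sym 3" "ract g (gpt ?e t) = gpt ?e t'" for t t' g
  proof -
    have "gpt (f, g, perm f \<circ> g, N f) t = gpt ?e t'" using that ract_gpt[of g f id "perm f"] by simp
    from fun_cong[OF this, of "Inr ?e"] show ?thesis
      using that by (auto simp: gpt_def split: if_splits)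
  qed
  show "continuous_on (gpt ?e ` {0..1}) (\<lambda>z. z (Inl (perm f)))"
    by (rule continuous_on_subset[OF continuous_on_product_coordinates]) simp
  show "gpt ?e t (Inl (perm f)) = t" if "0 \<le> t" "t \<le> 1" for t
    using nid by (simp add: gpt_def)
qed (use gact_ract ginv_R closed_R continuous_gpt closed_gpt in auto)

lemma path_component_gpt:
  assumes "(f, x, y, k) \<in> orbit_edges N" "0 \<le> t" "t \<le> 1"
  shows "path_component (R N) (gvert x) (gpt (f, x, y, k) t)"
  unfolding path_component_def
proof (intro exI conjI)
  let ?p = "\<lambda>s. gpt (f, x, y, k) (s * t)"
  have st: "s * t \<in> {0..1}" if "s \<in> {0..1}" for s using assms that by (auto simp: mult_le_one)
  show "path ?p" unfolding path_def
    by (rule continuous_on_compose2[OF continuous_gpt[of UNIV]]) (auto intro!: continuous_intros)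
  show "path_image ?p \<subseteq> R N"
    using assms(1) st unfolding path_image_def R_def by blast
qed (auto simp: pathstart_def pathfinish_def gpt_ends)

lemma path_component_perm:
  assumes "f < 3" "0 < N f" "x \<in> Sym 3"
  shows "path_component (R N) (gvert x) (gvert (perm f \<circ> x))"
  using path_component_gpt[of f x "perm f \<circ> x" 0 N 1] assms
  by (simp add: gpt_ends) (auto simp: orbit_edges_def)

text \<open>The transpositions \<open>perm 1\<close> and \<open>perm 2\<close> generate the
  symmetric group, so one orbit of edges in each of these families connects all six
  vertices.\<close>

lemma path_component_R_gvert:
  assumes N: "0 < N 1" "0 < N 2" and "x \<in> Sym 3"
  shows "path_component (R N) (gvert id) (gvert x)"
proof -
  let ?c = "\<lambda>x y. path_component (R N) (gvert x) (gvert y)"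
  have s: "x \<in> Sym 3" if "x \<in> G3_vertices" for x using that G3_vertices by simp
  have p: "?c (pv i j k) (pv (perm f i) (perm f j) (perm f k))" if "pv i j k \<in> G3_vertices" "f < 3" "0 < N f" for f i j k
    using path_component_perm[of f N "pv i j k", OF that(2,3) s[OF that(1)]] unfolding comp_pv[OF perm_in_Sym3] .
  have "id = pv 0 1 2" by (rule ext) (auto simp: pv_def)
  have 1: "?c (pv 0 1 2) (pv 1 0 2)" "?c (pv 0 2 1) (pv 1 2 0)" "?c (pv 2 0 1) (pv 2 1 0)"
    using p[of 0 1 2 1] p[of 0 2 1 1] p[of 2 0 1 1] N by (simp_all add: G3_vertices_def perm_def)
  have 2: "?c (pv 0 1 2) (pv 0 2 1)" "?c (pv 1 0 2) (pv 2 0 1)"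
    using p[of 0 1 2 2] p[of 1 0 2 2] N by (simp_all add: G3_vertices_def perm_def)
  have "?c (pv 0 1 2) y" if "y \<in> G3_vertices" for y
    using that 1 2 path_component_trans[OF 2(1) 1(2)] path_component_trans[OF 1(1) 2(2)]
      path_component_trans[OF path_component_trans[OF 1(1) 2(2)] 1(3)]
      path_component_refl[of "gvert (pv 0 1 2)" "R N"] s
    unfolding G3_vertices_def by (auto simp: R_def)
  then show ?thesis using assms(3) G3_vertices \<open>id = pv 0 1 2\<close> by simp
qed

lemma path_component_R:
  assumes N: "0 < N 1" "0 < N 2" and z: "z \<in> R N" "z' \<in> R N"
  shows "path_component (R N) z z'"
proof -
  have c: "path_component (R N) (gvert id) z" if zN: "z \<in> R N" for z
  proof -
    consider x where "x \<in> Sym 3" "z = gvert x" | e t where "e \<in> orbit_edges N" "t \<in> {0..1}" "z = gpt e t"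
      using zN unfolding R_def by blast
    then show ?thesis
    proof cases
      case 1
      then show ?thesis using path_component_R_gvert[OF N] by simp
    next
      case 2
      obtain f x k where e: "e = (f, x, perm f \<circ> x, k)" "x \<in> Sym 3"
        using 2(1) unfolding orbit_edges_def by blast
      have "path_component (R N) (gvert x) z" using path_component_gpt 2 unfolding e(1) by simp
      then show ?thesis using path_component_trans[OF path_component_R_gvert[OF N e(2)]] by blast
    qed
  qed
  show ?thesis by (rule path_component_trans[OF path_component_sym[OF c[OF z(1)]] c[OF z(2)]])
qed

lemma G3_action_ract: "G3_action V E ract"
  unfolding G3_action_def G3_real G3_edges G3_vertices
proof (intro conjI ballI allI impI)
  fix g assume g: "g \<in> Sym 3"
  show "ract g ` R (fam_mult V E) \<subseteq> R (fam_mult V E)"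
    using ginv_R g unfolding ginv_def by blast
next
  fix g f x y k assume g: "g \<in> Sym 3" and e: "(f, x, y, k) \<in> orbit_edges (fam_mult V E)"
  show "\<exists>k'. (f, x \<circ> g, y \<circ> g, k') \<in> orbit_edges (fam_mult V E) \<and>
       (\<forall>t\<in>{0..1}. ract g (gpt (f, x, y, k) t) = gpt (f, x \<circ> g, y \<circ> g, k') t)"
    using orbit_edges_act[OF e g] ract_gpt[OF g] by blast
qed (use gact_ract ract_gvert in \<open>auto simp: gact_def\<close>)

section \<open>The configuration complex of a tree\<close>

lemma bdryI: "e \<in> s \<Longrightarrow> card e = 2 \<Longrightarrow> v \<in> e \<Longrightarrow> insert {v} (s - {e}) \<in> bdry s"
  unfolding bdry_def by blast

text \<open>The point to check is that the faces of \<open>a\<close> are present: such a face arises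
  from a face of \<open>s\<close> that still has the edge \<open>{u, w}\<close> by moving this edge
  to \<open>w\<close>.\<close>

lemma cplx_expand:
  assumes L: "cplx n L" and s: "config n s" "{u, w} \<in> s" "u \<noteq> w"
    and a: "a = insert {w} (s - {{u, w}})" "bdry s - {a} \<subseteq> L"
  shows "cplx n (insert s (insert a L))"
proof -
  have c2: "card {u, w} = 2" using s(3) by simp
  have ab: "a \<in> bdry s" unfolding a(1) by (rule bdryI[OF s(2) c2]) simp
  have ea: "{u, w} \<notin> a" using s(3) a(1) by auto
  have "bdry a \<subseteq> L"
  proof
    fix t assume "t \<in> bdry a"
    then obtain e v where e: "e \<in> a" "card e = 2" "v \<in> e" "t = insert {v} (a - {e})" by (auto simp: bdry_def)
    have ne: "e \<noteq> {w}" "e \<noteq> {u, w}" using e(1,2) ea by auto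
    then have es: "e \<in> s" using e(1) a(1) by auto
    let ?s = "insert {v} (s - {e})"
    have "{u, w} \<in> ?s" using s(2) ne by auto
    then have "?s \<in> L" using a(2) es e(2,3) ea by (auto simp: bdry_def)
    moreover have "{v} \<noteq> {u, w}" using s(3) by auto
    then have "t = insert {w} (?s - {{u, w}})" using e(4) a(1) ne by auto
    then have "t \<in> bdry ?s" using bdryI[OF \<open>{u, w} \<in> ?s\<close> c2, of w] by simp
    ultimately show "t \<in> L" using L by (auto simp: cplx_def)
  qed
  moreover have "config n a" using config_bdry[OF s(1) ab] .
  ultimately show ?thesis using L s(1) a(2) by (auto simp: cplx_def)
qed

text \<open>The base configuration \<open>v\<close> fixes which components correspond to which
  vertices of the graph. This is needed as long as the complex is disconnected, to decide to which
  family a new arc belongs.\<close>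

definition models :: "(nat \<Rightarrow> nat) \<Rightarrow> nat set set set \<Rightarrow> (nat \<Rightarrow> nat) \<Rightarrow> bool" where
  "models v K N \<longleftrightarrow> (\<exists>f h. geqv (geom K) conf_act (R N) ract f h \<and>
     path_component (R N) (f (vpt v)) (gvert id))"

lemma geom_mono: "K \<subseteq> L \<Longrightarrow> geom K \<subseteq> geom L"
  by (auto simp: geom_def Ord_def)

lemma models_expand:
  assumes M: "models v L N" "vpt v \<in> geom L" and L: "cplx 3 L" "finite L"
    and s: "config 3 s" "{u, w} \<in> s" "u \<noteq> w"
    and a: "a = insert {w} (s - {{u, w}})" "s \<notin> L" "a \<notin> L" "bdry s - {a} \<subseteq> L"
  shows "models v (insert s (insert a L)) N"
proof -
  obtain f h where f: "geqv (geom L) conf_act (R N) ract f h" "path_component (R N) (f (vpt v)) (gvert id)"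
    using M(1) by (auto simp: models_def)
  obtain r where r: "geqv (geom (insert s (insert a L))) conf_act (geom L) conf_act r id"
      "\<And>x. x \<in> geom L \<Longrightarrow> r x = x"
    using expansion_geom[OF L s a] by blast
  have "geqv (geom (insert s (insert a L))) conf_act (R N) ract (f \<circ> r) (id \<circ> h)"
    by (rule geqv_trans[OF ginv_geom ginv_geom ginv_R r(1) f(1)])
  moreover have "(f \<circ> r) (vpt v) = f (vpt v)" using r(2)[OF M(2)] by simp
  ultimately show ?thesis using f(2) unfolding models_def by metis
qed

lemma path_component_image:
  assumes "path_component A x y" "continuous_on A f" "f ` A \<subseteq> B"
  shows "path_component B (f x) (f y)"
proof -
  obtain p where "path p" "path_image p \<subseteq> A" "pathstart p = x" "pathfinish p = y"
    using assms(1) by (auto simp: path_component_def)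
  then show ?thesis
    using path_in_image[of p A f B] assms(2,3) unfolding path_component_def
    by (intro exI[of _ "f \<circ> p"]) (auto simp: pathstart_compose pathfinish_compose)
qed

lemma vpt_cong: "(\<And>j. j < 3 \<Longrightarrow> p j = q j) \<Longrightarrow> vpt p = vpt q"
  by (intro ext) (auto simp: vpt_def)

lemma conf_act_vpt: "g \<in> Sym 3 \<Longrightarrow> conf_act g (vpt v) = vpt (v \<circ> g)"
proof -
  assume "g \<in> Sym 3"
  then have "g j < 3 \<longleftrightarrow> j < 3" for j using permutes_in_image[of g "{..<3}" j] by (simp add: Sym3)
  then show ?thesis by (intro ext) (simp add: conf_act_def vpt_def)
qed

text \<open>By \<open>arc_geqv\<close> it suffices that the ends of the arc map to the components of
  the identity and of \<open>perm f\<close>. Either the graph is connected already, or the ends are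
  joined to \<open>v\<close> and to its translate under \<open>perm f\<close>, and equivariance
  gives the image of the latter.\<close>

lemma models_arc:
  assumes M: "models v L N" "vpt v \<in> geom L" and f: "f < 3"
    and L: "cplx 3 L" "finite L" and i: "i < 3" and pq: "p i \<noteq> q i" "\<And>j. j < 3 \<Longrightarrow> j \<noteq> i \<Longrightarrow> p j = q j"
    and s: "s = (\<lambda>j. {p j, q j}) ` {..<3}" "config 3 s" "s \<notin> L"
    and faces: "(\<lambda>v. {v}) ` p ` {..<3} \<in> L" "(\<lambda>v. {v}) ` q ` {..<3} \<in> L"
    and conn: "(0 < N 1 \<and> 0 < N 2) \<or>
      (path_component (geom L) (vpt p) (vpt v) \<and> path_component (geom L) (vpt q) (vpt (v \<circ> perm f)))"
  shows "models v (insert s L) (N(f := Suc (N f)))"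
proof -
  obtain F h where F: "geqv (geom L) conf_act (R N) ract F h" and base: "path_component (R N) (F (vpt v)) (gvert id)"
    using M(1) by (auto simp: models_def)
  have Fd: "continuous_on (geom L) F" "F ` geom L \<subseteq> R N"
      "\<And>g x. g \<in> Sym 3 \<Longrightarrow> x \<in> geom L \<Longrightarrow> F (conf_act g x) = ract g (F x)"
    using F by (auto simp: geqv_def gmap_def)
  have arc: "arc conf_act (geom (insert s L)) (geom L) (seg p q) (\<lambda>x. x i (q i))"
    by (rule arc_geom[OF L i pq(1) _ s faces]) (rule pq(2))
  have ends: "vpt p \<in> geom L" "vpt q \<in> geom L" using arc.ends[OF arc] by simp_all
  have "path_component (R N) (F (vpt p)) (gvert id) \<and> path_component (R N) (F (vpt q)) (gvert (perm f))"
    using conn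
  proof (elim disjE conjE)
    assume N: "0 < N 1" "0 < N 2"
    have "gvert g \<in> R N" if "g \<in> Sym 3" for g using that by (simp add: R_def)
    then show ?thesis using path_component_R[OF N] Fd(2) ends Sym_id perm_in_Sym3 by (simp add: image_subset_iff)
  next
    assume c: "path_component (geom L) (vpt p) (vpt v)" "path_component (geom L) (vpt q) (vpt (v \<circ> perm f))"
    have "path_component (R N) (F (vpt p)) (gvert id)"
      using path_component_trans[OF path_component_image[OF c(1) Fd(1,2)] base] .
    moreover have "F (vpt (v \<circ> perm f)) = ract (perm f) (F (vpt v))"
      using Fd(3)[OF perm_in_Sym3 M(2)] by (simp add: conf_act_vpt[OF perm_in_Sym3])
    moreover have "path_component (R N) (ract (perm f) (F (vpt v))) (ract (perm f) (gvert id))"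
    proof (rule path_component_image[OF base])
      show "continuous_on (R N) (ract (perm f))"
        using gact_ract perm_in_Sym3 by (auto simp: gact_def intro: continuous_on_subset)
      show "ract (perm f) ` R N \<subseteq> R N" using ginv_R perm_in_Sym3 by (auto simp: ginv_def)
    qed
    ultimately show ?thesis
      using path_component_trans[OF path_component_image[OF c(2) Fd(1,2)]] by (simp add: ract_gvert[OF perm_in_Sym3])
  qed
  then have "path_component (R N) (F (seg p q 0)) (gpt (f, id, perm f, N f) 0)"
      "path_component (R N) (F (seg p q 1)) (gpt (f, id, perm f, N f) 1)"
    by (simp_all add: gpt_ends)
  from arc_geqv[OF arc arc_R[OF f, of N] F, OF this] obtain F' h' where
    F': "geqv (geom (insert s L)) conf_act (R (N(f := Suc (N f)))) ract F' h'" "\<And>x. x \<in> geom L \<Longrightarrow> F' x = F x"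
    by blast
  have "R N \<subseteq> R (N(f := Suc (N f)))" using orbit_edges_Suc[OF f, of N] by (auto simp: R_def)
  then have "path_component (R (N(f := Suc (N f)))) (F' (vpt v)) (gvert id)"
    using base F'(2)[OF M(2)] path_component_of_subset by metis
  then show ?thesis using F'(1) by (auto simp: models_def)
qed

text \<open>An enumeration of the cell with the edge at position \<open>i\<close>; replacing the
  edge by one of its ends gives \<open>p\<close> and \<open>q\<close>.\<close>

lemma arc_ordering:
  assumes s: "config 3 s" "{u, w} \<in> s" "u \<noteq> w" "\<And>c. c \<in> s \<Longrightarrow> c \<noteq> {u, w} \<Longrightarrow> card c = 1"
  shows "\<exists>(p :: nat \<Rightarrow> nat) q i. i < 3 \<and> p i \<noteq> q i \<and> (\<forall>j<3. j \<noteq> i \<longrightarrow> p j = q j) \<and>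
    s = (\<lambda>j. {p j, q j}) ` {..<3} \<and> (\<lambda>v. {v}) ` p ` {..<3} \<in> bdry s \<and> (\<lambda>v. {v}) ` q ` {..<3} \<in> bdry s"
proof -
  have "finite s" "card s = 3" using s(1) config_finite(2)[OF s(1)] by (auto simp: config_def)
  then obtain b where b: "bij_betw b {..<3::nat} s"
    using ex_bij_betw_nat_finite[of s] by (auto simp: atLeast0LessThan)
  then have bs: "b ` {..<3} = s" and inj: "inj_on b {..<3}" by (auto simp: bij_betw_def)
  have "{u, w} \<in> b ` {..<3}" using s(2) bs by simp
  then obtain i where i: "i < 3" "b i = {u, w}" by (metis imageE lessThan_iff)
  define r where "r x j = (if j = i then x else the_elem (b j))" for x j
  have sing: "b j = {r x j}" if "j < 3" "j \<noteq> i" for j x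
  proof -
    have "b j \<in> s" "b j \<noteq> {u, w}" using that i bs inj by (auto simp: inj_on_def)
    then have "card (b j) = 1" using s(4) by simp
    then obtain y where "b j = {y}" by (meson card_1_singletonE)
    then show ?thesis using that(2) by (simp add: r_def)
  qed
  have b_eq: "b j = {r u j, r w j}" if "j < 3" for j
    using sing[OF that] i(2) that by (cases "j = i") (auto simp: r_def)
  have rest: "b ` ({..<3} - {i}) = s - {{u, w}}"
    using inj_on_image_set_diff[OF inj, of "{..<3}" "{i}"] i bs by simp
  have "(\<lambda>v. {v}) ` r x ` {..<3} \<in> bdry s" if x: "x \<in> {u, w}" for x
  proof -
    have "(\<lambda>v. {v}) ` r x ` {..<3} = insert {x} ((\<lambda>j. {r x j}) ` ({..<3} - {i}))"
      using i(1) by (auto simp: r_def image_image)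
    also have "(\<lambda>j. {r x j}) ` ({..<3} - {i}) = b ` ({..<3} - {i})"
      by (rule image_cong) (use sing in auto)
    finally have "(\<lambda>v. {v}) ` r x ` {..<3} = insert {x} (s - {{u, w}})" unfolding rest .
    then show ?thesis using bdryI[OF s(2) _ x] s(3) by simp
  qed
  moreover have "s = (\<lambda>j. {r u j, r w j}) ` {..<3}" using bs b_eq by (metis (no_types, lifting) image_cong lessThan_iff)
  ultimately show ?thesis
    using i(1) s(3) by (intro exI[of _ "r u"] exI[of _ "r w"] exI[of _ i]) (simp add: r_def)
qed

text \<open>Once families 1 and 2 are inhabited, it does not matter how the orbits of edges are
  distributed over the families. Quantifying over all distributions of the total spares any decision
  about where an arc goes.\<close>

definition full :: "(nat \<Rightarrow> nat) \<Rightarrow> nat set set set \<Rightarrow> nat \<Rightarrow> bool" where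
  "full v K m \<longleftrightarrow> (\<forall>N. 0 < N 1 \<longrightarrow> 0 < N 2 \<longrightarrow> N 0 + N 1 + N 2 = m \<longrightarrow> models v K N)"

text \<open>Two uses in one induction: without arcs every model persists, connected or not; with
  arcs the quantified form \<open>full\<close> is needed, which presupposes connected
  graphs.\<close>

lemma builds_models_aux:
  assumes "builds K n L" "cplx 3 K" "finite K" "\<And>s. s \<in> L \<Longrightarrow> config 3 s" "vpt v \<in> geom K"
  shows "cplx 3 L \<and> finite L \<and> (n = 0 \<longrightarrow> models v K N \<longrightarrow> models v L N) \<and>
    (2 \<le> m \<longrightarrow> full v K m \<longrightarrow> full v L (m + n))"
  using assms
proof (induction rule: builds.induct)
  case builds_refl
  then show ?case by simp
next
  case (builds_expand n L u w s a)
  have IH: "cplx 3 L" "finite L" "n = 0 \<Longrightarrow> models v K N \<Longrightarrow> models v L N"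
      "2 \<le> m \<Longrightarrow> full v K m \<Longrightarrow> full v L (m + n)"
    using builds_expand.IH builds_expand.prems by auto
  have s: "config 3 s" using builds_expand.prems(3) by simp
  have v: "vpt v \<in> geom L" using builds_expand.prems(4) geom_mono[OF builds_mono[OF builds_expand.hyps(1)]] by blast
  have e: "models v L N' \<Longrightarrow> models v (insert s (insert a L)) N'" for N'
    by (rule models_expand[OF _ v IH(1,2) s builds_expand.hyps(2-7)])
  show ?case
    using cplx_expand[OF IH(1) s builds_expand.hyps(2-4,7)] IH(2-4) e by (auto simp: full_def)
next
  case (builds_arc n L u w s)
  have IH: "cplx 3 L" "finite L" "2 \<le> m \<Longrightarrow> full v K m \<Longrightarrow> full v L (m + n)"
    using builds_arc.IH builds_arc.prems by auto
  have s: "config 3 s" using builds_arc.prems(3) by simp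
  have v: "vpt v \<in> geom L" using builds_arc.prems(4) geom_mono[OF builds_mono[OF builds_arc.hyps(1)]] by blast
  have "\<exists>(p :: nat \<Rightarrow> nat) q i. i < 3 \<and> p i \<noteq> q i \<and> (\<forall>j<3. j \<noteq> i \<longrightarrow> p j = q j) \<and>
      s = (\<lambda>j. {p j, q j}) ` {..<3} \<and> (\<lambda>v. {v}) ` p ` {..<3} \<in> bdry s \<and> (\<lambda>v. {v}) ` q ` {..<3} \<in> bdry s"
    by (rule arc_ordering[OF s builds_arc.hyps(2,3)]) (rule builds_arc.hyps(4))
  then obtain p q :: "nat \<Rightarrow> nat" and i :: nat where pq: "i < 3" "p i \<noteq> q i" "\<forall>j<3. j \<noteq> i \<longrightarrow> p j = q j"
    "s = (\<lambda>j. {p j, q j}) ` {..<3}" "(\<lambda>v. {v}) ` p ` {..<3} \<in> bdry s" "(\<lambda>v. {v}) ` q ` {..<3} \<in> bdry s"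
    by blast
  have faces: "(\<lambda>v. {v}) ` p ` {..<3} \<in> L" "(\<lambda>v. {v}) ` q ` {..<3} \<in> L"
    using pq(5,6) builds_arc.hyps(6) by auto
  have "full v (insert s L) (m + Suc n)" if m: "2 \<le> m" "full v K m"
    unfolding full_def
  proof (intro allI impI)
    fix N :: "nat \<Rightarrow> nat" assume N: "0 < N 1" "0 < N 2" "N 0 + N 1 + N 2 = m + Suc n"
    \<comment> \<open>The total is at least 3, so some family can give up an edge while families 1
      and 2 keep one each. The new arc takes the place of this edge.\<close>
    then have "0 < N 0 \<or> 1 < N 1 \<or> 1 < N 2" using m(1) by linarith
    then obtain f where f: "f < 3" "0 < N f" "0 < (N(f := N f - 1)) 1" "0 < (N(f := N f - 1)) 2"
    proof (elim disjE)
      assume "0 < N 0" then show ?thesis using that[of 0] N by simp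
    next
      assume "1 < N 1" then show ?thesis using that[of 1] N by simp
    next
      assume "1 < N 2" then show ?thesis using that[of 2] N by simp
    qed
    let ?N = "N(f := N f - 1)"
    have "f = 0 \<or> f = 1 \<or> f = 2" using f(1) by (rule less3_cases)
    then have "?N 0 + ?N 1 + ?N 2 = m + n" using N f(2) by auto
    then have "models v L ?N" using IH(3)[OF m] f(3,4) by (simp add: full_def)
    then have "models v (insert s L) (?N(f := Suc (?N f)))"
      by (rule models_arc[OF _ v f(1) IH(1,2) pq(1,2) _ pq(4) s builds_arc.hyps(5) faces]) (use f pq(3) in auto)
    then show "models v (insert s L) N" using f(2) by simp
  qed
  moreover have "cplx 3 (insert s L)" using IH(1) s builds_arc.hyps(6) by (auto simp: cplx_def)
  ultimately show ?case using IH(2) by simp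
qed

lemma builds_models:
  assumes "builds K 0 L" "cplx 3 K" "finite K" "cplx 3 L" "vpt v \<in> geom K" "models v K N"
  shows "models v L N"
  using builds_models_aux[of K 0 L v N] assms by (auto simp: cplx_def)

lemma builds_full:
  assumes "builds K n L" "cplx 3 K" "finite K" "cplx 3 L" "vpt v \<in> geom K" "full v K m" "2 \<le> m"
  shows "full v L (m + n)"
  using builds_models_aux[of K n L v _ m] assms by (auto simp: cplx_def)

section \<open>The star and the first two orbits of arcs\<close>

lemma Sym3_eqI: "p \<in> Sym 3 \<Longrightarrow> g \<in> Sym 3 \<Longrightarrow> (\<And>j. j < 3 \<Longrightarrow> p j = g j) \<Longrightarrow> p = g"
  by (metis Sym3_eq_pv zero_less_numeral one_less_numeral_iff semiring_norm(77) numeral_less_iff semiring_norm(81) lessI numeral_3_eq_3 numeral_2_eq_2)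

lemma Ord_vertices:
  assumes "inj_on v {..<3::nat}"
  shows "Ord {(\<lambda>j. {v j}) ` {..<3}} = (\<lambda>g j. if j < 3 then {v (g j)} else {}) ` Sym 3"
proof -
  let ?b = "\<lambda>j::nat. if j < 3 then {v j} else {}"
  have b: "?b \<in> Ord {(\<lambda>j. {v j}) ` {..<3}}" using assms by (auto simp: Ord_def inj_on_def)
  have "?b \<circ> g = (\<lambda>j. if j < 3 then {v (g j)} else {})" if "g \<in> Sym 3" for g
  proof -
    have lt: "g j < 3 \<longleftrightarrow> j < 3" for j using that permutes_in_image[of g "{..<3}" j] by (simp add: Sym3)
    show ?thesis by (rule ext) (simp add: lt)
  qed
  moreover have "Ord {(\<lambda>j. {v j}) ` {..<3}} = (\<lambda>g. ?b \<circ> g) ` Sym 3"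
    using Ord_comp[OF b] Ord_transitive[OF b] by blast
  ultimately show ?thesis by simp
qed

text \<open>Both sides are the symmetric group as a discrete set: the orbit of a configuration of
  three distinct vertices, and the graph without edges.\<close>

lemma models_vertices:
  assumes v: "inj_on v {..<3::nat}"
  shows "models v {(\<lambda>j. {v j}) ` {..<3}} (\<lambda>_. 0)" "vpt v \<in> geom {(\<lambda>j. {v j}) ` {..<3}}"
proof -
  let ?X = "geom {(\<lambda>j. {v j}) ` {..<3}}" and ?R = "R (\<lambda>_. 0)"
  have pb: "pbox (\<lambda>j. if j < 3 then {v (g j)} else {}) = {vpt (v \<circ> g)}" for g
  proof -
    have "x = vpt (v \<circ> g)" if x: "\<And>j. j < 3 \<Longrightarrow> x j (v (g j)) = 1 \<and> (\<forall>k. k \<noteq> v (g j) \<longrightarrow> x j k = 0)"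
      "\<And>j. j \<ge> 3 \<Longrightarrow> x j = (\<lambda>_. 0)" for x
    proof (intro ext)
      fix j k show "x j k = vpt (v \<circ> g) j k"
        using x(1)[of j] x(2)[of j] by (cases "j < 3"; cases "k = v (g j)") (auto simp: vpt_def)
    qed
    then show ?thesis by (auto simp: pbox_def closed_cell_vertex) (auto simp: vpt_def)
  qed
  have X: "?X = (\<lambda>g. vpt (v \<circ> g)) ` Sym 3"
    unfolding geom_def Ord_vertices[OF v] using pb by auto
  have RX: "?R = gvert ` Sym 3" by (simp add: R_def orbit_edges_def)
  show vX: "vpt v \<in> ?X" unfolding X using Sym_id by (auto intro!: image_eqI[of _ _ id])
  have vinj: "p = g" if "p \<in> Sym 3" "g \<in> Sym 3" "vpt (v \<circ> p) = vpt (v \<circ> g)" for p g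
  proof (rule Sym3_eqI[OF that(1,2)])
    fix j :: nat assume j: "j < 3"
    have "vpt (v \<circ> p) j (v (p j)) = 1" using j by (simp add: vpt_def)
    then have "vpt (v \<circ> g) j (v (p j)) = 1" using that(3) by simp
    then have "v (p j) = v (g j)" using j by (simp add: vpt_def split: if_splits)
    moreover have "p j < 3" "g j < 3" using that j permutes_in_image[of _ "{..<3}" j] by (auto simp: Sym3)
    ultimately show "p j = g j" using v by (auto simp: inj_on_def)
  qed
  \<comment> \<open>The inverse \<open>h\<close> below is given by a linear formula in the vertex
    coordinates, so that its continuity can be checked coordinatewise.\<close>
  define f where "f x = (gvert (THE p. p \<in> Sym 3 \<and> x = vpt (v \<circ> p)) :: gidx \<Rightarrow> real)" for x
  define h where "h z = (\<lambda>j k. \<Sum>p\<in>Sym 3. z (Inl p) * vpt (v \<circ> p) j k)" for z :: "gidx \<Rightarrow> real"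
  have f: "f (vpt (v \<circ> g)) = gvert g" if "g \<in> Sym 3" for g
  proof -
    have "(THE p. p \<in> Sym 3 \<and> vpt (v \<circ> g) = vpt (v \<circ> p)) = g"
    proof (rule the_equality)
      show "p = g" if "p \<in> Sym 3 \<and> vpt (v \<circ> g) = vpt (v \<circ> p)" for p
        using vinj[of p g] that \<open>g \<in> Sym 3\<close> by simp
    qed (use that in simp)
    then show ?thesis by (simp add: f_def)
  qed
  have h: "h (gvert g) = vpt (v \<circ> g)" if "g \<in> Sym 3" for g
    using that finite_Sym[of 3] by (auto simp: h_def gvert_def if_distrib[of "\<lambda>x. x * _"] sum.delta cong: if_cong)
  have "finite ?X" unfolding X using finite_Sym by simp
  have gf: "gmap ?X conf_act ?R ract f"
    unfolding gmap_def
  proof (intro conjI ballI)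
    show "continuous_on ?X f" using \<open>finite ?X\<close> by (rule continuous_on_finite)
    show "f ` ?X \<subseteq> ?R" unfolding X RX using f by auto
    show "f (conf_act g x) = ract g (f x)" if "g \<in> Sym 3" "x \<in> ?X" for g x
      using that f Sym_comp[OF _ that(1)] unfolding X by (auto simp: conf_act_vpt ract_gvert comp_assoc)
  qed
  have gh: "gmap ?R ract ?X conf_act h"
    unfolding gmap_def
  proof (intro conjI ballI)
    have c: "continuous_on ?R (\<lambda>z. z (Inl p))" for p
      by (rule continuous_on_subset[OF continuous_on_product_coordinates]) simp
    show "continuous_on ?R h"
      unfolding h_def
    proof (rule continuous_on_coordinatewise_then_product)+
      show "continuous_on ?R (\<lambda>z. \<Sum>p\<in>Sym 3. z (Inl p) * vpt (v \<circ> p) j k)" for j k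
        by (intro continuous_on_sum continuous_on_mult c continuous_on_const)
    qed
    show "h ` ?R \<subseteq> ?X" unfolding X RX using h by auto
    show "h (ract g z) = conf_act g (h z)" if "g \<in> Sym 3" "z \<in> ?R" for g z
      using that h Sym_comp[OF _ that(1)] unfolding RX by (auto simp: conf_act_vpt ract_gvert comp_assoc)
  qed
  have "ghom ?X conf_act ?X conf_act (h \<circ> f) id"
    by (rule ghom_cong[OF ginv_geom gmap_ghom_refl[OF gmap_comp[OF gf gh]]]) (auto simp: X f h)
  moreover have "ghom ?R ract ?R ract (f \<circ> h) id"
    by (rule ghom_cong[OF ginv_R gmap_ghom_refl[OF gmap_comp[OF gh gf]]]) (auto simp: RX f h)
  ultimately have "geqv ?X conf_act ?R ract f h" using gf gh by (simp add: geqv_def)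
  moreover have "f (vpt v) = gvert id" using f[OF Sym_id] by simp
  then have "path_component ?R (f (vpt v)) (gvert id)"
    using path_component_refl[of "gvert id" ?R] Sym_id by (simp add: RX)
  ultimately show "models v {(\<lambda>j. {v j}) ` {..<3}} (\<lambda>_. 0)" by (auto simp: models_def)
qed

lemma D_3I:
  assumes "A \<in> cells_in E W" "B \<in> cells_in E W" "C \<in> cells_in E W"
    and "A \<inter> B = {}" "A \<inter> C = {}" "B \<inter> C = {}" "A \<noteq> {}" "B \<noteq> {}" "C \<noteq> {}"
  shows "{A, B, C} \<in> D E 3 W"
proof -
  have d: "disjnt A B" "disjnt A C" "disjnt B C" using assms(4-6) by (simp_all add: disjnt_def)
  have "A \<noteq> B" "A \<noteq> C" "B \<noteq> C" using assms(4-9) by auto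
  moreover have "pairwise disjnt {A, B, C}"
    unfolding pairwise_def using d d[THEN disjnt_sym] by blast
  ultimately show ?thesis using assms(1-3) by (simp add: D_def)
qed

text \<open>Three points on a star with four vertices leave one vertex free, so from
  \<open>{x}, {y}, {z}\<close> a single point can move to \<open>u\<close> and must return before
  another one moves. Each component is a tripod, and its three legs are expansions.\<close>

lemma builds_star:
  assumes E: "graph E" and d: "distinct [u, x, y, z]" and n: "nbrs E {u, x, y, z} u = {x, y, z}"
    and e: "edges_in E {x, y, z} = {}"
  shows "builds {{{x}, {y}, {z}}} 0 (D E 3 {u, x, y, z})"
proof -
  let ?W = "{u, x, y, z}"
  let ?K = "{{{x}, {y}, {z}}} :: nat set set set"
  define L where "L a b c M = insert {{a, u}, {b}, {c}} (insert {{u}, {b}, {c}} M)" for a b c :: nat and M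
  have b1: "builds M 0 (L a b c M)" if abc: "distinct [u, a, b, c]" "{{a}, {b}, {c}} \<in> M"
      "\<forall>t\<in>M. {a} \<in> t" for a b c M
    unfolding L_def
  proof (rule builds_expand[OF builds_refl, of a u])
    show "{a, u} \<in> {{a, u}, {b}, {c}}" "a \<noteq> u" using abc by auto
    have ne: "{b} \<noteq> {a, u}" "{c} \<noteq> {a, u}" using abc(1) by auto
    then show "{{u}, {b}, {c}} = insert {u} ({{a, u}, {b}, {c}} - {{a, u}})" by auto
    have "{a} \<notin> {{u}, {b}, {c}}" "{a} \<notin> {{a, u}, {b}, {c}}" using abc(1) by auto
    moreover have "t \<notin> M" if "{a} \<notin> t" for t using abc(3) that by blast
    ultimately show "{{a, u}, {b}, {c}} \<notin> M" "{{u}, {b}, {c}} \<notin> M" by simp_all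
    have "bdry {{b}, {c}} = {}" by (auto simp: bdry_def)
    moreover have "{a, u} \<notin> {{b}, {c}}" using ne by auto
    ultimately have "bdry {{a, u}, {b}, {c}} = {insert {v} {{b}, {c}} | v. v \<in> {a, u} \<and> card {a, u} = 2}"
      by (simp add: bdry_insert)
    then show "bdry {{a, u}, {b}, {c}} - {{{u}, {b}, {c}}} \<subseteq> M" using abc(2) by auto
  qed
  have cW: "cells_in E (?W - {u}) = {{x}, {y}, {z}}"
  proof -
    have "?W - {u} = {x, y, z}" using d by auto
    then show ?thesis using e by (simp add: cells_in_def)
  qed
  have uE: "{u, x} \<in> E" "{u, y} \<in> E" "{u, z} \<in> E" using n by (auto simp: nbrs_def)
  have eq: "D E 3 ?W = L z x y (L y x z (L x y z ?K))"
  proof (intro equalityI subsetI)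
    fix s assume s: "s \<in> D E 3 ?W"
    have s2: "t = {{x}, {y}} \<or> t = {{x}, {z}} \<or> t = {{y}, {z}}" if t: "t \<subseteq> {{x}, {y}, {z}}" "card t = 2" for t
    proof -
      obtain p q where pq: "t = {p, q}" "p \<noteq> q" using t(2) by (auto simp: card_2_iff)
      then have "p \<in> {{x}, {y}, {z}}" "q \<in> {{x}, {y}, {z}}" using t(1) by auto
      then show ?thesis using pq by (elim insertE emptyE) (simp_all add: insert_commute)
    qed
    show "s \<in> L z x y (L y x z (L x y z ?K))"
    proof (cases "u \<in> \<Union>s")
      case False
      have "c \<in> cells_in E (?W - {u})" if "c \<in> s" for c
      proof -
        have c: "c \<in> cells_in E ?W" using s that by (auto simp: D_def)
        have "c \<subseteq> ?W - {u}" using cells_in_subset[OF c] False that by blast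
        then show ?thesis using cells_in_iff[OF _ _ c] by blast
      qed
      then have "s \<subseteq> {{x}, {y}, {z}}" using cW by blast
      moreover have "card s = card {{x}, {y}, {z}}" using s d by (simp add: D_def)
      ultimately have "s = {{x}, {y}, {z}}" by (intro card_subset_eq) auto
      then show ?thesis by (simp add: L_def)
    next
      case True
      then obtain c where c: "c \<in> s" "u \<in> c" by blast
      have r: "s - {c} \<in> D E 2 (?W - c)" "s = insert c (s - {c})"
        using D_removeI[of s E 2 ?W c] s c by (simp_all add: numeral_3_eq_3 numeral_2_eq_2)
      have "cells_in E (?W - c) \<subseteq> cells_in E (?W - {u})" using c by (intro cells_in_mono) auto
      then have "s - {c} \<subseteq> {{x}, {y}, {z}}" "card (s - {c}) = 2" using r(1) cW by (auto simp: D_def)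
      note t = s2[OF this]
      have off: "v \<notin> c" if "{v} \<in> s - {c}" for v using D_not[OF r(1) that] by blast
      have "c \<in> cells_in E ?W" using s c by (auto simp: D_def)
      then consider "c = {u}" | "c \<in> edges_in E ?W" using c(2) by (auto simp: cells_in_def)
      then show ?thesis
      proof cases
        case 1
        from t r(2) have "s = insert c {{x}, {y}} \<or> s = insert c {{x}, {z}} \<or> s = insert c {{y}, {z}}" by metis
        then show ?thesis unfolding 1 L_def by (elim disjE) simp_all
      next
        case 2
        then obtain a where a: "c = {u, a}" "a \<noteq> u" using graph_edge[OF E _ c(2)] by (auto simp: edges_in_def)
        then have axyz: "a = x \<or> a = y \<or> a = z" using 2 by (auto simp: edges_in_def)
        have ca: "c = {a, u}" "a \<in> c" using a(1) by auto
        from t show ?thesis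
        proof (elim disjE)
          assume t: "s - {c} = {{x}, {y}}"
          then have "a = z" using off[of x] off[of y] axyz ca(2) by auto
          then have "s = {{z, u}, {x}, {y}}" using r(2)[unfolded t] ca(1) by simp
          then show ?thesis by (simp add: L_def)
        next
          assume t: "s - {c} = {{x}, {z}}"
          then have "a = y" using off[of x] off[of z] axyz ca(2) by auto
          then have "s = {{y, u}, {x}, {z}}" using r(2)[unfolded t] ca(1) by simp
          then show ?thesis by (simp add: L_def)
        next
          assume t: "s - {c} = {{y}, {z}}"
          then have "a = x" using off[of y] off[of z] axyz ca(2) by auto
          then have "s = {{x, u}, {y}, {z}}" using r(2)[unfolded t] ca(1) by simp
          then show ?thesis by (simp add: L_def)
        qed
      qed
    qed
  next
    have cm: "{u} \<in> cells_in E ?W" "{x} \<in> cells_in E ?W" "{y} \<in> cells_in E ?W" "{z} \<in> cells_in E ?W"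
      "{x, u} \<in> cells_in E ?W" "{y, u} \<in> cells_in E ?W" "{z, u} \<in> cells_in E ?W"
      using uE by (auto simp: cells_in_def edges_in_def insert_commute)
    fix s assume "s \<in> L z x y (L y x z (L x y z ?K))"
    then show "s \<in> D E 3 ?W"
      unfolding L_def by (elim insertE emptyE; hypsubst; intro D_3I cm) (use d in simp_all)
  qed
  have s1: "builds ?K 0 (L x y z ?K)" using d by (intro b1) auto
  have s2: "builds (L x y z ?K) 0 (L y x z (L x y z ?K))"
    using d by (intro b1) (auto simp: L_def insert_commute)
  have s3: "builds (L y x z (L x y z ?K)) 0 (L z x y (L y x z (L x y z ?K)))"
    using d by (intro b1) (auto simp: L_def insert_commute)
  show ?thesis unfolding eq using builds_trans[OF s3 builds_trans[OF s2 s1]] by simp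
qed

text \<open>Two uses of \<open>builds_leaf\<close>, at \<open>l\<close> and then at
  \<open>c\<close>, reduce to one point near \<open>u\<close>. There the edge \<open>{u, a}\<close>
  is an expansion and \<open>{u, b}\<close> is held back, so the cell left out is
  \<open>{u, b}\<close> with \<open>l\<close> and \<open>c\<close> occupied.\<close>

lemma builds_stage:
  assumes E: "graph E" and W: "finite W" "c \<in> W" "nbrs E W c = {u}" "nbrs E (W - {c}) u = {a, b}" "a \<noteq> b"
    and l: "l \<notin> W" "nbrs E W l = {c}"
  shows "builds (D E 3 W) 0 (D E 3 (insert l W) - {{{l}, {c}, {u, b}}})"
proof -
  let ?W = "W - {c}"
  have u: "u \<in> W" "u \<noteq> c" using W(3) nbrs_not_self[OF E, of u W c] by (auto simp: nbrs_def)
  have b: "b \<in> W" "b \<noteq> c" "{u, b} \<in> E" "a \<in> W" using W(4) by (auto simp: nbrs_def)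
  have "c \<notin> nbrs E W c" by (rule nbrs_irrefl[OF E])
  then have nc: "nbrs E ?W c = {u}" using W(3) by (auto simp: nbrs_def)
  have R: "(\<lambda>v. {{u, v}}) ` (nbrs E ?W u - {a} - {}) = {{{u, b}}}" using W(4,5) by auto
  have "builds (D E (Suc 0) (?W - {u})) (card ({} :: nat set)) (D E (Suc 0) ?W - {{{u, b}}})"
    using builds_D_1[OF E, of ?W u a "{}"] W u unfolding R by auto
  moreover have ub: "{u, b} \<in> cells_in E ?W" using u b by (auto simp: cells_in_def edges_in_def)
  then have "{{u, b}} \<in> D E (Suc 0) ?W" "{{u, b}} \<notin> D E (Suc 0) (?W - {u})"
    by (auto simp: D_1 dest: cells_in_subset)
  ultimately have "builds (D E (Suc (Suc 0)) ?W) 0 (D E (Suc (Suc 0)) (insert c ?W) - insert {c} ` {{{u, b}}})"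
    using W u by (intro builds_leaf[OF E _ _ _ nc]) auto
  moreover have "insert c ?W = W" using W(2) by auto
  ultimately have b2: "builds (D E 2 ?W) 0 (D E 2 W - {{{c}, {u, b}}})" by (simp add: numeral_2_eq_2)
  have "{{c}, {u, b}} \<in> D E 2 W"
    using D_insertI(1)[of "{{u, b}}" E "Suc 0" ?W W "{c}"] ub W(2) by (auto simp: D_1 cells_in_def numeral_2_eq_2)
  moreover have "{{c}, {u, b}} \<notin> D E 2 ?W" using D_not[of "{{c}, {u, b}}" E 2 ?W "{c}"] by auto
  ultimately have "builds (D E (Suc 2) W) 0 (D E (Suc 2) (insert l W) - insert {l} ` {{{c}, {u, b}}})"
    using b2 by (intro builds_leaf[OF E W(1) l(1) W(2) l(2)]) auto
  then show ?thesis by (simp add: numeral_3_eq_3 numeral_2_eq_2)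
qed

definition place :: "nat \<Rightarrow> nat \<Rightarrow> 'a \<Rightarrow> 'a \<Rightarrow> 'a \<Rightarrow> nat \<Rightarrow> 'a" where
  "place i j x y z k = (if k = i then x else if k = j then y else z)"

text \<open>The remaining cell is an arc. Its ends are joined to \<open>v\<close> and to
  \<open>v\<close> with the points at \<open>a\<close> and \<open>b\<close> exchanged, since the
  branch of \<open>c\<close>, lengthened by \<open>l\<close>, gives room for a point to step aside.
  So the new arc realizes the transposition \<open>perm f\<close>.\<close>

lemma stage:
  assumes E: "graph E" and W: "finite W" "c \<in> W" "nbrs E W c = {u}" "nbrs E (W - {c}) u = {a, b}" "a \<noteq> b"
    and l: "l \<notin> W" "nbrs E W l = {c}"
    and ijk: "{i, j, k} = {..<3}" "i \<noteq> j" "i \<noteq> k" "j \<noteq> k" and f: "f < 3"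
    and v: "v i = c" "v j = b" "v k = a" "perm f i = i" "perm f j = k" "perm f k = j"
    and M: "models v (D E 3 W) N" "vpt v \<in> geom (D E 3 W)"
  shows "models v (D E 3 (insert l W)) (N(f := Suc (N f)))"
proof -
  let ?s = "{{l}, {c}, {u, b}}"
  let ?K = "D E 3 (insert l W) - {?s}"
  let ?p = "place i j l c u" and ?q = "place i j l c b"
  have u: "u \<in> W" "u \<noteq> c" using W(3) nbrs_not_self[OF E, of u W c] by (auto simp: nbrs_def)
  have ab: "a \<in> W" "b \<in> W" "a \<noteq> c" "b \<noteq> c" "{u, a} \<in> E" "{u, b} \<in> E" using W(4) by (auto simp: nbrs_def)
  have abu: "a \<noteq> u" "b \<noteq> u" using nbrs_not_self[OF E, of _ "W - {c}" u] W(4) by auto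
  have lc: "{l, c} \<in> E" "{c, u} \<in> E" using l(2) W(3) by (auto simp: nbrs_def)
  have ln: "l \<noteq> c" "l \<noteq> u" "l \<noteq> a" "l \<noteq> b" using l(1) W(2) u ab by auto
  note dist = u(2) ab(3,4) abu ln W(5)
  have lt: "i < 3" "j < 3" "k < 3" using ijk(1) by auto
  have j3: "m = i \<or> m = j \<or> m = k" if "m < 3" for m using ijk(1) that by (metis empty_iff insert_iff lessThan_iff)
  have pl [simp]: "place i j x y z i = x" "place i j x y z j = y" "place i j x y z k = z" for x y z :: 'x
    using ijk(2-4) by (simp_all add: place_def)
  have cl: "{x} \<in> cells_in E (insert l W)" if "x \<in> {l, c, u, a, b}" for x
    using that W(2) u ab by (auto simp: cells_in_def)
  have ce: "{l, c} \<in> cells_in E (insert l W)" "{c, u} \<in> cells_in E (insert l W)"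
     "{u, a} \<in> cells_in E (insert l W)" "{u, b} \<in> cells_in E (insert l W)"
    using lc ab u W(2) by (auto simp: cells_in_def edges_in_def)
  \<comment> \<open>The cell left out must not be a face of another one. In such a cell an edge
    disjoint from \<open>{u, b}\<close> would contain \<open>l\<close> or \<open>c\<close>, hence be
    \<open>{l, c}\<close>; but at least one of \<open>{l}\<close> and \<open>{c}\<close> would also
    remain as a cell, and it meets this edge.\<close>
  have cK: "cplx 3 ?K" "finite ?K"
  proof -
    have "?s \<notin> bdry t" if "t \<in> D E 3 (insert l W)" for t
    proof
      assume "?s \<in> bdry t"
      then obtain e x where e: "e \<in> t" "card e = 2" "x \<in> e" "?s = insert {x} (t - {e})" by (auto simp: bdry_def)
      have t: "pairwise disjnt t" "t \<subseteq> cells_in E (insert l W)" using that by (auto simp: D_def)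
      have "{u, b} \<in> insert {x} (t - {e})" unfolding e(4)[symmetric] by simp
      then have ub: "{u, b} \<in> t" "{u, b} \<noteq> e" using abu by auto
      have de: "{u, b} \<inter> e = {}" using pairwiseD[OF t(1) ub(1) e(1) ub(2)] by (simp add: disjnt_def)
      have "{x} \<in> ?s" unfolding e(4) by simp
      then have xs: "x = l \<or> x = c" using abu by auto
      have eE: "e \<in> E" "e \<subseteq> insert l W" using e(1,2) t(2) by (auto simp: cells_in_def edges_in_def)
      obtain x' where x': "e = {x, x'}" "x' \<noteq> x" using graph_edge[OF E eE(1) e(3)] by blast
      have "e = {l, c}"
        using xs
      proof
        assume "x = l"
        then have "x' \<in> nbrs E W l" using x' eE by (auto simp: nbrs_def)
        then show ?thesis using l(2) x' \<open>x = l\<close> by simp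
      next
        assume xc: "x = c"
        have "x' = l \<or> x' \<in> nbrs E W c" using x' eE xc by (auto simp: nbrs_def)
        then show ?thesis using W(3) x' xc de by auto
      qed
      have "{l} \<in> insert {x} (t - {e})" "{c} \<in> insert {x} (t - {e})" unfolding e(4)[symmetric] by simp_all
      then have "{l} \<in> t \<or> {c} \<in> t" using ln(1) by auto
      then obtain y where y: "{y} \<in> t" "y \<in> e" using \<open>e = {l, c}\<close> by auto
      have "{y} \<noteq> e" using e(2) by auto
      then have "disjnt {y} e" using pairwiseD[OF t(1) y(1) e(1)] by simp
      then show False using y(2) by simp
    qed
    then show "cplx 3 ?K" using cplx_D[OF E, of 3 "insert l W"] unfolding cplx_def by blast
    show "finite ?K" using finite_D W(1) by auto
  qed
  have move: "path_component (geom ?K) (vpt (place i j x y z)) (vpt (place i j x' y' z'))"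
    if K: "A \<in> cells_in E (insert l W)" "B \<in> cells_in E (insert l W)" "C \<in> cells_in E (insert l W)"
        "A \<inter> B = {}" "A \<inter> C = {}" "B \<inter> C = {}" "A \<notin> ?s \<or> B \<notin> ?s \<or> C \<notin> ?s"
      and x: "x \<in> A" "x' \<in> A" "y \<in> B" "y' \<in> B" "z \<in> C" "z' \<in> C" for A B C x y z x' y' z'
  proof (rule path_component_geom[OF cK(1)])
    let ?b = "\<lambda>m. if m < 3 then place i j A B C m else {}"
    have "A \<noteq> {}" "B \<noteq> {}" "C \<noteq> {}" using x by auto
    then have "{A, B, C} \<in> D E 3 (insert l W)" by (intro D_3I K)
    moreover have "{A, B, C} \<noteq> ?s" using K(7) by blast
    moreover have "?b ` {i, j, k} = {A, B, C}" using lt by simp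
    then have "?b ` {..<3} = {A, B, C}" using ijk(1) by simp
    moreover have "A \<noteq> B" "A \<noteq> C" "B \<noteq> C" using K(4-6) x by auto
    then have "inj_on ?b {i, j, k}" by (auto simp: inj_on_def lt)
    then have "inj_on ?b {..<3}" using ijk(1) by simp
    ultimately show "?b \<in> Ord ?K" by (simp add: Ord_def)
    show "place i j x y z m \<in> ?b m \<and> place i j x' y' z' m \<in> ?b m" if "m < 3" for m
      using j3[OF that] that x by (elim disjE) simp_all
  qed
  note dist' = dist dist[symmetric]
  let ?c = "\<lambda>p q. path_component (geom ?K) (vpt p) (vpt q)"
  have cz: "{z} \<in> cells_in E (insert l W)" "z \<noteq> l" "z \<noteq> c" "z \<noteq> u" if "z = a \<or> z = b" for z
    using that cl[of a] cl[of b] dist' by auto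
  \<comment> \<open>The moves from the ends of the arc: the point at \<open>u\<close> retreats to
    \<open>a\<close>; the point at \<open>c\<close> comes to \<open>u\<close>; the point at
    \<open>l\<close> follows to \<open>c\<close>; the point at \<open>u\<close> goes on to
    \<open>b\<close> or to \<open>a\<close>, whichever is free. The end with a point at
    \<open>b\<close> omits the first move.\<close>
  have 1: "?c (place i j l c u) (place i j l c a)"
    by (rule move[of "{l}" "{c}" "{u, a}"]) (use cl ce dist' in \<open>simp_all add: doubleton_eq_iff\<close>)
  have 2: "?c (place i j l c z) (place i j l u z)" if "z = a \<or> z = b" for z
    by (rule move[of "{l}" "{c, u}" "{z}"]) (use cl ce dist' cz[OF that] in \<open>simp_all add: doubleton_eq_iff\<close>)
  have 3: "?c (place i j l u z) (place i j c u z)" if "z = a \<or> z = b" for z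
    by (rule move[of "{l, c}" "{u}" "{z}"]) (use cl ce dist' cz[OF that] in \<open>simp_all add: doubleton_eq_iff\<close>)
  have 4: "?c (place i j c u a) (place i j c b a)"
    by (rule move[of "{c}" "{u, b}" "{a}"]) (use cl ce dist' in \<open>simp_all add: doubleton_eq_iff\<close>)
  have 5: "?c (place i j c u b) (place i j c a b)"
    by (rule move[of "{c}" "{u, a}" "{b}"]) (use cl ce dist' in \<open>simp_all add: doubleton_eq_iff\<close>)
  note tr = path_component_trans
  have P: "?c ?p v"
  proof -
    have "place i j c b a m = v m" if "m < 3" for m using j3[OF that] v(1-3) by (elim disjE) simp_all
    then have "vpt (place i j c b a) = vpt v" by (rule vpt_cong)
    then show ?thesis using tr[OF 1 tr[OF 2[of a] tr[OF 3[of a] 4]]] by simp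
  qed
  have Q: "?c ?q (v \<circ> perm f)"
  proof -
    have "place i j c a b m = (v \<circ> perm f) m" if "m < 3" for m using j3[OF that] v by (elim disjE) simp_all
    then have "vpt (place i j c a b) = vpt (v \<circ> perm f)" by (rule vpt_cong)
    then show ?thesis using tr[OF 2[of b] tr[OF 3[of b] 5]] by simp
  qed
  have b: "builds (D E 3 W) 0 ?K" by (rule builds_stage[OF E W l])
  have MK: "models v ?K N" by (rule builds_models[OF b cplx_D[OF E] finite_D[OF W(1)] cK(1) M(2,1)])
  have vK: "vpt v \<in> geom ?K" using geom_mono[OF builds_mono[OF b]] M(2) by blast
  have sD: "?s \<in> D E 3 (insert l W)" by (rule D_3I) (use cl ce dist' in simp_all)
  have img: "g ` {..<3} = {g i, g j, g k}" for g :: "nat \<Rightarrow> 'b" unfolding ijk(1)[symmetric] by simp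
  have "{u, b} \<notin> {{l}, {c}, {u}}" "{u, b} \<notin> {{l}, {c}, {b}}" using abu by auto
  moreover have "X \<noteq> ?s" if "{u, b} \<notin> X" for X using that by blast
  ultimately have ns: "{{l}, {c}, {u}} \<noteq> ?s" "{{l}, {c}, {b}} \<noteq> ?s" by metis+
  have fD: "{{l}, {c}, {u}} \<in> D E 3 (insert l W)" "{{l}, {c}, {b}} \<in> D E 3 (insert l W)"
    by (rule D_3I; use cl dist' in simp)+
  have "X \<in> A - {S}" if "X \<in> A" "X \<noteq> S" for X S :: "nat set set" and A using that by simp
  note faces = this[OF fD(1) ns(1)] this[OF fD(2) ns(2)]
  have "models v (insert ?s ?K) (N(f := Suc (N f)))"
  proof (rule models_arc[OF MK vK f cK, of k ?p ?q])
    show "k < 3" using lt by simp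
    show "?p k \<noteq> ?q k" using abu by simp
    show "?p m = ?q m" if "m < 3" "m \<noteq> k" for m using j3[OF that(1)] that(2) by auto
    show "?s = (\<lambda>j'. {?p j', ?q j'}) ` {..<3}" unfolding img by simp
    show "config 3 ?s" using sD cplx_D[OF E] by (auto simp: cplx_def)
    show "(\<lambda>v. {v}) ` ?p ` {..<3} \<in> ?K" "(\<lambda>v. {v}) ` ?q ` {..<3} \<in> ?K"
      unfolding img using faces by simp_all
    show "(0 < N 1 \<and> 0 < N 2) \<or> (?c ?p v \<and> ?c ?q (v \<circ> perm f))" using P Q by blast
  qed simp
  moreover have "insert ?s ?K = D E 3 (insert l W)" using sD by auto
  ultimately show ?thesis by simp
qed

section \<open>Identification with the discretized configuration space\<close>

lemma closed_cell_disjoint_iff: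
  assumes "finite c" "finite d"
  shows "closed_cell c \<inter> closed_cell d = {} \<longleftrightarrow> c \<inter> d = {}"
proof
  assume "closed_cell c \<inter> closed_cell d = {}"
  moreover have "(\<lambda>k. if k = v then 1 else 0) \<in> closed_cell c \<inter> closed_cell d" if "v \<in> c" "v \<in> d" for v
    using that assms by (auto simp: closed_cell_def)
  ultimately show "c \<inter> d = {}" by blast
next
  assume cd: "c \<inter> d = {}"
  have False if "x \<in> closed_cell c" "x \<in> closed_cell d" for x
  proof -
    have "x k = 0" if "k \<in> c" for k
      using cd that \<open>x \<in> closed_cell d\<close> by (auto simp: closed_cell_def)
    then have "sum x c = 0" by simp
    then show False using \<open>x \<in> closed_cell c\<close> by (simp add: closed_cell_def)
  qed
  then show "closed_cell c \<inter> closed_cell d = {}" by blast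
qed

lemma conf_cells_eq_Ord:
  assumes T: "finite_tree V E"
  shows "conf_cells 3 V E = Ord (D E 3 V)"
proof -
  note G = finite_tree_graph[OF T]
  have cells: "cells V E = cells_in E V" using G(3) by (auto simp: cells_def cells_in_def edges_in_def)
  have fin: "finite c" "c \<noteq> {}" if "c \<in> cells_in E V" for c
    using cells_in_card[OF G(2) that] card_ge_0_finite[of c] by auto
  show ?thesis
  proof (intro equalityI subsetI)
    fix a assume a: "a \<in> conf_cells 3 V E"
    have c: "a i \<in> cells_in E V" if "i < 3" for i using a that by (auto simp: conf_cells_def cells)
    have d: "a i \<inter> a j = {}" if "i < 3" "j < 3" "i \<noteq> j" for i j
      using a that closed_cell_disjoint_iff[OF fin(1)[OF c] fin(1)[OF c], of i j] by (auto simp: conf_cells_def)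
    have inj: "inj_on a {..<3}"
    proof (rule inj_onI)
      fix i j :: nat assume "i \<in> {..<3}" "j \<in> {..<3}" "a i = a j"
      then show "i = j" using d[of i j] fin(2)[OF c, of i] by (cases "i = j") auto
    qed
    moreover have "a ` {..<3} \<in> D E 3 V"
    proof -
      have "pairwise disjnt (a ` {..<3})"
        unfolding pairwise_def disjnt_def using d by auto
      then show ?thesis using c card_image[OF inj] by (auto simp: D_def)
    qed
    ultimately show "a \<in> Ord (D E 3 V)" using a by (auto simp: Ord_def conf_cells_def)
  next
    fix a assume a: "a \<in> Ord (D E 3 V)"
    have c: "a i \<in> cells_in E V" if "i < 3" for i using a that by (auto simp: Ord_def D_def)
    have "closed_cell (a i) \<inter> closed_cell (a j) = {}" if "i < 3" "j < 3" "i \<noteq> j" for i j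
    proof -
      have ne: "a i \<noteq> a j" and p: "pairwise disjnt (a ` {..<3})" using a that by (auto simp: Ord_def D_def inj_on_def)
      have "disjnt (a i) (a j)" by (rule pairwiseD[OF p _ _ ne]) (use that in auto)
      then show ?thesis
        using closed_cell_disjoint_iff[OF fin(1)[OF c[OF that(1)]] fin(1)[OF c[OF that(2)]]] by (simp add: disjnt_def)
    qed
    then show "a \<in> conf_cells 3 V E" using a c by (auto simp: conf_cells_def Ord_def cells)
  qed
qed

lemma DConf_eq_geom: "finite_tree V E \<Longrightarrow> DConf 3 V E = geom (D E 3 V)"
  unfolding DConf_def geom_def pbox_def conf_cells_eq_Ord ..

lemma three_elements:
  assumes "3 \<le> card A"
  obtains x y z where "x \<in> A" "y \<in> A" "z \<in> A" "x \<noteq> y" "x \<noteq> z" "y \<noteq> z"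
proof -
  obtain B where B: "B \<subseteq> A" "card B = 3" using assms by (meson obtain_subset_with_card_n)
  then obtain x y z where "B = {x, y, z}" "x \<noteq> y" "x \<noteq> z" "y \<noteq> z" by (auto simp: card_3_iff)
  then show ?thesis using that B(1) by auto
qed

lemma models_cong:
  assumes "\<And>f. f < 3 \<Longrightarrow> N f = N' f" "models v K N" shows "models v K N'"
proof -
  have "orbit_edges N = orbit_edges N'" using assms(1) by (auto simp: orbit_edges_def)
  then show ?thesis using assms(2) by (simp add: models_def R_def)
qed

theorem theorem4p3:
  fixes V :: "nat set" and E :: "nat set set"
  assumes "finite_tree V E"
    and "suff_subdivided 3 E"
    and "\<exists>v\<in>V. essential E v"
  shows "\<exists>act. G3_action V E act \<and>
           equiv_homotopy_equivalent (Sym 3)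
             (top_of_set (DConf 3 V E)) conf_act
             (top_of_set (G3_real V E)) act"
proof -
  note T = assms(1)
  note E = finite_tree_graph(2)[OF T] and fV = finite_tree_graph(1)[OF T] and F = finite_tree_forest[OF T]
  note sd = suff_subdivided_edge[OF T assms(2)]
  obtain u where u: "u \<in> V" "3 \<le> card (nbrs E V u)"
    using assms(3) deg_eq_card_nbrs[OF T] by (auto simp: essential_def)
  obtain x y z where xyz: "x \<in> nbrs E V u" "y \<in> nbrs E V u" "z \<in> nbrs E V u" "x \<noteq> y" "x \<noteq> z" "y \<noteq> z"
    using three_elements[OF u(2)] by blast
  have xyzV: "x \<in> V" "y \<in> V" "z \<in> V" "{u, x} \<in> E" "{u, y} \<in> E" "{u, z} \<in> E" using xyz by (auto simp: nbrs_def)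
  have xyzu: "x \<noteq> u" "y \<noteq> u" "z \<noteq> u" using xyz nbrs_not_self[OF E] by auto
  have deg2: "card (nbrs E V a) = 2" if "{u, a} \<in> E" for a using sd[OF that] u(2) by auto
  have other: "\<exists>l\<in>V. l \<noteq> u \<and> {a, l} \<in> E" if "{u, a} \<in> E" "a \<in> V" for a
  proof -
    have "\<not> nbrs E V a \<subseteq> {u}" using deg2[OF that(1)] card_mono[of "{u}" "nbrs E V a"] by auto
    then show ?thesis by (auto simp: nbrs_def)
  qed
  \<comment> \<open>All three branches of the star have to be lengthened before
    \<open>tree_growth\<close> can start, because a leaf next to \<open>u\<close> violates its
    invariant.\<close>
  obtain p q r where pqr: "p \<in> V" "q \<in> V" "r \<in> V" "p \<noteq> u" "q \<noteq> u" "r \<noteq> u" "{x, p} \<in> E" "{y, q} \<in> E" "{z, r} \<in> E"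
    using other xyzV by metis
  note grow = subtree_insert[OF E fV F]
  let ?W0 = "{u}" let ?W1 = "insert x ?W0" let ?W2 = "insert y ?W1" let ?W3 = "insert z ?W2"
  let ?W4 = "insert r ?W3" let ?W5 = "insert p ?W4" let ?W6 = "insert q ?W5"
  have "edges_in E {u} = {}" using E by (auto simp: edges_in_def graph_def subset_singleton_iff)
  then have st0: "subtree E ?W0" by (simp add: subtree_def)
  have n0: "nbrs E ?W0 u = {}" using nbrs_irrefl[OF E, of u ?W0] by (auto simp: nbrs_def)
  have V0: "?W0 \<subseteq> V" "?W1 \<subseteq> V" "?W2 \<subseteq> V" "?W3 \<subseteq> V" "?W4 \<subseteq> V" "?W5 \<subseteq> V" "?W6 \<subseteq> V" using u xyzV pqr by auto
  have x0: "x \<notin> ?W0" "u \<in> ?W0" using xyzu by auto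
  note g1 = grow[OF V0(1) st0 xyzV(1) x0 xyzV(4)]
  have n1: "nbrs E ?W1 u = {x}" "nbrs E ?W1 x = {u}" and st1: "subtree E ?W1"
    using g1(2,4,5) n0 by auto
  have y1: "y \<notin> ?W1" "u \<in> ?W1" using xyz xyzu by auto
  note g2 = grow[OF V0(2) st1 xyzV(2) y1 xyzV(5)]
  have n2: "nbrs E ?W2 u = {x, y}" "nbrs E ?W2 x = {u}" "nbrs E ?W2 y = {u}"
    using g2(3)[of x] g2(4,5) n1 xyzu by auto
  have z2: "z \<notin> ?W2" "u \<in> ?W2" using xyz xyzu by auto
  note g3 = grow[OF V0(3) g2(2) xyzV(3) z2 xyzV(6)]
  have n3: "nbrs E ?W3 u = {x, y, z}" "nbrs E ?W3 x = {u}" "nbrs E ?W3 y = {u}" "nbrs E ?W3 z = {u}"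
    using g3(3)[of x] g3(3)[of y] g3(4,5) n2 xyzu by auto
  have new: "l \<notin> W" if "nbrs E W a = {u}" "{a, l} \<in> E" "l \<noteq> u" for W a l
  proof
    assume "l \<in> W"
    then have "l \<in> nbrs E W a" using that(2) by (simp add: nbrs_def)
    then show False using that(1,3) by simp
  qed
  have r3: "r \<notin> ?W3" "z \<in> ?W3" using new[OF n3(4) pqr(9,6)] by simp_all
  note g4 = grow[OF V0(4) g3(2) pqr(3) r3 pqr(9)]
  have n4: "nbrs E ?W4 u = {x, y, z}" "nbrs E ?W4 x = {u}" "nbrs E ?W4 y = {u}" "nbrs E ?W4 z = {r, u}" "nbrs E ?W4 r = {z}"
    using g4(3)[of u] g4(3)[of x] g4(3)[of y] g4(4,5) n3 xyzu xyz(4-6) by auto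
  have p4: "p \<notin> ?W4" "x \<in> ?W4" using new[OF n4(2) pqr(7,4)] by simp_all
  note g5 = grow[OF V0(5) g4(2) pqr(1) p4 pqr(7)]
  have n5: "nbrs E ?W5 u = {x, y, z}" "nbrs E ?W5 x = {p, u}" "nbrs E ?W5 y = {u}" "nbrs E ?W5 z = {r, u}"
      "nbrs E ?W5 r = {z}" "nbrs E ?W5 p = {x}"
    using g5(3)[of u] g5(3)[of y] g5(3)[of z] g5(3)[of r] g5(4,5) n4 xyzu xyz(4-6) r3 by auto
  have q5: "q \<notin> ?W5" "y \<in> ?W5" using new[OF n5(3) pqr(8,5)] by simp_all
  note g6 = grow[OF V0(6) g5(2) pqr(2) q5 pqr(8)]
  have n6: "nbrs E ?W6 u = {x, y, z}" "nbrs E ?W6 x = {p, u}" "nbrs E ?W6 y = {q, u}" "nbrs E ?W6 z = {r, u}"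
      "nbrs E ?W6 r = {z}" "nbrs E ?W6 p = {x}" "nbrs E ?W6 q = {y}"
    using g6(3)[of u] g6(3)[of x] g6(3)[of z] g6(3)[of r] g6(3)[of p] g6(4,5) n5 xyzu xyz(4-6) r3 p4 by auto
  define v where "v m = (if m = 0 then x else if m = 1 then y else z)" for m :: nat
  have v: "v 0 = x" "v 1 = y" "v 2 = z" by (simp_all add: v_def)
  have vK: "(\<lambda>j. {v j}) ` {..<3} = {{x}, {y}, {z}}" by (simp add: lessThan3 v_def)
  have vinj: "inj_on v {..<3}" using xyz(4-6) by (simp add: lessThan3 v_def)
  have W3: "{u, x, y, z} = ?W3" by auto
  have star: "builds {{{x}, {y}, {z}}} 0 (D E 3 ?W3)"
  proof -
    have "card (edges_in E ?W3) = card (edges_in E (?W3 - {u})) + card (nbrs E ?W3 u)"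
      by (rule card_edges_in_remove[OF E]) auto
    moreover have "card ?W3 = 4" using xyz(4-6) xyzu by simp
    moreover have "card {x, y, z} = 3" using xyz(4-6) by simp
    moreover have "?W3 - {u} = {x, y, z}" using xyzu by auto
    ultimately have "card (edges_in E {x, y, z}) = 0" using g3(2) n3(1) by (simp add: subtree_def)
    moreover have "finite (edges_in E {x, y, z})" by (rule finite_subset[of _ "Pow {x, y, z}"]) (auto simp: edges_in_def)
    ultimately have "edges_in E {x, y, z} = {}" by simp
    then have "builds {{{x}, {y}, {z}}} 0 (D E 3 {u, x, y, z})"
      using xyz(4-6) xyzu n3(1) unfolding W3[symmetric] by (intro builds_star[OF E]) auto
    then show ?thesis unfolding W3 .
  qed
  have K0: "cplx 3 {{{x}, {y}, {z}}}" "finite {{{x}, {y}, {z}}}"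
    using xyz(4-6) by (auto simp: cplx_def config_def bdry_def pairwise_insert)
  have M0: "models v {{{x}, {y}, {z}}} (\<lambda>_. 0)" "vpt v \<in> geom {{{x}, {y}, {z}}}"
    using models_vertices[OF vinj] unfolding vK by auto
  have M3: "models v (D E 3 ?W3) (\<lambda>_. 0)" by (rule builds_models[OF star K0 cplx_D[OF E] M0(2,1)])
  have vW3: "vpt v \<in> geom (D E 3 ?W3)" using geom_mono[OF builds_mono[OF star]] M0(2) by blast
  have vW: "vpt v \<in> geom (D E 3 W)" if "?W3 \<subseteq> W" for W using geom_mono[OF D_mono[OF that]] vW3 by blast
  \<comment> \<open>Lengthening the branch of \<open>z\<close>, where position 2 sits, exchanges
    positions 0 and 1, which is \<open>perm 1\<close>.\<close>
  have M4: "models v (D E 3 ?W4) ((\<lambda>_. 0)(1 := Suc 0))"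
  proof -
    have "nbrs E (?W3 - {z}) u = {x, y}" using n3(1) xyz(5,6) by (auto simp: nbrs_def)
    then show ?thesis
      using stage[OF E _ _ n3(4) _ xyz(4) r3(1) g4(1), of 2 1 0 1 v "\<lambda>_. 0"] v M3 vW3
      by (auto simp: perm_def lessThan3)
  qed
  \<comment> \<open>Lengthening the branch of \<open>x\<close>, where position 0 sits, exchanges
    positions 1 and 2, which is \<open>perm 2\<close>. From here on the graph is connected.\<close>
  have M5: "models v (D E 3 ?W5) ((\<lambda>_. 0)(1 := Suc 0, 2 := Suc 0))"
  proof -
    have "nbrs E (?W4 - {x}) u = {z, y}" using n4(1) xyz(4,5) by (auto simp: nbrs_def)
    then show ?thesis
      using stage[OF E _ _ n4(2) _ xyz(6)[symmetric] p4(1) g5(1), of 0 1 2 2 v "(\<lambda>_. 0)(1 := Suc 0)"] v M4 vW[of ?W4]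
      by (auto simp: perm_def lessThan3)
  qed
  have full5: "full v (D E 3 ?W5) 2"
    unfolding full_def
  proof (intro allI impI)
    fix N :: "nat \<Rightarrow> nat" assume N: "0 < N 1" "0 < N 2" "N 0 + N 1 + N 2 = 2"
    then have "N 0 = 0" "N 1 = 1" "N 2 = 1" by linarith+
    then have "((\<lambda>_. 0)(1 := Suc 0, 2 := Suc 0)) f = N f" if "f < 3" for f
      using less3_cases[OF that] by auto
    then show "models v (D E 3 ?W5) N" by (rule models_cong[OF _ M5])
  qed
  \<comment> \<open>The third branch is no longer handled by hand. Its single arc counts the two
    other neighbours \<open>x\<close> and \<open>z\<close> of \<open>u\<close>, less one.\<close>
  have b6: "builds (D E 3 ?W5) 1 (D E 3 ?W6)"
  proof (rule builds_D_3_leaf[OF E _ q5 g6(1)])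
    let ?W = "?W5 - {y}"
    have iW: "insert y ?W = ?W5" by auto
    have "nbrs E ?W y = {u}" "nbrs E ?W u = {x, z}" using n5(1,3) xyz(4,6) xyzu by (auto simp: nbrs_def)
    moreover have "u \<in> ?W" using xyzu by auto
    ultimately have "builds (D E 2 ?W) (card {x, z} - 1) (D E 2 (insert y ?W))"
      using builds_D_2_leaf[OF E, of ?W y u] by simp
    then show "builds (D E 2 ?W) 1 (D E 2 ?W5)" unfolding iW using xyz(5) by simp
  qed simp
  have full6: "full v (D E 3 ?W6) (2 + 1)"
    by (rule builds_full[OF b6 cplx_D[OF E] finite_D cplx_D[OF E] vW full5]) auto
  note bs = branch_sum_insert[OF E fV F]
  \<comment> \<open>Only \<open>u\<close> branches, with degree 3, so the value is 3 binom(2, 2) + 2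
    binom(2, 3), in agreement with the three orbits of arcs attached so far.\<close>
  have rank6: "rank E ?W6 = 3"
  proof -
    have "branch_sum E ?W6 k = (2 choose k)" if "k = 2 \<or> k = 3" for k
    proof -
      have k: "0 < k" "0 choose k = 0" "1 choose k = 0" "Suc 0 choose k = 0" using that by auto
      have "branch_sum E ?W0 k = 0" using k n0 by (simp add: branch_sum_def)
      then have "branch_sum E ?W1 k = 0" using bs[OF V0(1) st0 xyzV(1) x0 xyzV(4) k(1)] n0 k by simp
      then have "branch_sum E ?W2 k = 0" using bs[OF V0(2) st1 xyzV(2) y1 xyzV(5) k(1)] n1 k by simp
      then have "branch_sum E ?W3 k = (2 choose k)" using bs[OF V0(3) g2(2) xyzV(3) z2 xyzV(6) k(1)] n2 xyz(4) k
        by (simp add: numeral_2_eq_2)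
      then have "branch_sum E ?W4 k = (2 choose k)" using bs[OF V0(4) g3(2) pqr(3) r3 pqr(9) k(1)] n3 k by simp
      then have "branch_sum E ?W5 k = (2 choose k)" using bs[OF V0(5) g4(2) pqr(1) p4 pqr(7) k(1)] n4 k by simp
      then show ?thesis using bs[OF V0(6) g5(2) pqr(2) q5 pqr(8) k(1)] n5 k by simp
    qed
    then show ?thesis by (simp add: rank_def)
  qed
  define P where "P W m \<longleftrightarrow> vpt v \<in> geom (D E 3 W) \<and> 2 \<le> m \<and> full v (D E 3 W) m" for W m
  have "P V (rank E V)"
  proof (rule tree_growth[OF E fV F finite_tree_cross[OF T] sd _ V0(7) g6(2)])
    show "P W' (m + n)" if "P W m" "W \<subseteq> W'" "W' \<subseteq> V" "builds (D E 3 W) n (D E 3 W')" for W W' m n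
    proof -
      have "finite W" by (rule finite_subset[OF subset_trans[OF that(2,3)] fV])
      then have "full v (D E 3 W') (m + n)"
        using builds_full[OF that(4) cplx_D[OF E] finite_D cplx_D[OF E]] that(1) by (auto simp: P_def)
      then show ?thesis using that(1) geom_mono[OF D_mono[OF that(2)]] by (auto simp: P_def)
    qed
    show "nbrs E ?W6 a \<noteq> {}" if "a \<in> ?W6" for a using that n6 by auto
    show "card (nbrs E ?W6 b) = 2 \<and> card (nbrs E V b) = 2" if ab: "a \<in> ?W6" "nbrs E ?W6 a = {b}" for a b
    proof -
      have "p \<noteq> u" "q \<noteq> u" "r \<noteq> u" using pqr by auto
      then have "nbrs E ?W6 x \<noteq> {b}" "nbrs E ?W6 y \<noteq> {b}" "nbrs E ?W6 z \<noteq> {b}" "nbrs E ?W6 u \<noteq> {b}"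
        unfolding n6 using xyz(4) by (auto simp: doubleton_eq_iff)
      then have "a \<in> {p, q, r}" using ab by auto
      then have "b \<in> {x, y, z}" using ab(2) n6(5-7) by auto
      moreover have "card (nbrs E ?W6 c) = 2 \<and> card (nbrs E V c) = 2" if "c \<in> {x, y, z}" for c
        using that n6 deg2 xyzV pqr(4-6) by auto
      ultimately show ?thesis by blast
    qed
    show "P ?W6 (rank E ?W6)" unfolding rank6 P_def using full6 vW[of ?W6] by auto
  qed
  then have full: "full v (D E 3 V) (rank E V)" by (simp add: P_def)
  have m: "m_num V E 2 = branch_sum E V 2" "m_num V E 3 = branch_sum E V 3"
    by (simp_all add: m_num_eq_branch_sum[OF T])
  \<comment> \<open>The essential vertex makes m_2 positive, so the multiplicities of the target
    graph satisfy the conditions on families 1 and 2 in \<open>full\<close>.\<close>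
  have "0 < (card (nbrs E V u) - 1) choose 2" using u(2) by (simp add: zero_less_binomial_iff)
  also have "\<dots> \<le> branch_sum E V 2"
    unfolding branch_sum_def by (rule member_le_sum[OF u(1)]) (use fV in auto)
  finally have "0 < branch_sum E V 2" .
  then have "models v (D E 3 V) (fam_mult V E)"
    using full by (simp add: full_def fam_mult_def rank_def m)
  then obtain f h where "geqv (DConf 3 V E) conf_act (G3_real V E) ract f h"
    unfolding models_def G3_real DConf_eq_geom[OF T] by blast
  then show ?thesis
    using geqv_imp_equiv_homotopy_equivalent G3_action_ract by blast
qed

end
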